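(* For every choice of data as in the context there exists a solution $(m,V)=(m_1,\dots,m_L,V_1,\dots,V_L)\in\left[C^2(\Omega)\cap C^1(\bar\Omega)\right]^{2L}$ of the innovation MFG system. Furthermore, if $\sum_{\ell'=1}^L A_{\ell'}\,p(\ell,\ell')$ is small enough for every $\ell=1,\dots,L$ (that is, there is $\varepsilon>0$ depending only on $L,\bar z,\sigma,\rho,w,\alpha,\gamma,B$ such that the following holds whenever $\sum_{\ell'=1}^L A_{\ell'}\,p(\ell,\ell')<\varepsilon$ for every $\ell$), then the solution is unique.
   Context: Data: an integer $L\ge 1$; $\Omega=(0,\bar z)$ with $\bar z>0$; constants $\sigma>0$, $\rho>0$, $w>0$, $B>0$, $\alpha\in(0,1)$, $\gamma\in(0,1)$; weights $A_\ell\in(0,1)$ with $\sum_{\ell=1}^L A_\ell=1$; and nonnegative real numbers $p(\ell,\ell')$, $\ell,\ell'=1,\dots,L$. For $\ell=1,\dots,L$, $z\in\Omega$, $m=(m_1,\dots,m_L)\in (H^1(\Omega))^L$, $\lambda\in\mathbb{R}$ define the Hamiltonian $$H_\ell(z,m,\lambda)=(1-\gamma)\left(\tfrac{\gamma}{w}\right)^{\frac{\gamma}{1-\gamma}}\max(0,\lambda)^{\frac{1}{1-\gamma}}+\lambda\sum_{\ell'=1}^L A_{\ell'}p(\ell,\ell')\int_\Omega z' m_{\ell'}(z')\,dz'+\frac{z^\alpha}{B^{\alpha-1}},$$ so that $\partial_\lambda H_\ell(z,m,\lambda)=\left(\tfrac{\gamma}{w}\max(0,\lambda)\right)^{\frac{\gamma}{1-\gamma}}+\sum_{\ell'=1}^L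 A_{\ell'}p(\ell,\ell')\int_\Omega z' m_{\ell'}(z')\,dz'$. The innovation MFG system is: for every $\ell=1,\dots,L$, $V_\ell\in H^1(\Omega)$, $m_\ell\in H^1(\Omega)$ and $$-\tfrac{\sigma^2}{2}V_\ell''+\rho V_\ell-H_\ell(z,m,V_\ell')=0 \ \text{ in }\Omega,\qquad V_\ell'|_{z=0,\bar z}=0,$$ $$-\tfrac{\sigma^2}{2}m_\ell''+\left(\partial_\lambda H_\ell(z,m,V_\ell')\,m_\ell\right)'=0\ \text{ in }\Omega,\qquad \left.-\tfrac{\sigma^2}{2}m_\ell'+\partial_\lambda H_\ell(z,m,0)\,m_\ell\right|_{z=0,\bar z}=0,\qquad \int_\Omega m_\ell(z)\,dz=1.$$ A solution is a tuple $(m_1,\dots,m_L,V_1,\dots,V_L)$ with $m_\ell:\Omega\to(0,\infty)$ and $V_\ell:\Omega\to\mathbb{R}$ satisfying this system in the weak sense for each $\ell$, i.e. the nonlinear terms $H_\ell(\cdot,m,V_\ell')$ and $\partial_\lambda H_\ell(\cdot,m,V_\ell')m_\ell$ are integrable and, for all smooth test functions $\varphi$ on $\bar\Omega$, $\int_\Omega \frac{\sigma^2}{2}V_\ell'\varphi'+\rho V_\ell\varphi-H_\ell(z,m,V_\ell')\varphi\,dz=0$ and $\int_\Omega\left(\frac{\sigma^2}{2}m_\ell'-\partial_\lambda H_\ell(z,m,V_\ell')m_\ell\right)\varphi'\,dz=0$, together with $\int_\Omega m_\ell=1$. For functions with $C^2(\Omega)\cap C^1(\bar\Omega)$ regularity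 this is the pointwise system with its boundary conditions. *)

theory Defs
  imports "HOL-Analysis.Analysis"
begin

abbreviation Omega :: "real \<Rightarrow> real set"
  where "Omega zb \<equiv> {0<..<zb}"


subsection \<open>Function spaces on an interval\<close>

definition smooth :: "(real \<Rightarrow> real) \<Rightarrow> bool"
  where "smooth \<phi> \<longleftrightarrow> (\<forall>n x. ((deriv ^^ n) \<phi>) field_differentiable (at x))"

definition test_fun :: "real \<Rightarrow> (real \<Rightarrow> real) \<Rightarrow> bool"
  where "test_fun zb \<phi> \<longleftrightarrow> smooth \<phi> \<and>
    compact (closure {x. \<phi> x \<noteq> 0}) \<and> closure {x. \<phi> x \<noteq> 0} \<subseteq> Omega zb"

definition L2 :: "real \<Rightarrow> (real \<Rightarrow> real) set"
  where "L2 zb = {u. u \<in> borel_measurable (lebesgue_on (Omega zb)) \<and>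
    integrable (lebesgue_on (Omega zb)) (\<lambda>z. (u z)\<^sup>2)}"

definition is_weak_deriv :: "real \<Rightarrow> (real \<Rightarrow> real) \<Rightarrow> (real \<Rightarrow> real) \<Rightarrow> bool"
  where "is_weak_deriv zb u g \<longleftrightarrow> (\<forall>\<phi>. test_fun zb \<phi> \<longrightarrow>
    (LINT z|lebesgue_on (Omega zb). u z * deriv \<phi> z) =
      - (LINT z|lebesgue_on (Omega zb). g z * \<phi> z))"

definition H1 :: "real \<Rightarrow> (real \<Rightarrow> real) set"
  where "H1 zb = {u \<in> L2 zb. \<exists>g \<in> L2 zb. is_weak_deriv zb u g}"

text \<open>The weak derivative of an element of \<open>H1 zb\<close> is determined up to a null set; everything
  below is insensitive to the representative picked here.\<close>

definition weak_deriv :: "real \<Rightarrow> (real \<Rightarrow> real) \<Rightarrow> real \<Rightarrow> real"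
  where "weak_deriv zb u = (SOME g. g \<in> L2 zb \<and> is_weak_deriv zb u g)"

text \<open>$C^2(\Omega) \cap C^1(\bar\Omega)$; derivatives at the two endpoints are one-sided.\<close>

definition C2_C1 :: "real \<Rightarrow> (real \<Rightarrow> real) set"
  where "C2_C1 zb = {f. \<exists>f' f''.
    (\<forall>z\<in>{0..zb}. (f has_real_derivative f' z) (at z within {0..zb})) \<and>
    continuous_on {0..zb} f' \<and>
    (\<forall>z\<in>Omega zb. (f' has_real_derivative f'' z) (at z)) \<and>
    continuous_on (Omega zb) f''}"


subsection \<open>The innovation MFG system\<close>

text \<open>Families indexed by $\ell = 1,\dots,L$ are functions on \<open>nat\<close> of which only the values on
  \<open>{1..L}\<close> matter; likewise only the values on \<open>Omega zb\<close> of a function of the state matter.\<close>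

definition spillover ::
  "nat \<Rightarrow> real \<Rightarrow> (nat \<Rightarrow> real) \<Rightarrow> (nat \<Rightarrow> nat \<Rightarrow> real) \<Rightarrow> nat \<Rightarrow> (nat \<Rightarrow> real \<Rightarrow> real) \<Rightarrow> real"
  where "spillover L zb A p l m =
    (\<Sum>l'=1..L. A l' * p l l' * (LINT z'|lebesgue_on (Omega zb). z' * m l' z'))"

definition hamiltonian ::
  "nat \<Rightarrow> real \<Rightarrow> real \<Rightarrow> real \<Rightarrow> real \<Rightarrow> real \<Rightarrow> (nat \<Rightarrow> real) \<Rightarrow> (nat \<Rightarrow> nat \<Rightarrow> real) \<Rightarrow>
    nat \<Rightarrow> real \<Rightarrow> (nat \<Rightarrow> real \<Rightarrow> real) \<Rightarrow> real \<Rightarrow> real"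
  where "hamiltonian L zb w B \<alpha> \<gamma> A p l z m lam =
    (1 - \<gamma>) * (\<gamma> / w) powr (\<gamma> / (1 - \<gamma>)) * (max 0 lam) powr (1 / (1 - \<gamma>))
    + lam * spillover L zb A p l m
    + z powr \<alpha> / B powr (\<alpha> - 1)"

definition d_hamiltonian ::
  "nat \<Rightarrow> real \<Rightarrow> real \<Rightarrow> real \<Rightarrow> real \<Rightarrow> real \<Rightarrow> (nat \<Rightarrow> real) \<Rightarrow> (nat \<Rightarrow> nat \<Rightarrow> real) \<Rightarrow>
    nat \<Rightarrow> real \<Rightarrow> (nat \<Rightarrow> real \<Rightarrow> real) \<Rightarrow> real \<Rightarrow> real"
  where "d_hamiltonian L zb w B \<alpha> \<gamma> A p l z m lam =
    deriv (\<lambda>x. hamiltonian L zb w B \<alpha> \<gamma> A p l z m x) lam"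

lemma max_powr_has_derivative:
  fixes q lam :: real
  assumes q: "q > 1"
  shows "((\<lambda>x. (max 0 x) powr q) has_real_derivative q * (max 0 lam) powr (q - 1)) (at lam)"
proof -
  consider "lam > 0" | "lam < 0" | "lam = 0" by linarith
  then show ?thesis
  proof cases
    case 1
    have "((\<lambda>x. x powr q) has_real_derivative q * lam powr (q - 1)) (at lam)"
      using 1 by (rule has_real_derivative_powr)
    then have "((\<lambda>x. (max 0 x) powr q) has_real_derivative q * lam powr (q - 1)) (at lam)"
      by (rule has_field_derivative_transform_within_open[where S = "{0<..}"]) (use 1 in auto)
    then show ?thesis using 1 by simp
  next
    case 2
    have "((\<lambda>x. 0) has_real_derivative 0) (at lam)" by simp
    then have "((\<lambda>x. (max 0 x) powr q) has_real_derivative 0) (at lam)"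
      by (rule has_field_derivative_transform_within_open[where S = "{..<0}"]) (use 2 in auto)
    then show ?thesis using 2 by simp
  next
    case 3
    have "((\<lambda>h. \<bar>h\<bar> powr (q - 1)) \<longlongrightarrow> \<bar>0\<bar> powr (q - 1)) (at (0::real))"
      using q by (intro tendsto_powr' tendsto_intros) auto
    then have lim: "((\<lambda>h. \<bar>h\<bar> powr (q - 1)) \<longlongrightarrow> 0) (at (0::real))"
      using q by simp
    have bound: "norm (((max 0 (0 + h)) powr q - (max 0 0) powr q) / h) \<le> \<bar>h\<bar> powr (q - 1)"
      for h :: real
    proof (cases "h > 0")
      case True
      then have "h powr q / h = h powr (q - 1)" by (simp add: powr_diff)
      with True show ?thesis by simp
    qed auto
    have "((\<lambda>h. ((max 0 (0 + h)) powr q - (max 0 0) powr q) / h) \<longlongrightarrow> 0) (at (0::real))"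
      by (rule Lim_null_comparison[OF _ lim]) (use bound in simp)
    then have "((\<lambda>x. (max 0 x) powr q) has_real_derivative 0) (at 0)"
      unfolding DERIV_def .
    then show ?thesis using 3 q by simp
  qed
qed

lemma d_hamiltonian_eq:
  assumes "0 < \<gamma>" "\<gamma> < 1" "w > 0"
  shows "d_hamiltonian L zb w B \<alpha> \<gamma> A p l z m lam =
    (\<gamma> / w * max 0 lam) powr (\<gamma> / (1 - \<gamma>)) + spillover L zb A p l m"
proof -
  have q: "1 / (1 - \<gamma>) > 1" and e: "1 / (1 - \<gamma>) - 1 = \<gamma> / (1 - \<gamma>)"
    using assms by (auto simp: field_simps)
  let ?k = "(1 - \<gamma>) * (\<gamma> / w) powr (\<gamma> / (1 - \<gamma>))"
  have "((\<lambda>x. hamiltonian L zb w B \<alpha> \<gamma> A p l z m x) has_real_derivative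
      ?k * (1 / (1 - \<gamma>) * (max 0 lam) powr (1 / (1 - \<gamma>) - 1)) + 1 * spillover L zb A p l m + 0) (at lam)"
    unfolding hamiltonian_def
    by (intro DERIV_add DERIV_cmult DERIV_cmult_right DERIV_const DERIV_ident
        max_powr_has_derivative[OF q])
  moreover have "?k * (1 / (1 - \<gamma>) * (max 0 lam) powr (1 / (1 - \<gamma>) - 1))
      = (\<gamma> / w * max 0 lam) powr (\<gamma> / (1 - \<gamma>))"
    using assms unfolding e by (subst powr_mult) auto
  ultimately show ?thesis
    unfolding d_hamiltonian_def by (simp add: DERIV_imp_deriv)
qed

text \<open>Weak solutions. Smooth test functions on $\bar\Omega$ are restrictions of smooth functions
  on the real line; since they need not vanish at the endpoints, the boundary conditions
  are contained in the two integral identities. Positivity is imposed at every point of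
  $\Omega$: for \<open>H1\<close> classes this is no loss of generality, as a representative can be changed on a
  null set, and for continuous solutions it is stronger than positivity almost everywhere.\<close>

definition mfg_solution ::
  "nat \<Rightarrow> real \<Rightarrow> real \<Rightarrow> real \<Rightarrow> real \<Rightarrow> real \<Rightarrow> real \<Rightarrow> real \<Rightarrow>
    (nat \<Rightarrow> real) \<Rightarrow> (nat \<Rightarrow> nat \<Rightarrow> real) \<Rightarrow>
    (nat \<Rightarrow> real \<Rightarrow> real) \<Rightarrow> (nat \<Rightarrow> real \<Rightarrow> real) \<Rightarrow> bool"
  where "mfg_solution L zb \<sigma> \<rho> w B \<alpha> \<gamma> A p m V \<longleftrightarrow>
    (\<forall>l\<in>{1..L}. m l \<in> H1 zb \<and> V l \<in> H1 zb \<and> (\<forall>z\<in>Omega zb. m l z > 0)) \<and>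
    (\<forall>l\<in>{1..L}.
      (let \<Omega> = lebesgue_on (Omega zb);
           V' = weak_deriv zb (V l);
           m' = weak_deriv zb (m l);
           H = (\<lambda>z. hamiltonian L zb w B \<alpha> \<gamma> A p l z m (V' z));
           dH = (\<lambda>z. d_hamiltonian L zb w B \<alpha> \<gamma> A p l z m (V' z))
       in integrable \<Omega> H \<and>
          integrable \<Omega> (\<lambda>z. dH z * m l z) \<and>
          (\<forall>\<phi>. smooth \<phi> \<longrightarrow>
             (LINT z|\<Omega>. \<sigma>\<^sup>2 / 2 * V' z * deriv \<phi> z + \<rho> * V l z * \<phi> z - H z * \<phi> z) = 0) \<and>
          (\<forall>\<phi>. smooth \<phi> \<longrightarrow>
             (LINT z|\<Omega>. (\<sigma>\<^sup>2 / 2 * m' z - dH z * m l z) * deriv \<phi> z) = 0) \<and>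
          (LINT z|\<Omega>. m l z) = 1))"

definition mfg_weights :: "nat \<Rightarrow> (nat \<Rightarrow> real) \<Rightarrow> (nat \<Rightarrow> nat \<Rightarrow> real) \<Rightarrow> bool"
  where "mfg_weights L A p \<longleftrightarrow>
    (\<forall>l\<in>{1..L}. 0 < A l \<and> A l < 1) \<and> (\<Sum>l=1..L. A l) = 1 \<and>
    (\<forall>l\<in>{1..L}. \<forall>l'\<in>{1..L}. p l l' \<ge> 0)"

end

theory Submission
  imports Defs
begin

text \<open>
  The populations interact only through the numbers
  \<open>s\<^sub>\<ell> = \<Sum> A\<^sub>\<ell>\<^sub>' p(\<ell>, \<ell>') \<integral> z m\<^sub>\<ell>\<^sub>'\<close>. For a fixed \<open>s \<ge> 0\<close> the Hamilton-Jacobi equation is solved by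
  shooting: the maximum principle bounds the slope \<open>u = V'\<close> independently of the growth of the
  Hamiltonian, so it may be truncated. The Fokker-Planck equation has zero flux, so its solution
  is an explicit exponential of the primitive of the drift \<open>g(u) + s\<close>, and an equilibrium is a
  fixed point of a map on the first moments in \<open>[0, zb]\<^sup>L\<close>, which exists by Brouwer's theorem.

  Uniqueness for weak interaction is a contraction argument and needs the drift to be Lipschitz
  in \<open>s\<close>, although \<open>g\<close> is only Hoelder continuous at 0 when \<open>\<gamma> < 1/2\<close>. This is saved by a Hopf
  bound \<open>u \<ge> \<kappa> z (zb - z)\<close>: the difference of two slopes is at most \<open>C \<bar>s - s'\<bar> z (zb - z)\<close>, so
  their ratio is Lipschitz close to 1. Weak solutions are classical by du Bois-Reymond's lemma.
\<close>

subsection \<open>Brouwer fixed points of a cube with indexed coordinates\<close>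

text \<open>Once the spillovers are frozen, the \<open>L\<close> populations decouple and the
  Hamilton-Jacobi equation no longer sees the densities, so the analysis is one-dimensional and
  depends on a single number \<open>s \<ge> 0\<close>. The number \<open>L\<close> is a variable and
  not the dimension of a type; Brouwer's theorem is therefore derived from Kuhn's combinatorial
  lemma on coordinates indexed by \<open>nat\<close>. Existence takes its continuity from the same
  Lipschitz estimate as uniqueness. The possible failure of \<open>g\<close> to be differentiable at
  0 is met a second time in the regularity of \<open>m\<close>: its second derivative exists in the
  open interval because \<open>u > 0\<close> there. All constants are uniform for \<open>s\<close>
  in a bounded interval; for uniqueness this interval is fixed before the weights are, so \<epsilon>
  does not depend on them.\<close>

lemma seq_compact_cube:
  fixes X :: "nat \<Rightarrow> nat \<Rightarrow> real"
  assumes "\<And>k j. j < n \<Longrightarrow> X k j \<in> {0..1}"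
  shows "\<exists>r x. strict_mono (r :: nat \<Rightarrow> nat) \<and> (\<forall>j<n. x j \<in> {0..1} \<and> (\<lambda>k. X (r k) j) \<longlonglongrightarrow> x j)"
  using assms
proof (induction n)
  case 0
  show ?case by (rule exI[of _ id]) (simp add: strict_mono_def)
next
  case (Suc n)
  then obtain r x where r: "strict_mono (r :: nat \<Rightarrow> nat)"
    and x: "\<forall>j<n. x j \<in> {0..1} \<and> (\<lambda>k. X (r k) j) \<longlonglongrightarrow> x j"
    by (metis less_Suc_eq)
  have "seq_compact {0..1::real}"
    by (simp add: compact_imp_seq_compact)
  moreover have "\<forall>k. X (r k) n \<in> {0..1}" using Suc.prems by simp
  ultimately obtain l r' where l: "l \<in> {0..1}" "strict_mono (r' :: nat \<Rightarrow> nat)"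
    "((\<lambda>k. X (r k) n) \<circ> r') \<longlonglongrightarrow> l"
    by (rule seq_compactE)
  show ?case
  proof (intro exI conjI allI impI)
    show "strict_mono (r \<circ> r')" using r l(2) by (rule strict_mono_o)
    fix j assume "j < Suc n"
    show "(x(n := l)) j \<in> {0..1}" using \<open>j < Suc n\<close> x l by (auto simp: less_Suc_eq)
    show "(\<lambda>k. X ((r \<circ> r') k) j) \<longlonglongrightarrow> (x(n := l)) j"
    proof (cases "j = n")
      case True then show ?thesis using l(3) by (simp add: o_def)
    next
      case False
      with \<open>j < Suc n\<close> x have "(\<lambda>k. X (r k) j) \<longlonglongrightarrow> x j" by auto
      from LIMSEQ_subseq_LIMSEQ[OF this l(2)] False show ?thesis by (simp add: o_def)
    qed
  qed
qed

text \<open>Kuhn's lemma on the grid of mesh \<open>1 / Suc N\<close> yields a cell in which every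
  coordinate \<open>i\<close> has one vertex that \<open>F i\<close> does not push down and one that
  it does not push up. As the grid is refined, a subsequence of the cells shrinks to one point.
  Sequential continuity in the first \<open>n\<close> coordinates also forces \<open>F i\<close> to
  ignore the remaining ones.\<close>

lemma brouwer_unit_cube_nat:
  fixes F :: "nat \<Rightarrow> (nat \<Rightarrow> real) \<Rightarrow> real"
  assumes range: "\<And>i x. i < n \<Longrightarrow> (\<forall>j<n. x j \<in> {0..1}) \<Longrightarrow> F i x \<in> {0..1}"
    and cont: "\<And>i X x. i < n \<Longrightarrow> (\<forall>k. \<forall>j<n. X k j \<in> {0..1}) \<Longrightarrow> (\<forall>j<n. x j \<in> {0..1}) \<Longrightarrow>
      (\<forall>j<n. (\<lambda>k. X k j) \<longlonglongrightarrow> x j) \<Longrightarrow> (\<lambda>k. F i (X k)) \<longlonglongrightarrow> F i x"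
  obtains x where "\<And>i. i < n \<Longrightarrow> x i \<in> {0..1}" "\<And>i. i < n \<Longrightarrow> F i x = x i"
proof -
  define P where "P N q r s \<longleftrightarrow>
    (\<forall>j<n. q j < Suc N) \<and>
    (\<forall>i<n. (\<forall>j<n. q j \<le> r i j \<and> r i j \<le> q j + 1) \<and> (\<forall>j<n. q j \<le> s i j \<and> s i j \<le> q j + 1) \<and>
      F i (\<lambda>j. real (r i j) / Suc N) \<ge> real (r i i) / Suc N \<and>
      F i (\<lambda>j. real (s i j) / Suc N) \<le> real (s i i) / Suc N)"
    for N and q :: "nat \<Rightarrow> nat" and r s :: "nat \<Rightarrow> nat \<Rightarrow> nat"
  have "\<exists>q r s. P N q r s" for N
  proof -
    let ?p = "Suc N"
    \<comment> \<open>Label 1 stands for a point that \<open>F i\<close> moves down. The clause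
      \<open>x i = ?p\<close> gives label 1 on the upper face, as Kuhn's lemma demands, even where
      \<open>F i\<close> fixes the value 1; on the lower face the range of \<open>F\<close> excludes
      label 1.\<close>
    define label where "label x i = (if x i = ?p \<or> F i (\<lambda>j. real (x j) / ?p) < real (x i) / ?p then 1 else 0::nat)"
      for x :: "nat \<Rightarrow> nat" and i
    have in01: "\<forall>j<n. real (x j) / ?p \<in> {0..1}" if "\<forall>j<n. x j \<le> ?p" for x
      using that by auto
    have lab1: "F i (\<lambda>j. real (x j) / ?p) \<le> real (x i) / ?p" if "\<forall>j<n. x j \<le> ?p" "i < n" "label x i \<noteq> 0" for x i
      using range[OF that(2) in01[OF that(1)]] that(3)
      by (auto simp: label_def split: if_splits)
    have lab0: "F i (\<lambda>j. real (x j) / ?p) \<ge> real (x i) / ?p" if "label x i = 0" for x i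
      using that by (auto simp: label_def split: if_splits)
    have "0 < ?p" by simp
    moreover have "\<forall>x. (\<forall>i<n. x i \<le> ?p) \<longrightarrow> (\<forall>i<n. label x i = 0 \<or> label x i = 1)"
      by (simp add: label_def)
    moreover have "\<forall>x. (\<forall>i<n. x i \<le> ?p) \<longrightarrow> (\<forall>i<n. x i = 0 \<longrightarrow> label x i = 0)"
    proof (intro allI impI)
      fix x i assume "\<forall>i<n. x i \<le> ?p" "i < n" "x i = (0::nat)"
      then show "label x i = 0" using range[OF _ in01, of i x] by (auto simp: label_def)
    qed
    moreover have "\<forall>x. (\<forall>i<n. x i \<le> ?p) \<longrightarrow> (\<forall>i<n. x i = ?p \<longrightarrow> label x i = 1)"
      by (simp add: label_def)
    ultimately obtain q where q: "\<forall>i<n. q i < ?p"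
      "\<forall>i<n. \<exists>r s. (\<forall>j<n. q j \<le> r j \<and> r j \<le> q j + 1) \<and> (\<forall>j<n. q j \<le> s j \<and> s j \<le> q j + 1) \<and> label r i \<noteq> label s i"
      by (rule kuhn_lemma)
    have "\<exists>r s. (\<forall>j<n. q j \<le> r j \<and> r j \<le> q j + 1) \<and> (\<forall>j<n. q j \<le> s j \<and> s j \<le> q j + 1) \<and>
       F i (\<lambda>j. real (r j) / ?p) \<ge> real (r i) / ?p \<and> F i (\<lambda>j. real (s j) / ?p) \<le> real (s i) / ?p" if i: "i < n" for i
    proof -
      from q(2) i obtain r s where rs: "\<forall>j<n. q j \<le> r j \<and> r j \<le> q j + 1" "\<forall>j<n. q j \<le> s j \<and> s j \<le> q j + 1"
        "label r i \<noteq> label s i" by blast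
      have le: "\<forall>j<n. r j \<le> ?p" "\<forall>j<n. s j \<le> ?p" using rs q(1) by force+
      show ?thesis
      proof (cases "label r i = 0")
        case True
        with rs(3) lab0[OF True] lab1[OF le(2) i] rs show ?thesis by (intro exI[of _ r] exI[of _ s]) auto
      next
        case False
        then have "label s i = 0" using rs(3) by (auto simp: label_def split: if_splits)
        with lab0[OF this] lab1[OF le(1) i False] rs show ?thesis by (intro exI[of _ s] exI[of _ r]) auto
      qed
    qed
    then obtain r s where "\<forall>i<n. (\<forall>j<n. q j \<le> r i j \<and> r i j \<le> q j + 1) \<and> (\<forall>j<n. q j \<le> s i j \<and> s i j \<le> q j + 1) \<and>
       F i (\<lambda>j. real (r i j) / ?p) \<ge> real (r i i) / ?p \<and> F i (\<lambda>j. real (s i j) / ?p) \<le> real (s i i) / ?p"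
      by metis
    then show ?thesis using q(1) unfolding P_def by blast
  qed
  then obtain q r s where P: "\<And>N. P N (q N) (r N) (s N)" by metis
  have q01: "real (q N j) / Suc N \<in> {0..1}" if "j < n" for N j
  proof -
    have "q N j < Suc N" using P[of N] that unfolding P_def by blast
    then have "real (q N j) \<le> real (Suc N)" by simp
    then show ?thesis by (simp add: divide_le_eq del: of_nat_Suc)
  qed
  from seq_compact_cube[of n "\<lambda>N j. real (q N j) / Suc N", OF q01]
  obtain \<tau> x where \<tau>: "strict_mono (\<tau> :: nat \<Rightarrow> nat)"
    and x: "\<forall>j<n. x j \<in> {0..1} \<and> (\<lambda>k. real (q (\<tau> k) j) / Suc (\<tau> k)) \<longlonglongrightarrow> x j"
    by blast
  \<comment> \<open>Every vertex of a cell differs from its corner \<open>q\<close> by at most one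
    grid step, so it has the same limit.\<close>
  have close: "(\<lambda>k. real (t k) / Suc (\<tau> k)) \<longlonglongrightarrow> x j"
    if "j < n" and t: "\<And>k. q (\<tau> k) j \<le> t k \<and> t k \<le> q (\<tau> k) j + 1" for t j
  proof (rule tendsto_sandwich)
    show "\<forall>\<^sub>F k in sequentially. real (q (\<tau> k) j) / Suc (\<tau> k) \<le> real (t k) / Suc (\<tau> k)"
      using t by (intro always_eventually allI divide_right_mono) auto
    show "\<forall>\<^sub>F k in sequentially. real (t k) / Suc (\<tau> k) \<le> real (q (\<tau> k) j) / Suc (\<tau> k) + 1 / Suc (\<tau> k)"
    proof (intro always_eventually allI)
      fix k
      have "real (t k) \<le> real (q (\<tau> k) j) + 1" using t[of k] by linarith
      then show "real (t k) / Suc (\<tau> k) \<le> real (q (\<tau> k) j) / Suc (\<tau> k) + 1 / Suc (\<tau> k)"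
        by (metis add_divide_distrib divide_right_mono of_nat_0_le_iff)
    qed
    show "(\<lambda>k. real (q (\<tau> k) j) / Suc (\<tau> k)) \<longlonglongrightarrow> x j" using x \<open>j < n\<close> by blast
    have "(\<lambda>k. inverse (real (Suc k))) \<longlonglongrightarrow> 0" by (rule LIMSEQ_inverse_real_of_nat)
    from LIMSEQ_subseq_LIMSEQ[OF this \<tau>] have "(\<lambda>k. 1 / Suc (\<tau> k)) \<longlonglongrightarrow> 0"
      by (simp add: o_def inverse_eq_divide)
    with x \<open>j < n\<close> have "(\<lambda>k. real (q (\<tau> k) j) / Suc (\<tau> k) + 1 / Suc (\<tau> k)) \<longlonglongrightarrow> x j + 0"
      by (intro tendsto_add) auto
    then show "(\<lambda>k. real (q (\<tau> k) j) / Suc (\<tau> k) + 1 / Suc (\<tau> k)) \<longlonglongrightarrow> x j" by simp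
  qed
  have fixp: "F i x = x i" if i: "i < n" for i
  proof (rule antisym)
    have x01: "\<forall>j<n. x j \<in> {0..1}" using x by blast
    have unit: "real t / real (Suc N) \<in> {0..1}" if "t \<le> q N j + 1" "j < n" for t N j
    proof -
      have "q N j < Suc N" using P[of N] that unfolding P_def by blast
      with that have "t \<le> Suc N" by linarith
      then have "real t \<le> real (Suc N)" by (rule of_nat_mono)
      then show ?thesis by (simp add: divide_le_eq del: of_nat_Suc)
    qed
    have rr: "\<And>k j. j < n \<Longrightarrow> q (\<tau> k) j \<le> r (\<tau> k) i j \<and> r (\<tau> k) i j \<le> q (\<tau> k) j + 1"
      and ss: "\<And>k j. j < n \<Longrightarrow> q (\<tau> k) j \<le> s (\<tau> k) i j \<and> s (\<tau> k) i j \<le> q (\<tau> k) j + 1"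
      and Fr: "\<And>k. F i (\<lambda>j. real (r (\<tau> k) i j) / Suc (\<tau> k)) \<ge> real (r (\<tau> k) i i) / Suc (\<tau> k)"
      and Fs: "\<And>k. F i (\<lambda>j. real (s (\<tau> k) i j) / Suc (\<tau> k)) \<le> real (s (\<tau> k) i i) / Suc (\<tau> k)"
      using P i unfolding P_def by blast+
    have "(\<lambda>k. F i (\<lambda>j. real (r (\<tau> k) i j) / Suc (\<tau> k))) \<longlonglongrightarrow> F i x"
      using rr by (intro cont i x01 allI impI close unit) auto
    then show "x i \<le> F i x"
      by (rule LIMSEQ_le[rotated]) (use close[OF i rr[OF i]] Fr in auto)
    have "(\<lambda>k. F i (\<lambda>j. real (s (\<tau> k) i j) / Suc (\<tau> k))) \<longlonglongrightarrow> F i x"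
      using ss by (intro cont i x01 allI impI close unit) auto
    then show "F i x \<le> x i"
      by (rule LIMSEQ_le) (use close[OF i ss[OF i]] Fs in auto)
  qed
  show ?thesis by (rule that[of x]) (use x fixp in auto)
qed

subsection \<open>Smooth functions and test functions\<close>

text \<open>An invariant class closed under \<open>deriv\<close> replaces formulas for the n-th
  derivative, such as Leibniz' rule.\<close>

lemma smooth_coinduct:
  assumes "P f" and "\<And>f x. P f \<Longrightarrow> f field_differentiable (at x)" and "\<And>f. P f \<Longrightarrow> P (deriv f)"
  shows "smooth f"
proof -
  have "P ((deriv ^^ n) f)" for n by (induction n) (use assms in auto)
  then show ?thesis using assms(2) by (auto simp: smooth_def)
qed

lemma smooth_deriv: "smooth f \<Longrightarrow> smooth (deriv f)"
  unfolding smooth_def by (metis funpow_swap1 funpow.simps(2) o_apply)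

lemma smooth_has_derivative: "smooth f \<Longrightarrow> (f has_real_derivative deriv f x) (at x)"
  unfolding smooth_def by (metis DERIV_deriv_iff_field_differentiable funpow_0)

lemma smooth_field_differentiable: "smooth f \<Longrightarrow> f field_differentiable (at x)"
  unfolding smooth_def by (metis funpow_0)

lemma smooth_continuous_on: "smooth f \<Longrightarrow> continuous_on S f"
  by (meson DERIV_continuous_on has_field_derivative_at_within smooth_has_derivative)

lemma smooth_antiderivative:
  assumes "\<And>x. (f has_real_derivative g x) (at x)" and "smooth g"
  shows "smooth f"
proof -
  have "deriv f = g" using assms(1) by (auto simp: DERIV_imp_deriv)
  then show ?thesis
    by (intro smooth_coinduct[of "\<lambda>h. h = f \<or> smooth h"])
      (use assms in \<open>auto simp: smooth_deriv smooth_field_differentiable\<close>, auto simp: field_differentiable_def)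
qed

lemma smooth_const [simp]: "smooth (\<lambda>x. c)"
  by (rule smooth_coinduct[of "\<lambda>h. \<exists>c. h = (\<lambda>x. c)"]) auto

text \<open>Products alone are not closed under \<open>deriv\<close>, but finite sums of products
  are: this is the invariant class behind \<open>smooth_mult\<close> and
  \<open>smooth_add\<close>.\<close>

inductive prod_span :: "(real \<Rightarrow> real) \<Rightarrow> bool" where
  prod: "smooth f \<Longrightarrow> smooth g \<Longrightarrow> prod_span (\<lambda>x. f x * g x)"
| sum: "prod_span f \<Longrightarrow> prod_span g \<Longrightarrow> prod_span (\<lambda>x. f x + g x)"

lemma prod_span_deriv:
  "prod_span f \<Longrightarrow> (\<forall>x. f field_differentiable (at x)) \<and> prod_span (deriv f)"
proof (induction rule: prod_span.induct)
  case (prod f g)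
  have D: "((\<lambda>x. f x * g x) has_real_derivative (deriv f x * g x + f x * deriv g x)) (at x)" for x
    using prod by (auto intro!: derivative_eq_intros smooth_has_derivative)
  have "deriv (\<lambda>x. f x * g x) = (\<lambda>x. deriv f x * g x + f x * deriv g x)"
    using D by (intro ext DERIV_imp_deriv)
  then show ?case
    using D prod by (auto simp: field_differentiable_def intro!: prod_span.intros smooth_deriv)
next
  case (sum f g)
  have D: "((\<lambda>x. f x + g x) has_real_derivative (deriv f x + deriv g x)) (at x)" for x
    using sum by (intro DERIV_add) (auto simp: DERIV_deriv_iff_field_differentiable)
  have "deriv (\<lambda>x. f x + g x) = (\<lambda>x. deriv f x + deriv g x)"
    using D by (intro ext DERIV_imp_deriv)
  then show ?case
    using D sum by (auto simp: field_differentiable_def intro!: prod_span.intros)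
qed

lemma smooth_prod_span: "prod_span f \<Longrightarrow> smooth f"
  by (rule smooth_coinduct[of prod_span]) (auto dest: prod_span_deriv)

lemma smooth_mult: "smooth f \<Longrightarrow> smooth g \<Longrightarrow> smooth (\<lambda>x. f x * g x)"
  by (rule smooth_prod_span[OF prod_span.prod])

lemma smooth_add: "smooth f \<Longrightarrow> smooth g \<Longrightarrow> smooth (\<lambda>x. f x + g x)"
  using smooth_prod_span[OF prod_span.sum[OF prod_span.prod[of f "\<lambda>_. 1"] prod_span.prod[of g "\<lambda>_. 1"]]]
  by simp

lemma smooth_affine:
  assumes "smooth f" shows "smooth (\<lambda>x. f (a * x + b))"
\<comment> \<open>Each derivative contributes a factor \<open>a\<close>, so the class carries a free
  constant \<open>c\<close>.\<close>
proof (rule smooth_coinduct[of "\<lambda>h. \<exists>c f. smooth f \<and> h = (\<lambda>x. c * f (a * x + b))"])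
  show "\<exists>c g. smooth g \<and> (\<lambda>x. f (a * x + b)) = (\<lambda>x. c * g (a * x + b))"
    by (rule exI[of _ 1], rule exI[of _ f]) (use assms in auto)
next
  have D: "((\<lambda>x. c * f (a * x + b)) has_real_derivative (c * a) * deriv f (a * x + b)) (at x)"
    if "smooth f" for c f x
  proof -
    have "((\<lambda>x. a * x + b) has_real_derivative a) (at x)"
      by (auto intro!: derivative_eq_intros)
    from DERIV_cmult[OF DERIV_chain2[OF smooth_has_derivative[OF that] this], of c] show ?thesis
      by (simp add: mult_ac)
  qed
  show "f field_differentiable at x" if "\<exists>c g. smooth g \<and> f = (\<lambda>x. c * g (a * x + b))" for f x
    using D that unfolding field_differentiable_def by blast
  show "\<exists>c g. smooth g \<and> deriv f = (\<lambda>x. c * g (a * x + b))"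
    if "\<exists>c g. smooth g \<and> f = (\<lambda>x. c * g (a * x + b))" for f
  proof -
    from that obtain c g where g: "smooth g" "f = (\<lambda>x. c * g (a * x + b))" by blast
    have "deriv f = (\<lambda>x. (c * a) * deriv g (a * x + b))"
      unfolding g(2) using D[OF g(1)] by (intro ext DERIV_imp_deriv)
    then show ?thesis using smooth_deriv[OF g(1)] by blast
  qed
qed

section \<open>Flat functions and smooth bumps\<close>

definition flat :: "real poly \<Rightarrow> real \<Rightarrow> real" where
  "flat p x = (if x > 0 then poly p (1 / x) * exp (- (1 / x)) else 0)"

lemma tendsto_poly_exp_neg: "((\<lambda>y. poly p y * exp (- y)) \<longlongrightarrow> 0) (at_top :: real filter)"
proof -
  have "((\<lambda>y. \<Sum>i\<le>degree p. coeff p i * (y ^ i / exp y)) \<longlongrightarrow> (\<Sum>i\<le>degree p. coeff p i * 0)) (at_top :: real filter)"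
    by (intro tendsto_intros tendsto_power_div_exp_0)
  then show ?thesis
    by (simp add: poly_altdef sum_distrib_right exp_minus divide_inverse mult.assoc)
qed

text \<open>With y = 1/x the function is p(y) exp(-y), and its derivative in x is y^2 (p - p')(y)
  exp(-y). The polynomial in \<open>flat\<close> is there to make the class closed under
  derivatives; at 0 every polynomial is beaten by exp(-y).\<close>

lemma flat_has_derivative:
  "(flat p has_real_derivative flat ([:0, 0, 1:] * (p - pderiv p)) x) (at x)"
proof -
  consider "x > 0" | "x < 0" | "x = 0" by linarith
  then show ?thesis
  proof cases
    case 1
    have "((\<lambda>y. poly p (1 / y) * exp (- (1 / y))) has_real_derivative
        poly ([:0, 0, 1:] * (p - pderiv p)) (1 / x) * exp (- (1 / x))) (at x)"
      using 1 by (auto intro!: derivative_eq_intros poly_DERIV simp: field_simps power2_eq_square)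
    then have "(flat p has_real_derivative
        poly ([:0, 0, 1:] * (p - pderiv p)) (1 / x) * exp (- (1 / x))) (at x)"
      by (rule has_field_derivative_transform_within_open[where S = "{0<..}"])
        (use 1 in \<open>auto simp: flat_def\<close>)
    then show ?thesis using 1 by (simp add: flat_def)
  next
    case 2
    have "((\<lambda>y. 0) has_real_derivative 0) (at x)" by simp
    then have "(flat p has_real_derivative 0) (at x)"
      by (rule has_field_derivative_transform_within_open[where S = "{..<0}"])
        (use 2 in \<open>auto simp: flat_def\<close>)
    then show ?thesis using 2 by (simp add: flat_def)
  next
    case 3
    have "((\<lambda>h. flat p h / h) \<longlongrightarrow> 0) (at 0)"
    proof (rule filterlim_split_at)
      have "((\<lambda>h. 0) \<longlongrightarrow> 0) (at_left (0::real))" by simp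
      then show "((\<lambda>h. flat p h / h) \<longlongrightarrow> 0) (at_left 0)"
        by (rule Lim_transform_eventually)
          (auto simp: eventually_at_filter flat_def)
      \<comment> \<open>The difference quotient at 0 is y p(y) exp(-y) with y =
        \<open>inverse h\<close>, and \<open>pCons 0 p\<close> is the polynomial y p(y).\<close>
      have "((\<lambda>h. poly (pCons 0 p) (inverse h) * exp (- inverse h)) \<longlongrightarrow> 0) (at_right (0::real))"
        by (rule filterlim_compose[OF tendsto_poly_exp_neg filterlim_inverse_at_top_right])
      then show "((\<lambda>h. flat p h / h) \<longlongrightarrow> 0) (at_right 0)"
        by (rule Lim_transform_eventually)
          (auto simp: eventually_at_filter flat_def field_simps)
    qed
    then show ?thesis
      using 3 by (simp add: DERIV_def flat_def)
  qed
qed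

lemma smooth_flat: "smooth (flat p)"
proof (rule smooth_coinduct[of "\<lambda>h. \<exists>p. h = flat p"])
  have "deriv (flat p) = flat ([:0, 0, 1:] * (p - pderiv p))" for p
    using flat_has_derivative by (intro ext DERIV_imp_deriv)
  then show "\<exists>p. deriv f = flat p" if "\<exists>p. f = flat p" for f using that by metis
  show "f field_differentiable at x" if "\<exists>p. f = flat p" for f x
    using that flat_has_derivative unfolding field_differentiable_def by blast
qed auto


text \<open>The steepness \<open>n\<close> lets the bumps converge to the indicator of the open
  interval while they stay between 0 and 1, as dominated convergence requires.\<close>

definition bump :: "real \<Rightarrow> real \<Rightarrow> real \<Rightarrow> real \<Rightarrow> real" where
  "bump n a b x = flat 1 (n * (x - a)) * flat 1 (n * (b - x))"

lemma smooth_bump: "smooth (bump n a b)"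
proof -
  have "smooth (\<lambda>x. flat 1 (n * x + (- n * a)) * flat 1 (- n * x + n * b))"
    by (intro smooth_mult smooth_affine smooth_flat)
  then show ?thesis by (simp add: bump_def[abs_def] algebra_simps)
qed

lemma bump_pos_iff: "n > 0 \<Longrightarrow> bump n a b x \<noteq> 0 \<longleftrightarrow> a < x \<and> x < b"
  by (auto simp: bump_def flat_def zero_less_mult_iff)

lemma bump_bounds: "0 \<le> bump n a b x" "bump n a b x \<le> 1"
  by (auto simp: bump_def flat_def mult_le_one)

lemma test_fun_bump:
  assumes "n > 0" "0 < a" "a < b" "b < Z"
  shows "test_fun Z (bump n a b)"
proof -
  have "{x. bump n a b x \<noteq> 0} = {a<..<b}" using bump_pos_iff[OF assms(1)] by auto
  then show ?thesis using assms by (auto simp: test_fun_def smooth_bump)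
qed

lemma bump_tendsto: "(\<lambda>k. bump (real (Suc k)) a b x) \<longlonglongrightarrow> indicator {a<..<b} x"
proof (cases "a < x \<and> x < b")
  case True
  have *: "(\<lambda>k. flat 1 (real (Suc k) * c)) \<longlonglongrightarrow> 1" if "c > 0" for c
  proof -
    have "(\<lambda>k. exp (- (inverse (real (Suc k)) * inverse c))) \<longlonglongrightarrow> exp (- (0 * inverse c))"
      by (intro tendsto_intros LIMSEQ_inverse_real_of_nat)
    moreover have "flat 1 (real (Suc k) * c) = exp (- (inverse (real (Suc k)) * inverse c))" for k
      using that by (simp add: flat_def divide_inverse)
    ultimately show ?thesis by simp
  qed
  have "(\<lambda>k. flat 1 (real (Suc k) * (x - a)) * flat 1 (real (Suc k) * (b - x))) \<longlonglongrightarrow> 1 * 1"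
    by (intro tendsto_mult *) (use True in auto)
  then show ?thesis using True by (simp add: bump_def)
next
  case False
  then have "bump (real (Suc k)) a b x = 0" for k
    using bump_pos_iff[of "real (Suc k)" a b x] by auto
  then show ?thesis using False by (auto simp: indicator_def)
qed

section \<open>The fundamental lemma and primitives of test functions\<close>

lemma integrable_lebesgue_on_subset:
  fixes f :: "'a::euclidean_space \<Rightarrow> 'b::{banach, second_countable_topology}"
  assumes "integrable (lebesgue_on S) f" "T \<subseteq> S" "S \<in> sets lebesgue" "T \<in> sets lebesgue"
  shows "integrable (lebesgue_on T) f"
  using assms set_integrable_subset[of lebesgue S f T]
  by (simp add: integrable_restrict_space set_integrable_def)

text \<open>Bumps tend to indicators, so \<open>f\<close> integrates to zero over every interval
  well inside the domain; differentiating these integrals gives \<open>f = 0\<close> almost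
  everywhere.\<close>

lemma fundamental_lemma:
  fixes f :: "real \<Rightarrow> real"
  assumes f: "integrable (lebesgue_on (Omega Z)) f"
    and 0: "\<And>\<phi>. test_fun Z \<phi> \<Longrightarrow> (LINT z|lebesgue_on (Omega Z). f z * \<phi> z) = 0"
  shows "AE z in lebesgue_on (Omega Z). f z = 0"
proof -
  let ?M = "lebesgue_on (Omega Z)"
  have ind0: "(LINT z|?M. f z * indicator {a<..<b} z) = 0" if "0 < a" "a < b" "b < Z" for a b
  proof -
    have "(\<lambda>k. LINT z|?M. f z * bump (real (Suc k)) a b z) \<longlonglongrightarrow> (LINT z|?M. f z * indicator {a<..<b} z)"
    proof (rule integral_dominated_convergence[where w = "\<lambda>z. norm (f z)"])
      have "(indicator {a<..<b} :: real \<Rightarrow> real) \<in> borel_measurable ?M"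
        by (intro measurable_restrict_space1 borel_measurable_indicator) auto
      then show "(\<lambda>z. f z * indicator {a<..<b} z) \<in> borel_measurable ?M"
        using f by measurable
      have "bump n a b \<in> borel_measurable ?M" for n
        by (intro continuous_imp_measurable_on_sets_lebesgue smooth_continuous_on smooth_bump) auto
      then show "(\<lambda>z. f z * bump (real (Suc k)) a b z) \<in> borel_measurable ?M" for k
        using f by measurable
      show "integrable ?M (\<lambda>z. norm (f z))" using f by simp
      show "AE z in ?M. (\<lambda>k. f z * bump (real (Suc k)) a b z) \<longlonglongrightarrow> f z * indicator {a<..<b} z"
        by (intro AE_I2 tendsto_mult tendsto_const bump_tendsto)
      show "AE z in ?M. norm (f z * bump (real (Suc k)) a b z) \<le> norm (f z)" for k
        by (intro AE_I2) (use bump_bounds in \<open>simp add: abs_mult mult_left_le\<close>)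
    qed
    moreover have "(LINT z|?M. f z * bump (real (Suc k)) a b z) = 0" for k
      by (intro 0 test_fun_bump) (use that in auto)
    ultimately show ?thesis by (simp add: LIMSEQ_const_iff)
  qed
  define F where "F z = (if z \<in> Omega Z then f z else 0)" for z
  have F: "F integrable_on cbox a b" for a b
  proof -
    have "f integrable_on Omega Z"
      using f integrable_on_lebesgue_on by fastforce
    then have "F integrable_on UNIV" unfolding F_def by (subst integrable_restrict_UNIV)
    then show ?thesis by (rule integrable_on_subcbox) simp
  qed
  \<comment> \<open>Lebesgue's differentiation theorem for averages over \<open>{x..x + h}\<close>;
    \<open>F\<close> is the extension of \<open>f\<close> by zero, for which they make sense on the
    whole line.\<close>
  obtain N where N: "negligible N"
    "\<And>x e. x \<notin> N \<Longrightarrow> 0 < e \<Longrightarrow> \<exists>d>0. \<forall>h. 0 < h \<and> h < d \<longrightarrow>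
       norm (integral (cbox x (x + h *\<^sub>R One)) F /\<^sub>R h ^ DIM(real) - F x) < e"
    using integrable_ccontinuous_explicit[OF F] by metis
  have "f x = 0" if x: "x \<in> Omega Z" "x \<notin> N" for x
  proof (rule ccontr)
    assume "f x \<noteq> 0"
    with N(2)[OF x(2), of "\<bar>f x\<bar>"] obtain d where d: "d > 0"
      "\<And>h. 0 < h \<Longrightarrow> h < d \<Longrightarrow> \<bar>integral {x..x + h} F / h - F x\<bar> < \<bar>f x\<bar>"
      by (auto simp: divide_inverse mult.commute)
    define h where "h = min d (Z - x) / 2"
    have h: "0 < h" "h < d" "x + h < Z" using d x by (auto simp: h_def min_def field_simps)
    have sub: "{x<..<x+h} \<subseteq> Omega Z" using x h by auto
    have "integral {x..x + h} F = integral {x<..<x + h} F"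
      by (simp add: integral_open_interval_real)
    also have "\<dots> = integral {x<..<x+h} f"
      by (rule integral_cong) (use sub in \<open>auto simp: F_def\<close>)
    also have "\<dots> = (LINT z|lebesgue_on {x<..<x+h}. f z)"
    proof (rule lebesgue_integral_eq_integral[symmetric])
      show "integrable (lebesgue_on {x<..<x+h}) f"
        by (rule integrable_lebesgue_on_subset[OF f]) (use sub in auto)
    qed auto
    also have "\<dots> = (LINT z|?M. (if z \<in> {x<..<x+h} then f z else 0))"
      by (rule integral_restrict[symmetric]) (use sub in auto)
    also have "\<dots> = (LINT z|?M. f z * indicator {x<..<x+h} z)"
      by (rule Bochner_Integration.integral_cong) (auto simp: indicator_def)
    also have "\<dots> = 0" using ind0 x h by auto
    finally show False using d(2)[OF h(1,2)] x by (simp add: F_def)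
  qed
  moreover have "N \<in> null_sets lebesgue" using N(1) by (simp add: negligible_iff_null_sets)
  ultimately show ?thesis
    by (subst AE_restrict_space_iff) (auto intro!: AE_I'[of N])
qed

lemma test_funE:
  assumes "test_fun Z \<phi>" "Z > 0"
  obtains a b where "0 < a" "a < b" "b < Z" "\<And>x. x \<notin> {a..b} \<Longrightarrow> \<phi> x = 0"
proof (cases "closure {x. \<phi> x \<noteq> 0} = {}")
  case True
  then show ?thesis
    by (intro that[of "Z/3" "Z/2"]) (use \<open>Z > 0\<close> in auto)
next
  case False
  have c: "compact (closure {x. \<phi> x \<noteq> 0})" "closure {x. \<phi> x \<noteq> 0} \<subseteq> Omega Z"
    using assms by (auto simp: test_fun_def)
  obtain a where a: "a \<in> closure {x. \<phi> x \<noteq> 0}" "\<And>x. x \<in> closure {x. \<phi> x \<noteq> 0} \<Longrightarrow> a \<le> x"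
    using compact_attains_inf[OF c(1) False] by blast
  obtain b where b: "b \<in> closure {x. \<phi> x \<noteq> 0}" "\<And>x. x \<in> closure {x. \<phi> x \<noteq> 0} \<Longrightarrow> x \<le> b"
    using compact_attains_sup[OF c(1) False] by blast
  have "0 < a" "a \<le> b" "b < Z" using a b c(2) by auto
  \<comment> \<open>Moving the right end to the midpoint of \<open>b\<close> and \<open>Z\<close>
    makes the interval nondegenerate without a look at the size of the support.\<close>
  moreover have "\<phi> x = 0" if "x \<notin> {a..(b+Z)/2}" for x
  proof (rule ccontr)
    assume "\<phi> x \<noteq> 0"
    then have "x \<in> closure {x. \<phi> x \<noteq> 0}" by (intro subsetD[OF closure_subset]) simp
    with a(2) b(2) \<open>b < Z\<close> that show False by fastforce
  qed
  ultimately show ?thesis by (intro that[of a "(b+Z)/2"]) auto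
qed

text \<open>The primitive from 0 vanishes before the support of \<phi> and equals the total integral
  after it, so zero mean is what keeps its support inside the open interval.\<close>

lemma test_fun_antiderivative:
  assumes "test_fun Z \<phi>" "Z > 0"
  obtains F where "smooth F" "deriv F = \<phi>" "\<And>x. (F has_real_derivative \<phi> x) (at x)"
    "(\<integral>z. \<phi> z \<partial>lebesgue_on (Omega Z)) = 0 \<Longrightarrow> test_fun Z F"
proof -
  obtain a b where ab: "0 < a" "a < b" "b < Z" "\<And>x. x \<notin> {a..b} \<Longrightarrow> \<phi> x = 0"
    using test_funE[OF assms] by blast
  have sm: "smooth \<phi>" using assms by (simp add: test_fun_def)
  define F where "F x = integral {0..x} \<phi>" for x
  \<comment> \<open>For \<open>x < 0\<close> the interval \<open>{0..x}\<close> is empty and the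
    integral is 0, which is the right value because \<phi> vanishes left of
    \<open>a\<close>.\<close>
  have F0: "F x = 0" if "x < a" for x
  proof -
    have "integral {0..x} \<phi> = integral {0..x} (\<lambda>_. 0)"
      by (rule integral_cong) (use ab that in auto)
    then show ?thesis by (simp add: F_def)
  qed
  have D: "(F has_real_derivative \<phi> x) (at x)" for x
  proof (cases "x < a")
    case True
    have "((\<lambda>x. 0) has_real_derivative 0) (at x)" by simp
    then have "(F has_real_derivative 0) (at x)"
      by (rule has_field_derivative_transform_within_open[where S = "{..<a}"])
        (use True F0 in auto)
    then show ?thesis using ab(4)[of x] True by simp
  next
    case False
    have "(F has_real_derivative \<phi> x) (at x within {0..x + 1})"
      unfolding F_def[abs_def]
      by (rule integral_has_real_derivative) (use False ab sm in \<open>auto intro: smooth_continuous_on\<close>)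
    moreover have "at x within {0..x + 1} = at x"
      by (rule at_within_interior) (use False ab in auto)
    ultimately show ?thesis by simp
  qed
  have "smooth F" using smooth_antiderivative[OF D sm] .
  moreover have "test_fun Z F" if int0: "(\<integral>z. \<phi> z \<partial>lebesgue_on (Omega Z)) = 0"
  proof -
    have "integrable (lebesgue_on {0..Z}) \<phi>"
      by (intro continuous_imp_integrable_real smooth_continuous_on sm)
    then have i: "integrable (lebesgue_on (Omega Z)) \<phi>"
      by (rule integrable_lebesgue_on_subset) auto
    have Fb: "F x = F b" if "x \<ge> b" for x
    proof (rule DERIV_isconst2[of b "x + 1"])
      show "continuous_on {b..x + 1} F"
        using D by (meson DERIV_continuous_on has_field_derivative_at_within)
      show "DERIV F y :> 0" if "b < y" "y < x + 1" for y
        using D[of y] ab(4)[of y] that by simp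
    qed (use that in auto)
    have "F Z = integral (Omega Z) \<phi>"
      by (simp add: F_def integral_open_interval_real)
    also have "\<dots> = 0"
      using lebesgue_integral_eq_integral[OF i] int0 by simp
    finally have "F x = 0" if "x \<ge> b" for x using Fb[OF that] Fb[of Z] ab by simp
    have sub: "{x. F x \<noteq> 0} \<subseteq> {a..b}" using F0 \<open>\<And>x. b \<le> x \<Longrightarrow> F x = 0\<close>
      by (smt (verit) atLeastAtMost_iff mem_Collect_eq subsetI)
    then have "closure {x. F x \<noteq> 0} \<subseteq> {a..b}" by (rule closure_minimal) simp
    then show ?thesis using \<open>smooth F\<close> ab
      by (auto simp: test_fun_def intro: bounded_subset[OF bounded_closed_interval sub])
  qed
  moreover have "deriv F = \<phi>" using D by (intro ext DERIV_imp_deriv)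
  ultimately show ?thesis using D that by blast
qed

subsection \<open>Weak derivatives on an interval\<close>

lemma finite_measure_Omega: "finite_measure (lebesgue_on (Omega Z))"
  by (rule finite_measure_lebesgue_on) auto

lemma integrable_Omega_continuous:
  fixes F :: "real \<Rightarrow> real"
  assumes "continuous_on {0..Z} F"
  shows "integrable (lebesgue_on (Omega Z)) F" "(LINT z|lebesgue_on (Omega Z). F z) = integral {0..Z} F"
proof -
  show i: "integrable (lebesgue_on (Omega Z)) F"
    by (rule integrable_lebesgue_on_subset[OF continuous_imp_integrable_real[OF assms]]) auto
  show "(LINT z|lebesgue_on (Omega Z). F z) = integral {0..Z} F"
    by (subst lebesgue_integral_eq_integral[OF i]) (auto simp: integral_open_interval_real)
qed

lemma integrable_mult_continuous:
  fixes p \<phi> :: "real \<Rightarrow> real"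
  assumes p: "integrable (lebesgue_on (Omega Z)) p" and \<phi>: "continuous_on {0..Z} \<phi>"
  shows "integrable (lebesgue_on (Omega Z)) (\<lambda>z. p z * \<phi> z)"
proof -
  have "bounded (\<phi> ` {0..Z})" by (intro compact_imp_bounded compact_continuous_image \<phi>) simp
  then obtain c where c: "\<And>z. z \<in> {0..Z} \<Longrightarrow> \<bar>\<phi> z\<bar> \<le> c"
    unfolding bounded_iff real_norm_def by blast
  show ?thesis
  proof (rule Bochner_Integration.integrable_bound[of _ "\<lambda>z. p z * c"])
    show "integrable (lebesgue_on (Omega Z)) (\<lambda>z. p z * c)" using p by simp
    have "\<phi> \<in> borel_measurable (lebesgue_on (Omega Z))"
      using integrable_Omega_continuous(1)[OF \<phi>] by auto
    then show "(\<lambda>z. p z * \<phi> z) \<in> borel_measurable (lebesgue_on (Omega Z))"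
      using p by measurable
    show "AE z in lebesgue_on (Omega Z). norm (p z * \<phi> z) \<le> norm (p z * c)"
    proof (rule AE_I2)
      fix z assume "z \<in> space (lebesgue_on (Omega Z))"
      then have "\<bar>\<phi> z\<bar> \<le> \<bar>c\<bar>" using c[of z] by (auto simp: abs_if split: if_splits)
      then show "norm (p z * \<phi> z) \<le> norm (p z * c)" by (simp add: abs_mult mult_left_mono)
    qed
  qed
qed

lemma L2_imp_integrable:
  assumes "u \<in> L2 Z" shows "integrable (lebesgue_on (Omega Z)) u"
proof (rule Bochner_Integration.integrable_bound[of _ "\<lambda>z. 1 + (u z)\<^sup>2"])
  interpret finite_measure "lebesgue_on (Omega Z)" by (rule finite_measure_Omega)
  show "integrable (lebesgue_on (Omega Z)) (\<lambda>z. 1 + (u z)\<^sup>2)" using assms by (simp add: L2_def)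
  show "u \<in> borel_measurable (lebesgue_on (Omega Z))" using assms by (simp add: L2_def)
  have "\<bar>x\<bar> \<le> 1 + x\<^sup>2" for x :: real
    using sum_squares_bound[of "\<bar>x\<bar>" 1] zero_le_power2[of x] by simp
  then show "AE z in lebesgue_on (Omega Z). norm (u z) \<le> norm (1 + (u z)\<^sup>2)"
    by (intro AE_I2) simp
qed

lemma integral_cong_AE_Omega:
  fixes p q :: "real \<Rightarrow> real"
  assumes "AE z in lebesgue_on (Omega Z). p z = q z" "x \<le> Z"
  shows "integral {0..x} p = integral {0..x} q"
proof -
  have "AE z in lebesgue. z \<in> Omega Z \<longrightarrow> p z = q z"
    using assms(1) by (subst (asm) AE_restrict_space_iff) auto
  then have "negligible {z. \<not> (z \<in> Omega Z \<longrightarrow> p z = q z)}"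
    by (simp add: eventually_ae_filter_negligible) (meson negligible_subset)
  then have "negligible ({z. \<not> (z \<in> Omega Z \<longrightarrow> p z = q z)} \<union> {0, Z})"
    by (intro negligible_Un) auto
  then show ?thesis
    by (rule integral_spike) (use assms(2) in auto)
qed

lemma indefinite_integral_Omega:
  fixes q :: "real \<Rightarrow> real"
  assumes q: "integrable (lebesgue_on (Omega Z)) q"
  shows "continuous_on {0..Z} (\<lambda>x. integral {0..x} q)"
    and "x \<in> {0..Z} \<Longrightarrow> (LINT y|lebesgue_on (Omega Z). (if y \<le> x then q y else 0)) = integral {0..x} q"
proof -
  have "q integrable_on {0<..<Z}" using integrable_on_lebesgue_on[OF q] by auto
  then have "q integrable_on {0..Z}"
    using has_integral_Icc_iff_Ioo unfolding integrable_on_def by metis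
  then show "continuous_on {0..Z} (\<lambda>x. integral {0..x} q)"
    by (rule indefinite_integral_continuous_1)
next
  assume x: "x \<in> {0..Z}"
  have i: "integrable (lebesgue_on {0<..<x}) q"
    by (rule integrable_lebesgue_on_subset[OF q]) (use x in auto)
  have "AE y in lebesgue. y \<noteq> x"
    by (rule AE_I'[of "{x}"]) (auto simp: null_sets_completionI)
  then have "AE y in lebesgue_on (Omega Z). y \<noteq> x"
    by (subst AE_restrict_space_iff) auto
  then have "(LINT y|lebesgue_on (Omega Z). (if y \<le> x then q y else 0)) =
      (LINT y|lebesgue_on (Omega Z). (if y \<in> {0<..<x} then q y else 0))"
  proof (intro integral_cong_AE)
    have [measurable]: "(\<lambda>x. x) \<in> borel_measurable (lebesgue_on (Omega Z))"
      by (intro measurable_restrict_space1 measurable_completion) simp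
    have [measurable]: "q \<in> borel_measurable (lebesgue_on (Omega Z))" using q by auto
    show "(\<lambda>y. if y \<le> x then q y else 0) \<in> borel_measurable (lebesgue_on (Omega Z))"
      by measurable
    show "(\<lambda>y. if y \<in> {0<..<x} then q y else 0) \<in> borel_measurable (lebesgue_on (Omega Z))"
      by measurable
  qed (auto elim!: eventually_rev_mp[OF AE_space[of "lebesgue_on (Omega Z)"]])
  also have "\<dots> = (LINT y|lebesgue_on {0<..<x}. q y)"
    by (rule integral_restrict) (use x in auto)
  also have "\<dots> = integral {0..x} q"
    by (subst lebesgue_integral_eq_integral[OF i]) (auto simp: integral_open_interval_real)
  finally show "(LINT y|lebesgue_on (Omega Z). (if y \<le> x then q y else 0)) = integral {0..x} q" .
qed

text \<open>\<open>q\<close> is only integrable, so its primitive may fail to be differentiable at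
  some points. Fubini's theorem for \<open>q y * \<phi>' x\<close> on the triangle
  \<open>y \<le> x\<close> takes the place of the product rule.\<close>

lemma integral_by_parts_Omega:
  fixes q \<phi> \<phi>' :: "real \<Rightarrow> real"
  assumes q: "integrable (lebesgue_on (Omega Z)) q"
    and \<phi>: "\<And>z. z \<in> {0..Z} \<Longrightarrow> (\<phi> has_real_derivative \<phi>' z) (at z within {0..Z})"
    and \<phi>': "continuous_on {0..Z} \<phi>'"
  shows "(LINT z|lebesgue_on (Omega Z). q z * \<phi> z) =
    (LINT z|lebesgue_on (Omega Z). q z) * \<phi> Z - (LINT x|lebesgue_on (Omega Z). integral {0..x} q * \<phi>' x)"
proof -
  let ?M = "lebesgue_on (Omega Z)"
  interpret finite_measure ?M by (rule finite_measure_Omega)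
  interpret pair_sigma_finite ?M ?M ..
  have i\<phi>': "integrable ?M \<phi>'" by (rule integrable_Omega_continuous[OF \<phi>'])
  have [measurable]: "(\<lambda>x. x) \<in> borel_measurable ?M"
    by (intro measurable_restrict_space1 measurable_completion) simp
  have [measurable]: "q \<in> borel_measurable ?M" "\<phi>' \<in> borel_measurable ?M" using q i\<phi>' by auto
  define F where "F x y = (if y \<le> x then q y * \<phi>' x else 0)" for x y
  have F: "integrable (?M \<Otimes>\<^sub>M ?M) (case_prod F)"
  proof (rule Bochner_Integration.integrable_bound)
    show "integrable (?M \<Otimes>\<^sub>M ?M) (\<lambda>(x, y). \<phi>' x * q y)"
      by (rule Fubini_integrable) (use q i\<phi>' in \<open>auto simp: abs_mult\<close>)
    show "case_prod F \<in> borel_measurable (?M \<Otimes>\<^sub>M ?M)"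
      unfolding F_def split_beta by measurable
    show "AE p in ?M \<Otimes>\<^sub>M ?M. norm (case_prod F p) \<le> norm (case p of (x, y) \<Rightarrow> \<phi>' x * q y)"
      by (intro AE_I2) (auto simp: F_def abs_mult)
  qed
  have L: "(LINT x|?M. F x y) = q y * (\<phi> Z - \<phi> y)" if y: "y \<in> Omega Z" for y
  proof -
    have i: "integrable (lebesgue_on {y..<Z}) \<phi>'"
      by (rule integrable_lebesgue_on_subset[OF i\<phi>']) (use y in auto)
    have "(LINT x|?M. F x y) = q y * (LINT x|?M. (if x \<in> {y..<Z} then \<phi>' x else 0))"
      unfolding Bochner_Integration.integral_mult_right_zero[symmetric]
      by (rule Bochner_Integration.integral_cong) (auto simp: F_def)
    also have "(LINT x|?M. (if x \<in> {y..<Z} then \<phi>' x else 0)) = (LINT x|lebesgue_on {y..<Z}. \<phi>' x)"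
      by (rule integral_restrict) (use y in auto)
    also have "\<dots> = integral {y..<Z} \<phi>'" by (rule lebesgue_integral_eq_integral[OF i]) auto
    also have "\<dots> = integral {y..Z} \<phi>'"
      by (rule integral_subset_negligible) (auto intro: negligible_subset[of "{Z}"])
    also have "\<dots> = \<phi> Z - \<phi> y"
    proof (rule integral_unique, rule fundamental_theorem_of_calculus)
      show "(\<phi> has_vector_derivative \<phi>' x) (at x within {y..Z})" if "x \<in> {y..Z}" for x
        using has_vector_derivative_within_subset[of \<phi> "\<phi>' x" x "{0..Z}" "{y..Z}"] \<phi>[of x] that y
        by (auto simp: has_real_derivative_iff_has_vector_derivative)
    qed (use y in auto)
    finally show ?thesis .
  qed
  have R: "(LINT y|?M. F x y) = integral {0..x} q * \<phi>' x" if "x \<in> Omega Z" for x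
  proof -
    have "(LINT y|?M. F x y) = (LINT y|?M. (if y \<le> x then q y else 0) * \<phi>' x)"
      by (rule Bochner_Integration.integral_cong) (auto simp: F_def)
    then show ?thesis using indefinite_integral_Omega(2)[OF q, of x] that by simp
  qed
  have cont\<phi>: "continuous_on {0..Z} \<phi>" using \<phi> by (rule DERIV_continuous_on)
  have "(LINT y|?M. (LINT x|?M. F x y)) = (LINT y|?M. q y * \<phi> Z - q y * \<phi> y)"
    by (rule Bochner_Integration.integral_cong) (use L in \<open>auto simp: algebra_simps\<close>)
  also have "\<dots> = (LINT y|?M. q y) * \<phi> Z - (LINT y|?M. q y * \<phi> y)"
    using q integrable_mult_continuous[OF q cont\<phi>] by simp
  finally have "(LINT y|?M. q y) * \<phi> Z - (LINT y|?M. q y * \<phi> y) = (LINT x|?M. (LINT y|?M. F x y))"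
    using Fubini_integral[OF F] by simp
  also have "\<dots> = (LINT x|?M. integral {0..x} q * \<phi>' x)"
    by (rule Bochner_Integration.integral_cong) (use R in auto)
  finally show ?thesis by simp
qed


section \<open>Du Bois-Reymond's lemma and weak equations in divergence form\<close>

lemma test_fun_vanishes:
  assumes "test_fun Z \<phi>" shows "\<phi> Z = 0" "\<phi> 0 = 0"
proof -
  have "closure {x. \<phi> x \<noteq> 0} \<subseteq> Omega Z" using assms by (simp add: test_fun_def)
  then have "{x. \<phi> x \<noteq> 0} \<subseteq> Omega Z" by (rule subset_trans[OF closure_subset])
  then show "\<phi> Z = 0" "\<phi> 0 = 0" by auto
qed

lemma smooth_test_fun: "test_fun Z \<phi> \<Longrightarrow> smooth \<phi>"
  by (simp add: test_fun_def)

lemma test_fun_diff_scaled: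
  assumes "test_fun Z \<phi>" "test_fun Z \<psi>"
  shows "test_fun Z (\<lambda>x. \<phi> x - c * \<psi> x)"
proof -
  have "smooth (\<lambda>x. \<phi> x + (- c) * \<psi> x)"
    using assms by (intro smooth_add smooth_mult smooth_const) (auto simp: test_fun_def)
  moreover have sub: "closure {x. \<phi> x - c * \<psi> x \<noteq> 0} \<subseteq> closure {x. \<phi> x \<noteq> 0} \<union> closure {x. \<psi> x \<noteq> 0}"
    unfolding closure_Un[symmetric] by (rule closure_mono) auto
  moreover have "compact (closure {x. \<phi> x - c * \<psi> x \<noteq> 0})"
  proof -
    have "bounded (closure {x. \<phi> x \<noteq> 0} \<union> closure {x. \<psi> x \<noteq> 0})"
      using assms by (intro compact_imp_bounded compact_Un) (simp_all add: test_fun_def)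
    then have "bounded (closure {x. \<phi> x - c * \<psi> x \<noteq> 0})" using sub by (rule bounded_subset)
    then show ?thesis by (simp add: compact_eq_bounded_closed)
  qed
  moreover have "closure {x. \<phi> x \<noteq> 0} \<union> closure {x. \<psi> x \<noteq> 0} \<subseteq> Omega Z"
    using assms by (simp add: test_fun_def)
  ultimately show ?thesis unfolding test_fun_def by (simp add: subset_trans)
qed

lemma integrable_mult_smooth:
  "integrable (lebesgue_on (Omega Z)) p \<Longrightarrow> smooth \<phi> \<Longrightarrow> integrable (lebesgue_on (Omega Z)) (\<lambda>z. p z * \<phi> z)"
  by (intro integrable_mult_continuous smooth_continuous_on)

lemma integral_by_parts_smooth:
  assumes "integrable (lebesgue_on (Omega Z)) q" "smooth \<phi>"
  shows "(LINT z|lebesgue_on (Omega Z). q z * \<phi> z) =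
    (LINT z|lebesgue_on (Omega Z). q z) * \<phi> Z - (LINT x|lebesgue_on (Omega Z). integral {0..x} q * deriv \<phi> x)"
  by (rule integral_by_parts_Omega[OF assms(1)])
    (use assms in \<open>auto intro: has_field_derivative_at_within smooth_has_derivative smooth_continuous_on smooth_deriv\<close>)

lemma integrable_indefinite_integral:
  assumes "integrable (lebesgue_on (Omega Z)) q"
  shows "integrable (lebesgue_on (Omega Z)) (\<lambda>x. integral {0..x} q :: real)"
  by (intro integrable_Omega_continuous indefinite_integral_Omega assms)

text \<open>A test function of mean zero is the derivative of a test function. Subtracting a
  multiple of one fixed \<eta> with nonzero integral brings any \<phi> into this form, and the
  constant is the average of \<open>v\<close> weighted by \<eta>.\<close>

lemma du_Bois_Reymond:
  assumes Z: "Z > 0" and v: "integrable (lebesgue_on (Omega Z)) v"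
    and 0: "\<And>\<phi>. test_fun Z \<phi> \<Longrightarrow> (LINT z|lebesgue_on (Omega Z). v z * deriv \<phi> z) = 0"
  obtains c where "AE z in lebesgue_on (Omega Z). v z = c"
proof -
  let ?M = "lebesgue_on (Omega Z)"
  interpret finite_measure ?M by (rule finite_measure_Omega)
  define \<eta> where "\<eta> = bump 1 (Z / 3) (Z / 2)"
  have \<eta>: "test_fun Z \<eta>" unfolding \<eta>_def by (rule test_fun_bump) (use Z in auto)
  define I where "I = (LINT z|?M. \<eta> z)"
  have c\<eta>: "continuous_on {0..Z} \<eta>" using \<eta> smooth_continuous_on smooth_test_fun by blast
  have "I \<noteq> 0"
  proof
    assume "I = 0"
    then have "integral\<^sup>L (lebesgue_on {0..Z}) \<eta> = 0"
      using integrable_Omega_continuous(2)[OF c\<eta>]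
        lebesgue_integral_eq_integral[OF continuous_imp_integrable_real[OF c\<eta>]] by (simp add: I_def)
    then have "\<forall>x\<in>{0..Z}. \<eta> x = 0"
      using integralL_eq_0_iff[OF c\<eta> Z] bump_bounds by (simp add: \<eta>_def)
    \<comment> \<open>The midpoint of the interval on which the bump \<eta> is positive.\<close>
    moreover have "\<eta> (5 * Z / 12) \<noteq> 0" unfolding \<eta>_def using Z by (subst bump_pos_iff) auto
    ultimately show False using Z by auto
  qed
  define c where "c = (LINT z|?M. v z * \<eta> z) / I"
  have "AE z in ?M. v z - c = 0"
  proof (rule fundamental_lemma)
    show "integrable ?M (\<lambda>z. v z - c)" using v by simp
    fix \<phi> assume \<phi>: "test_fun Z \<phi>"
    define r where "r = (LINT z|?M. \<phi> z) / I"
    have i\<phi>: "integrable ?M \<phi>" and i\<eta>: "integrable ?M \<eta>"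
      using \<phi> \<eta> by (auto intro: integrable_Omega_continuous smooth_continuous_on smooth_test_fun)
    have iv\<phi>: "integrable ?M (\<lambda>z. v z * \<phi> z)" and iv\<eta>: "integrable ?M (\<lambda>z. v z * \<eta> z)"
      using \<phi> \<eta> v by (auto intro: integrable_mult_smooth smooth_test_fun)
    have "test_fun Z (\<lambda>x. \<phi> x - r * \<eta> x)" by (rule test_fun_diff_scaled[OF \<phi> \<eta>])
    then obtain F where F: "deriv F = (\<lambda>x. \<phi> x - r * \<eta> x)"
      "(LINT z|?M. \<phi> z - r * \<eta> z) = 0 \<Longrightarrow> test_fun Z F"
      using test_fun_antiderivative[OF _ Z] by metis
    have "(LINT z|?M. \<phi> z - r * \<eta> z) = 0"
      using i\<phi> i\<eta> \<open>I \<noteq> 0\<close> by (simp add: r_def flip: I_def)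
    then have "(LINT z|?M. v z * (\<phi> z - r * \<eta> z)) = 0" using 0 F by metis
    moreover have "(LINT z|?M. v z * (\<phi> z - r * \<eta> z)) = (LINT z|?M. v z * \<phi> z - r * (v z * \<eta> z))"
      by (simp add: algebra_simps)
    ultimately have "(LINT z|?M. v z * \<phi> z) = r * (LINT z|?M. v z * \<eta> z)"
      using iv\<phi> iv\<eta> by simp
    also have "\<dots> = c * (LINT z|?M. \<phi> z)" by (simp add: r_def c_def)
    finally show "(LINT z|?M. (v z - c) * \<phi> z) = 0"
      using iv\<phi> i\<phi> by (simp add: left_diff_distrib)
  qed
  then show ?thesis by (intro that[of c]) auto
qed

text \<open>Integration by parts shows that \<open>u\<close> minus the primitive of \<open>q\<close>
  has weak derivative zero, so it is constant.\<close>

lemma weak_deriv_primitive: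
  assumes Z: "Z > 0" and u: "integrable (lebesgue_on (Omega Z)) u" and q: "integrable (lebesgue_on (Omega Z)) q"
    and wd: "is_weak_deriv Z u q"
  obtains c where "AE z in lebesgue_on (Omega Z). u z = c + integral {0..z} q"
proof -
  let ?M = "lebesgue_on (Omega Z)"
  note iQ = integrable_indefinite_integral[OF q]
  obtain c where "AE z in ?M. u z - integral {0..z} q = c"
  proof (rule du_Bois_Reymond[OF Z])
    show "integrable ?M (\<lambda>z. u z - integral {0..z} q)" using u iQ by simp
    fix \<phi> assume \<phi>: "test_fun Z \<phi>"
    have sm: "smooth (deriv \<phi>)" using \<phi> smooth_deriv smooth_test_fun by blast
    have "(LINT x|?M. integral {0..x} q * deriv \<phi> x) = (LINT z|?M. u z * deriv \<phi> z)"
      using integral_by_parts_smooth[OF q smooth_test_fun[OF \<phi>]] wd \<phi> test_fun_vanishes[OF \<phi>]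
      by (simp add: is_weak_deriv_def)
    then show "(LINT z|?M. (u z - integral {0..z} q) * deriv \<phi> z) = 0"
      using integrable_mult_smooth[OF u sm] integrable_mult_smooth[OF iQ sm] by (simp add: left_diff_distrib)
  qed
  then show ?thesis by (intro that[of c]) (auto elim!: eventually_mono)
qed

text \<open>The functions \<phi> need not vanish at the endpoints. The choice \<phi> = 1 gives
  \<open>q\<close> zero total integral, which removes the boundary term, and every test function is
  the derivative of an admissible \<phi>. Hence no free constant remains: this is how the boundary
  conditions at both ends are recovered.\<close>

lemma weak_divergence_form:
  assumes Z: "Z > 0" and r: "integrable (lebesgue_on (Omega Z)) r" and q: "integrable (lebesgue_on (Omega Z)) q"
    and weak: "\<And>\<phi>. smooth \<phi> \<Longrightarrow> (LINT z|lebesgue_on (Omega Z). r z * deriv \<phi> z + q z * \<phi> z) = 0"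
  shows "AE z in lebesgue_on (Omega Z). r z = integral {0..z} q" and "integral {0..Z} q = 0"
proof -
  let ?M = "lebesgue_on (Omega Z)"
  note iQ = integrable_indefinite_integral[OF q]
  have "deriv (\<lambda>x. 1 :: real) = (\<lambda>x. 0)" by (rule ext) simp
  then have q0: "(LINT z|?M. q z) = 0" using weak[OF smooth_const[of 1]] by simp
  have "AE z in ?M. r z - integral {0..z} q = 0"
  proof (rule fundamental_lemma)
    show "integrable ?M (\<lambda>z. r z - integral {0..z} q)" using r iQ by simp
    fix \<phi> assume \<phi>: "test_fun Z \<phi>"
    then obtain F where F: "smooth F" "deriv F = \<phi>"
      using test_fun_antiderivative[OF _ Z] by metis
    have i: "integrable ?M (\<lambda>z. r z * \<phi> z)" "integrable ?M (\<lambda>z. q z * F z)"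
      "integrable ?M (\<lambda>z. integral {0..z} q * \<phi> z)"
      using r q iQ \<phi> F by (auto intro: integrable_mult_smooth smooth_test_fun)
    have "(LINT z|?M. r z * \<phi> z) + (LINT z|?M. q z * F z) = 0"
      using weak[OF F(1)] i by (simp add: F(2))
    then show "(LINT z|?M. (r z - integral {0..z} q) * \<phi> z) = 0"
      using integral_by_parts_smooth[OF q F(1)] q0 i by (simp add: left_diff_distrib F(2))
  qed
  then show "AE z in ?M. r z = integral {0..z} q" by simp
  show "integral {0..Z} q = 0"
    using lebesgue_integral_eq_integral[OF q] q0 by (simp add: integral_open_interval_real)
qed

lemma is_weak_deriv_unique:
  assumes q1: "q1 \<in> L2 Z" "is_weak_deriv Z u q1" and q2: "q2 \<in> L2 Z" "is_weak_deriv Z u q2"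
  shows "AE z in lebesgue_on (Omega Z). q1 z = q2 z"
proof -
  note i = L2_imp_integrable[OF q1(1)] L2_imp_integrable[OF q2(1)]
  have "AE z in lebesgue_on (Omega Z). q1 z - q2 z = 0"
  proof (rule fundamental_lemma)
    show "integrable (lebesgue_on (Omega Z)) (\<lambda>z. q1 z - q2 z)" using i by simp
    fix \<phi> assume \<phi>: "test_fun Z \<phi>"
    have "(LINT z|lebesgue_on (Omega Z). q1 z * \<phi> z) = (LINT z|lebesgue_on (Omega Z). q2 z * \<phi> z)"
      using q1(2)[unfolded is_weak_deriv_def, rule_format, OF \<phi>] q2(2)[unfolded is_weak_deriv_def, rule_format, OF \<phi>]
      by simp
    then show "(LINT z|lebesgue_on (Omega Z). (q1 z - q2 z) * \<phi> z) = 0"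
      using i[THEN integrable_mult_smooth, OF smooth_test_fun[OF \<phi>]] by (simp add: left_diff_distrib)
  qed
  then show ?thesis by simp
qed

lemma weak_deriv_H1:
  assumes "u \<in> H1 Z"
  shows "weak_deriv Z u \<in> L2 Z" "is_weak_deriv Z u (weak_deriv Z u)"
proof -
  have "\<exists>q. q \<in> L2 Z \<and> is_weak_deriv Z u q" using assms by (auto simp: H1_def)
  from someI_ex[OF this] show "weak_deriv Z u \<in> L2 Z" "is_weak_deriv Z u (weak_deriv Z u)"
    by (simp_all add: weak_deriv_def)
qed

lemma continuous_imp_L2:
  assumes "continuous_on {0..Z} u" shows "u \<in> L2 Z"
proof -
  have "integrable (lebesgue_on (Omega Z)) u" "integrable (lebesgue_on (Omega Z)) (\<lambda>z. (u z)\<^sup>2)"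
    by (intro integrable_Omega_continuous continuous_intros assms)+
  then show ?thesis by (auto simp: L2_def)
qed

text \<open>\<open>weak_deriv\<close> is an arbitrary choice of representative, so even for a
  classical function it is known only almost everywhere.\<close>

lemma C1_weak_deriv:
  assumes Z: "Z > 0"
    and D: "\<And>z. z \<in> {0..Z} \<Longrightarrow> (V has_real_derivative u z) (at z within {0..Z})"
    and u: "continuous_on {0..Z} u"
  shows "V \<in> H1 Z" "AE z in lebesgue_on (Omega Z). weak_deriv Z V z = u z"
proof -
  have V: "continuous_on {0..Z} V" using D by (rule DERIV_continuous_on)
  have wd: "is_weak_deriv Z V u"
    unfolding is_weak_deriv_def
  proof (intro allI impI)
    fix \<phi> assume \<phi>: "test_fun Z \<phi>"
    have sm: "smooth \<phi>" "smooth (deriv \<phi>)" using \<phi> smooth_deriv smooth_test_fun by blast+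
    have c: "continuous_on {0..Z} (\<lambda>z. V z * deriv \<phi> z)" "continuous_on {0..Z} (\<lambda>z. u z * \<phi> z)"
      by (intro continuous_intros V u smooth_continuous_on sm)+
    have "((\<lambda>z. V z * deriv \<phi> z + u z * \<phi> z) has_integral (V Z * \<phi> Z - V 0 * \<phi> 0)) {0..Z}"
    proof (rule fundamental_theorem_of_calculus)
      fix z assume "z \<in> {0..Z}"
      then show "((\<lambda>z. V z * \<phi> z) has_vector_derivative V z * deriv \<phi> z + u z * \<phi> z) (at z within {0..Z})"
        using D[of z] has_field_derivative_at_within[OF smooth_has_derivative[OF sm(1)]]
        by (auto intro!: derivative_eq_intros simp flip: has_real_derivative_iff_has_vector_derivative)
    qed (use Z in auto)
    then have "integral {0..Z} (\<lambda>z. V z * deriv \<phi> z + u z * \<phi> z) = 0"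
      using test_fun_vanishes[OF \<phi>] by (simp add: integral_unique)
    then have "integral {0..Z} (\<lambda>z. V z * deriv \<phi> z) + integral {0..Z} (\<lambda>z. u z * \<phi> z) = 0"
      using c by (simp add: Henstock_Kurzweil_Integration.integral_add integrable_continuous_real)
    then show "(LINT z|lebesgue_on (Omega Z). V z * deriv \<phi> z) = - (LINT z|lebesgue_on (Omega Z). u z * \<phi> z)"
      using c by (simp add: integrable_Omega_continuous(2))
  qed
  show H1: "V \<in> H1 Z"
    using continuous_imp_L2[OF V] continuous_imp_L2[OF u] wd by (auto simp: H1_def)
  show "AE z in lebesgue_on (Omega Z). weak_deriv Z V z = u z"
    by (rule is_weak_deriv_unique[OF weak_deriv_H1[OF H1] continuous_imp_L2[OF u] wd])
qed

subsection \<open>Ordinary differential equations\<close>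

text \<open>Freezing the argument outside \<open>{0..Z}\<close> embeds functions on the interval
  into the complete space of bounded continuous functions on the line, where Banach's theorem is
  applied.\<close>

lemma bcontfun_clamp:
  fixes f :: "real \<Rightarrow> 'a::real_normed_vector"
  assumes "continuous_on {0..Z} f" "0 \<le> Z"
  shows "(\<lambda>t. f (max 0 (min t Z))) \<in> bcontfun"
proof -
  have "bounded (f ` {0..Z})"
    by (intro compact_imp_bounded compact_continuous_image assms) simp
  then obtain b where b: "\<And>t. t \<in> {0..Z} \<Longrightarrow> norm (f t) \<le> b"
    unfolding bounded_iff by blast
  show ?thesis
  proof (rule bcontfun_normI)
    show "continuous_on UNIV (\<lambda>t. f (max 0 (min t Z)))"
      by (rule continuous_on_compose2[OF assms(1)], intro continuous_intros) (use assms in auto)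
    show "norm (f (max 0 (min t Z))) \<le> b" for t
      by (rule b) (use assms in auto)
  qed
qed

text \<open>Banach's fixed point theorem in the norm \<open>sup e\<^sup>-\<^sup>c\<^sup>t |y t|\<close> with \<open>c = 2 K\<close>,
  in which the Picard operator contracts by the factor 1/2.\<close>

lemma picard_global:
  fixes F :: "real \<Rightarrow> 'a::euclidean_space \<Rightarrow> 'a" and y0 :: 'a
  assumes cont: "continuous_on ({0..Z} \<times> UNIV) (\<lambda>(t, y). F t y)"
    and lip: "\<And>t x y. t \<in> {0..Z} \<Longrightarrow> norm (F t x - F t y) \<le> K * norm (x - y)"
    and Z: "0 \<le> Z" and K: "K > 0"
  obtains y where "y 0 = y0"
    "\<And>t. t \<in> {0..Z} \<Longrightarrow> (y has_vector_derivative F t (y t)) (at t within {0..Z})"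
proof -
  define c where "c = 2 * K"
  have c: "c > 0" using K by (simp add: c_def)
  \<comment> \<open>\<open>g\<close> stores the weighted unknown and \<open>Y\<close> removes the
    weight, so the sup distance of two \<open>g\<close> controls the weighted distance of the
    functions \<open>Y g\<close>.\<close>
  define Y where "Y g t = exp (c * t) *\<^sub>R apply_bcontfun g t" for g :: "real \<Rightarrow>\<^sub>C 'a" and t
  define T where "T g t = y0 + integral {0..t} (\<lambda>\<tau>. F \<tau> (Y g \<tau>))" for g :: "real \<Rightarrow>\<^sub>C 'a" and t
  have contF: "continuous_on {0..Z} (\<lambda>\<tau>. F \<tau> (Y g \<tau>))" for g
  proof -
    have "continuous_on {0..Z} (\<lambda>\<tau>. (\<tau>, Y g \<tau>))"
      unfolding Y_def by (intro continuous_intros continuous_on_apply_bcontfun)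
    from continuous_on_compose2[OF cont this] show ?thesis by auto
  qed
  have dT: "(T g has_vector_derivative F t (Y g t)) (at t within {0..Z})" if "t \<in> {0..Z}" for g t
    unfolding T_def
    using has_vector_derivative_add[OF has_vector_derivative_const integral_has_vector_derivative[OF contF that], of y0 g]
    by simp
  have contT: "continuous_on {0..Z} (T g)" for g
    by (rule continuous_on_vector_derivative[where f' = "\<lambda>t. F t (Y g t)"]) (rule dT)
  define S where "S g = Bcontfun (\<lambda>t. exp (- c * max 0 (min t Z)) *\<^sub>R T g (max 0 (min t Z)))" for g
  have S: "apply_bcontfun (S g) t = exp (- c * max 0 (min t Z)) *\<^sub>R T g (max 0 (min t Z))" for g t
  proof -
    have "continuous_on {0..Z} (\<lambda>t. exp (- c * t) *\<^sub>R T g t)"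
      by (intro continuous_intros contT)
    from bcontfun_clamp[OF this Z] show ?thesis
      unfolding S_def by (simp add: Bcontfun_inverse)
  qed
  have contr: "dist (S g) (S h) \<le> (1/2) * dist g h" for g h
  proof (rule dist_bound)
    fix t
    define s where "s = max 0 (min t Z)"
    have s: "s \<in> {0..Z}" using Z by (auto simp: s_def)
    have sub: "{0..s} \<subseteq> {0..Z}" using s by auto
    let ?d = "dist g h"
    have int: "(\<lambda>\<tau>. F \<tau> (Y g \<tau>)) integrable_on {0..s}" for g
      by (intro integrable_continuous_real continuous_on_subset[OF contF sub])
    have bd: "norm (F \<tau> (Y g \<tau>) - F \<tau> (Y h \<tau>)) \<le> K * ?d * exp (c * \<tau>)" if "\<tau> \<in> {0..s}" for \<tau>
    proof -
      have "norm (F \<tau> (Y g \<tau>) - F \<tau> (Y h \<tau>)) \<le> K * norm (Y g \<tau> - Y h \<tau>)"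
        by (rule lip) (use that sub in auto)
      also have "norm (Y g \<tau> - Y h \<tau>) = exp (c * \<tau>) * dist (apply_bcontfun g \<tau>) (apply_bcontfun h \<tau>)"
        by (simp add: Y_def dist_norm flip: scaleR_diff_right)
      also have "\<dots> \<le> exp (c * \<tau>) * ?d"
        by (intro mult_left_mono dist_bounded) auto
      finally show ?thesis using K by (simp add: mult_ac)
    qed
    have I: "((\<lambda>\<tau>. K * ?d * exp (c * \<tau>)) has_integral (K * ?d * (exp (c * s) - 1) / c)) {0..s}"
    proof -
      have "((\<lambda>\<tau>. K * ?d * exp (c * \<tau>)) has_integral
          (K * ?d * exp (c * s) / c - K * ?d * exp (c * 0) / c)) {0..s}"
        by (rule fundamental_theorem_of_calculus)
          (use s c in \<open>auto intro!: derivative_eq_intros simp flip: has_real_derivative_iff_has_vector_derivative\<close>)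
      then show ?thesis by (simp add: right_diff_distrib diff_divide_distrib)
    qed
    have "norm (T g s - T h s) = norm (integral {0..s} (\<lambda>\<tau>. F \<tau> (Y g \<tau>) - F \<tau> (Y h \<tau>)))"
      unfolding T_def by (subst Henstock_Kurzweil_Integration.integral_diff[OF int int]) simp
    also have "\<dots> \<le> integral {0..s} (\<lambda>\<tau>. K * ?d * exp (c * \<tau>))"
      by (rule integral_norm_bound_integral) (use bd int I in \<open>auto intro: Henstock_Kurzweil_Integration.integrable_diff\<close>)
    also have "\<dots> = K * ?d * (exp (c * s) - 1) / c" using I by (rule integral_unique)
    also have "\<dots> \<le> K * ?d * exp (c * s) / c"
      by (intro divide_right_mono mult_left_mono) (use K c in auto)
    also have "\<dots> = (1/2) * ?d * exp (c * s)" using K by (simp add: c_def)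
    finally have *: "norm (T g s - T h s) \<le> (1/2) * ?d * exp (c * s)" .
    have "dist (apply_bcontfun (S g) t) (apply_bcontfun (S h) t) = exp (- c * s) * norm (T g s - T h s)"
      unfolding S s_def[symmetric] by (simp add: dist_norm flip: scaleR_diff_right)
    also have "\<dots> \<le> exp (- c * s) * ((1/2) * ?d * exp (c * s))"
      by (intro mult_left_mono *) auto
    also have "\<dots> = (1/2) * ?d" by (simp add: exp_minus)
    finally show "dist (apply_bcontfun (S g) t) (apply_bcontfun (S h) t) \<le> (1/2) * ?d" .
  qed
  obtain g where g: "S g = g"
    using banach_fix_type[of "1/2" S] contr by auto
  have YT: "Y g t = T g t" if "t \<in> {0..Z}" for t
  proof -
    have "apply_bcontfun g t = exp (- c * t) *\<^sub>R T g t" using S[of g t] that by (simp add: g)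
    then show ?thesis unfolding Y_def by (simp add: exp_minus)
  qed
  show ?thesis
  proof (rule that[of "T g"])
    show "T g 0 = y0" by (simp add: T_def)
    show "(T g has_vector_derivative F t (T g t)) (at t within {0..Z})" if "t \<in> {0..Z}" for t
      using dT[OF that, of g] YT[OF that] by simp
  qed
qed

lemma gronwall:
  fixes N :: "real \<Rightarrow> real"
  assumes D: "\<And>t. t \<in> {0..Z} \<Longrightarrow> (N has_real_derivative N' t) (at t within {0..Z})"
    and le: "\<And>t. t \<in> {0..Z} \<Longrightarrow> N' t \<le> C * N t + e"
    and "0 \<le> e" "0 \<le> C" "z \<in> {0..Z}"
  shows "N z \<le> (N 0 + e * z) * exp (C * z)"
proof -
  \<comment> \<open>\<open>exp (- C * t)\<close> is the integrating factor; it is at most 1, so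
    subtracting \<open>e * t\<close> absorbs the source and makes \<open>G\<close>
    nonincreasing.\<close>
  define G where "G t = N t * exp (- C * t) - e * t" for t
  have "G z \<le> G 0"
  proof (rule DERIV_nonpos_imp_decreasing_open[of 0 z G])
    show "0 \<le> z" using assms by auto
    show "continuous_on {0..z} G"
      unfolding G_def
      by (intro continuous_intros continuous_on_subset[of "{0..Z}" N "{0..z}"] DERIV_continuous_on[OF D])
        (use assms in auto)
    fix t assume t: "0 < t" "t < z"
    have at: "at t within {0..Z} = at t" by (rule at_within_interior) (use t assms in auto)
    have t': "t \<in> {0..Z}" using t assms by auto
    have DN: "(N has_real_derivative N' t) (at t)" using D[OF t'] at by simp
    have "(G has_real_derivative (N' t - C * N t) * exp (- C * t) - e) (at t)"
      unfolding G_def by (auto intro!: derivative_eq_intros DN simp: algebra_simps)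
    moreover have "(N' t - C * N t) * exp (- C * t) - e \<le> 0"
    proof -
      have "(N' t - C * N t) * exp (- C * t) \<le> e * exp (- C * t)"
        by (intro mult_right_mono) (use le[OF t'] in auto)
      also have "\<dots> \<le> e * 1" using assms t by (intro mult_left_mono) auto
      finally show ?thesis by simp
    qed
    ultimately show "\<exists>y. DERIV G t :> y \<and> y \<le> 0" by blast
  qed
  then have "N z * exp (- C * z) \<le> N 0 + e * z" by (simp add: G_def)
  then show ?thesis by (simp add: exp_minus field_simps)
qed

text \<open>At the endpoints the hypothesis \<open>g z = 0\<close> replaces Fermat's theorem, so that a Neumann
  condition turns the one-sided second derivative test into the two-sided one.\<close>

lemma second_derivative_nonpos_at_max:
  fixes f g :: "real \<Rightarrow> real"
  assumes f: "\<And>t. t \<in> {a..b} \<Longrightarrow> (f has_real_derivative g t) (at t within {a..b})"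
    and g: "(g has_real_derivative d) (at z within {a..b})" "g z = 0"
    and z: "z \<in> {a..b}" "a < b" and max: "\<And>t. t \<in> {a..b} \<Longrightarrow> f t \<le> f z"
  shows "d \<le> 0"
proof (rule ccontr)
  assume "\<not> d \<le> 0"
  then have d: "d > 0" by simp
  have D: "DERIV f t :> g t" if "a < t" "t < b" for t
    using f[of t] at_within_interior[of t "{a..b}"] that by auto
  have cont: "continuous_on {a..b} f" using f by (rule DERIV_continuous_on)
  have mvt: "\<exists>x. p < x \<and> x < q \<and> f q - f p = (q - p) * g x" if "a \<le> p" "p < q" "q \<le> b" for p q
  proof -
    have "continuous_on {p..q} f" by (rule continuous_on_subset[OF cont]) (use that in auto)
    moreover have D': "DERIV f x :> g x" if "p < x" "x < q" for x
      using D[of x] that \<open>a \<le> p\<close> \<open>q \<le> b\<close> by simp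
    ultimately obtain l x where x: "p < x" "x < q" "DERIV f x :> l" "f q - f p = (q - p) * l"
      using MVT[OF \<open>p < q\<close>, of f] real_differentiable_def by blast
    then show ?thesis using DERIV_unique[OF D'[OF x(1,2)] x(3)] by blast
  qed
  show False
  \<comment> \<open>As \<open>g\<close> increases through 0 at \<open>z\<close>, \<open>f\<close>
    rises to the right of \<open>z\<close>. Only at the right endpoint must one look left, where
    \<open>f\<close> falls towards \<open>z\<close>.\<close>
  proof (cases "z < b")
    case True
    from has_real_derivative_pos_inc_right[OF g(1) d] obtain e where e: "e > 0"
      "\<And>h. h > 0 \<Longrightarrow> z + h \<in> {a..b} \<Longrightarrow> h < e \<Longrightarrow> g z < g (z + h)" by blast
    define t where "t = z + min e (b - z) / 2"
    have t: "z < t" "t < b" "t < z + e" using e True by (auto simp: t_def min_def field_simps)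
    obtain x where x: "z < x" "x < t" "f t - f z = (t - z) * g x"
      using mvt[of z t] t z by auto
    have "g x > 0" using e(2)[of "x - z"] x t z g(2) by auto
    with x have "f t - f z > 0" by simp
    with max[of t] t z show False by auto
  next
    case False
    then have zb: "z = b" using z by auto
    from has_real_derivative_pos_inc_left[OF g(1) d] obtain e where e: "e > 0"
      "\<And>h. h > 0 \<Longrightarrow> z - h \<in> {a..b} \<Longrightarrow> h < e \<Longrightarrow> g (z - h) < g z" by blast
    define t where "t = b - min e (b - a) / 2"
    have t: "a < t" "t < b" "b - e < t" using e z by (auto simp: t_def min_def field_simps)
    obtain x where x: "t < x" "x < b" "f b - f t = (b - t) * g x"
      using mvt[of t b] t by auto
    have "g x < 0" using e(2)[of "b - x"] x t z g(2) zb by auto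
    with x have "f b - f t < 0" by (simp add: mult_pos_neg)
    with max[of t] t zb show False by auto
  qed
qed

subsection \<open>The Hamilton-Jacobi equation with a fixed spillover\<close>

locale hjb =
  fixes Z \<sigma> \<rho> w B \<alpha> \<gamma> :: real
  assumes Z: "Z > 0" and \<sigma>: "\<sigma> > 0" and \<rho>: "\<rho> > 0" and w: "w > 0" and B: "B > 0"
    and \<alpha>: "0 < \<alpha>" "\<alpha> < 1" and \<gamma>: "0 < \<gamma>" "\<gamma> < 1"
begin

definition \<theta> where "\<theta> = \<gamma> / (1 - \<gamma>)"
definition a where "a = 2 / \<sigma>\<^sup>2"
definition h where "h x = (1 - \<gamma>) * (\<gamma> / w) powr \<theta> * (max 0 x) powr (1 / (1 - \<gamma>))"
definition g where "g x = (\<gamma> / w * max 0 x) powr \<theta>"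
definition f where "f z = z powr \<alpha> / B powr (\<alpha> - 1)"
definition f' where "f' z = \<alpha> * z powr (\<alpha> - 1) / B powr (\<alpha> - 1)"
text \<open>The a priori bound for V'. The added 1 makes the comparison in
  \<open>gradient_upper\<close> strict.\<close>

definition P where "P = a * (f Z + 1) * Z"

lemma a_pos: "a > 0" and \<theta>_pos: "\<theta> > 0"
  using \<sigma> \<gamma> by (auto simp: a_def \<theta>_def)

lemma h_has_derivative: "(h has_real_derivative g x) (at x)"
proof -
  have q: "1 / (1 - \<gamma>) > 1" and e: "1 / (1 - \<gamma>) - 1 = \<theta>"
    using \<gamma> by (auto simp: field_simps \<theta>_def)
  have "(h has_real_derivative (1 - \<gamma>) * (\<gamma> / w) powr \<theta> * (1 / (1 - \<gamma>) * (max 0 x) powr (1 / (1 - \<gamma>) - 1))) (at x)"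
    unfolding h_def by (intro DERIV_cmult max_powr_has_derivative q)
  moreover have "(1 - \<gamma>) * (\<gamma> / w) powr \<theta> * (1 / (1 - \<gamma>) * (max 0 x) powr (1 / (1 - \<gamma>) - 1)) = g x"
    using \<gamma> w unfolding e g_def by (subst powr_mult) auto
  ultimately show ?thesis by simp
qed

lemma g_nonneg: "0 \<le> g x" and h_nonneg: "0 \<le> h x" and h_0: "h 0 = 0" and g_0: "g 0 = 0"
  using \<gamma> w by (auto simp: g_def h_def)

lemma g_mono: "x \<le> y \<Longrightarrow> g x \<le> g y"
  unfolding g_def using \<gamma> w \<theta>_pos by (intro powr_mono2 mult_left_mono) auto

lemma continuous_on_g [continuous_intros]:
  "continuous_on S v \<Longrightarrow> continuous_on S (\<lambda>x. g (v x))"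
  unfolding g_def by (intro continuous_on_powr' continuous_intros) (use \<theta>_pos \<gamma> w in auto)

lemma continuous_on_h [continuous_intros]:
  assumes "continuous_on S v" shows "continuous_on S (\<lambda>x. h (v x))"
proof -
  have "continuous_on UNIV h"
    using h_has_derivative by (meson DERIV_continuous_on has_field_derivative_at_within)
  from continuous_on_compose2[OF this assms] show ?thesis by auto
qed

text \<open>The derivative \<open>g\<close> is nonnegative and increasing, so an upper bound on the
  two arguments controls it between them.\<close>

lemma h_lipschitz:
  assumes "x \<le> M" "y \<le> M" shows "\<bar>h x - h y\<bar> \<le> g M * \<bar>x - y\<bar>"
proof -
  have *: "\<bar>h x - h y\<bar> \<le> g M * \<bar>x - y\<bar>" if xy: "x < y" "y \<le> M" for x y
  proof -
    obtain c where c: "x < c" "c < y" "h y - h x = (y - x) * g c"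
      using MVT2[OF xy(1) h_has_derivative] by blast
    have "h y - h x \<ge> 0" unfolding c(3) using c xy g_nonneg[of c] by simp
    then have "\<bar>h x - h y\<bar> = (y - x) * g c" using c(3) by simp
    also have "\<dots> \<le> (y - x) * g M" by (intro mult_left_mono g_mono) (use c xy in auto)
    finally show ?thesis using xy by (simp add: mult.commute)
  qed
  consider "x < y" | "x = y" | "y < x" by linarith
  then show ?thesis
    by cases (use *[of x y] *[of y x] assms in \<open>auto simp: abs_minus_commute\<close>)
qed

lemma f_nonneg: "0 \<le> f z"
  by (simp add: f_def)

lemma f_le: "0 \<le> z \<Longrightarrow> z \<le> Z \<Longrightarrow> f z \<le> f Z"
  unfolding f_def using \<alpha> by (intro divide_right_mono powr_mono2) auto

lemma continuous_on_f: "continuous_on {0..Z} f"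
  unfolding f_def by (intro continuous_intros continuous_on_powr') (use \<alpha> B in auto)

lemma f_has_derivative: "z > 0 \<Longrightarrow> (f has_real_derivative f' z) (at z)"
  unfolding f_def[abs_def] f'_def
  using DERIV_cdivide[OF has_real_derivative_powr, of z \<alpha> "B powr (\<alpha> - 1)"] by simp

text \<open>\<open>f\<close> is concave: its derivative blows up at 0 and is smallest at
  \<open>Z\<close>. This positive minimum is the source that pushes the slope up in
  \<open>gradient_lower\<close>.\<close>

lemma f'_ge: "0 < z \<Longrightarrow> z \<le> Z \<Longrightarrow> f' Z \<le> f' z"
  unfolding f'_def using \<alpha> Z by (intro divide_right_mono mult_left_mono powr_mono2') auto

lemma f'_pos: "f' Z > 0"
  unfolding f'_def using \<alpha> Z B by auto

lemma P_pos: "P > 0"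
  unfolding P_def using a_pos Z f_nonneg[of Z] by (intro mult_pos_pos) auto

text \<open>\<open>k\<close> is a parameter because truncated Hamiltonians occur as well as the true
  one. The equation is required at the endpoints too, with one-sided derivatives, so that the second
  derivative test applies there.\<close>

definition classical :: "(real \<Rightarrow> real) \<Rightarrow> (real \<Rightarrow> real) \<Rightarrow> (real \<Rightarrow> real) \<Rightarrow> bool" where
  "classical k V u \<longleftrightarrow>
    (\<forall>z\<in>{0..Z}. (V has_real_derivative u z) (at z within {0..Z})) \<and>
    (\<forall>z\<in>{0..Z}. (u has_real_derivative a * (\<rho> * V z - k (u z) - f z)) (at z within {0..Z})) \<and>
    u 0 = 0 \<and> u Z = 0"

lemma classicalD:
  assumes "classical k V u"
  shows "z \<in> {0..Z} \<Longrightarrow> (V has_real_derivative u z) (at z within {0..Z})"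
    "z \<in> {0..Z} \<Longrightarrow> (u has_real_derivative a * (\<rho> * V z - k (u z) - f z)) (at z within {0..Z})"
    "u 0 = 0" "u Z = 0" "continuous_on {0..Z} V" "continuous_on {0..Z} u"
  using assms unfolding classical_def by (auto intro: DERIV_continuous_on)

section \<open>The maximum principle and upper bounds\<close>

lemma derivative_zero_at_interior_max:
  fixes F :: "real \<Rightarrow> real"
  assumes "(F has_real_derivative d) (at z within {0..Z})" "0 < z" "z < Z"
    and "\<And>t. t \<in> {0..Z} \<Longrightarrow> F t \<le> F z"
  shows "d = 0"
proof (rule DERIV_local_max)
  show "DERIV F z :> d"
    using assms(1) at_within_interior[of z "{0..Z}"] assms(2,3) by simp
  show "0 < min z (Z - z)" using assms by simp
  show "\<forall>y. \<bar>z - y\<bar> < min z (Z - z) \<longrightarrow> F y \<le> F z" using assms(4) by (auto simp: abs_if split: if_splits)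
qed

lemma exists_max:
  assumes "continuous_on {0..Z} F"
  obtains z where "z \<in> {0..Z}" "\<And>t. t \<in> {0..Z} \<Longrightarrow> F t \<le> (F z :: real)"
  using continuous_attains_sup[of "{0..Z}" F] assms Z by auto

text \<open>At a maximum of \<open>V\<close>, inside or on the Neumann boundary, the slope is 0 and
  the second derivative is nonpositive. Since \<open>k 0 = 0\<close>, the equation leaves
  \<open>\<rho> * V y \<le> f y\<close>.\<close>

lemma value_upper:
  assumes cl: "classical k V u" and k0: "k 0 = 0" and z: "z \<in> {0..Z}"
  shows "\<rho> * V z \<le> f Z"
proof -
  note cl = classicalD[OF cl]
  obtain y where y: "y \<in> {0..Z}" "\<And>t. t \<in> {0..Z} \<Longrightarrow> V t \<le> V y"
    using exists_max[OF cl(5)] by blast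
  have u0: "u y = 0"
    using derivative_zero_at_interior_max[OF cl(1)[OF y(1)] _ _ y(2)] y(1) cl(3,4) by force
  have "a * (\<rho> * V y - k (u y) - f y) \<le> 0"
    by (rule second_derivative_nonpos_at_max[OF cl(1) cl(2)[OF y(1)] u0 y(1) Z y(2)])
  then have "\<rho> * V y \<le> f y" using a_pos k0 u0 by (simp add: mult_le_0_iff)
  moreover have "\<rho> * V z \<le> \<rho> * V y" using y z \<rho> by simp
  ultimately show ?thesis using f_le[of y] y(1) by simp
qed

text \<open>Where \<open>u > 0\<close>, the bound on \<open>V\<close> and the sign of
  \<open>k\<close> give a derivative of \<open>u\<close> of at most \<open>a * f Z\<close>, whatever
  the growth of \<open>k\<close>. So \<open>u\<close> minus a line of larger slope has no positive
  interior maximum.\<close>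

lemma gradient_upper:
  assumes cl: "classical k V u" and k: "k 0 = 0" "\<And>x. x > 0 \<Longrightarrow> k x \<ge> 0" and z: "z \<in> {0..Z}"
  shows "u z \<le> P"
proof -
  note cl' = classicalD[OF cl]
  let ?K = "a * (f Z + 1)"
  have K: "?K > 0" using a_pos f_nonneg[of Z] by auto
  have "continuous_on {0..Z} (\<lambda>t. u t - ?K * t)" by (intro continuous_intros cl')
  then obtain y where y: "y \<in> {0..Z}" "\<And>t. t \<in> {0..Z} \<Longrightarrow> u t - ?K * t \<le> u y - ?K * y"
    using exists_max by blast
  have "u y - ?K * y \<le> 0"
  proof (rule ccontr)
    assume neg: "\<not> u y - ?K * y \<le> 0"
    moreover have "?K * y \<ge> 0" using K y by auto
    ultimately have uy: "u y > 0" by linarith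
    then have y': "0 < y" "y < Z" using y(1) cl'(3,4) by (cases "y = 0"; cases "y = Z"; force)+
    have "((\<lambda>t. u t - ?K * t) has_real_derivative a * (\<rho> * V y - k (u y) - f y) - ?K) (at y within {0..Z})"
      by (auto intro!: derivative_eq_intros cl'(2) y)
    from derivative_zero_at_interior_max[OF this y' y(2)]
    have "\<rho> * V y - k (u y) - f y = f Z + 1" using a_pos by (simp add: mult_left_cancel)
    moreover have "\<rho> * V y \<le> f Z" by (rule value_upper[OF cl k(1) y(1)])
    ultimately show False using k(2)[OF uy] f_nonneg[of y] by linarith
  qed
  with y(2)[OF z] have "u z \<le> ?K * z" by linarith
  also have "\<dots> \<le> P" unfolding P_def using K z by (intro mult_left_mono) auto
  finally show ?thesis .
qed


section \<open>Initial value problems and shooting\<close>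

lemma exists_ivp:
  assumes lip: "\<And>x y. \<bar>k x - k y\<bar> \<le> K * \<bar>x - y\<bar>"
  obtains V u where "V 0 = v" "u 0 = 0"
    "\<And>z. z \<in> {0..Z} \<Longrightarrow> (V has_real_derivative u z) (at z within {0..Z})"
    "\<And>z. z \<in> {0..Z} \<Longrightarrow> (u has_real_derivative a * (\<rho> * V z - k (u z) - f z)) (at z within {0..Z})"
proof -
  have K: "K \<ge> 0" using lip[of 1 0] by simp
  have ck: "continuous_on UNIV k"
    by (rule lipschitz_on_continuous_on[of K], rule lipschitz_onI) (use lip K in \<open>auto simp: dist_real_def\<close>)
  define F where "F t y = (snd y, a * (\<rho> * fst y - k (snd y) - f t))" for t and y :: "real \<times> real"
  let ?K = "1 + a * (\<rho> + K)"
  have cont: "continuous_on ({0..Z} \<times> UNIV) (\<lambda>(t, y). F t y)"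
    unfolding F_def split_beta
    by (intro continuous_intros continuous_on_compose2[OF ck] continuous_on_compose2[OF continuous_on_f]) auto
  have lipF: "norm (F t x - F t y) \<le> ?K * norm (x - y)" for t x y
  proof -
    have n: "\<bar>fst x - fst y\<bar> \<le> norm (x - y)" "\<bar>snd x - snd y\<bar> \<le> norm (x - y)"
      using norm_fst_le[of "fst x - fst y" "snd x - snd y"] norm_snd_le[of "snd x - snd y" "fst x - fst y"]
      by (auto simp: minus_prod_def)
    have "norm (F t x - F t y) \<le> \<bar>snd x - snd y\<bar> + \<bar>a * (\<rho> * (fst x - fst y) - (k (snd x) - k (snd y)))\<bar>"
      using norm_Pair_le[of "snd x - snd y" "a * (\<rho> * (fst x - fst y) - (k (snd x) - k (snd y)))"]
      by (simp add: F_def algebra_simps)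
    also have "\<bar>a * (\<rho> * (fst x - fst y) - (k (snd x) - k (snd y)))\<bar>
        \<le> a * (\<rho> * \<bar>fst x - fst y\<bar> + K * \<bar>snd x - snd y\<bar>)"
    proof -
      have "\<bar>\<rho> * (fst x - fst y) - (k (snd x) - k (snd y))\<bar> \<le> \<rho> * \<bar>fst x - fst y\<bar> + K * \<bar>snd x - snd y\<bar>"
        using lip[of "snd x" "snd y"] \<rho> abs_triangle_ineq4[of "\<rho> * (fst x - fst y)" "k (snd x) - k (snd y)"]
        by (simp add: abs_mult)
      then show ?thesis using a_pos by (simp add: abs_mult)
    qed
    also have "\<dots> \<le> a * (\<rho> * norm (x - y) + K * norm (x - y))"
      using a_pos \<rho> K n by (intro mult_left_mono add_mono) auto
    finally show ?thesis using n(2) by (simp add: algebra_simps)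
  qed
  have "?K > 0" using a_pos \<rho> K by (intro add_pos_nonneg) auto
  then obtain y where y: "y 0 = (v, 0)"
    "\<And>t. t \<in> {0..Z} \<Longrightarrow> (y has_vector_derivative F t (y t)) (at t within {0..Z})"
    using picard_global[OF cont lipF _ , of "(v, 0)"] Z by auto
  have "((\<lambda>t. fst (y t)) has_real_derivative snd (y t)) (at t within {0..Z})"
    "((\<lambda>t. snd (y t)) has_real_derivative a * (\<rho> * fst (y t) - k (snd (y t)) - f t)) (at t within {0..Z})"
    if "t \<in> {0..Z}" for t
    using bounded_linear.has_vector_derivative[OF bounded_linear_fst y(2)[OF that]]
      bounded_linear.has_vector_derivative[OF bounded_linear_snd y(2)[OF that]]
    by (auto simp: F_def has_real_derivative_iff_has_vector_derivative)
  then show ?thesis using y(1) by (intro that[of "\<lambda>t. fst (y t)" "\<lambda>t. snd (y t)"]) auto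
qed

text \<open>Gronwall's inequality for the energy \<open>N\<close>. The summands of the rate come
  from the product \<open>D z * E z\<close>, from the zeroth-order term and from the Lipschitz bound
  on \<open>k\<close>. The slopes at \<open>Z\<close> are compared because they are the target of
  the shooting.\<close>

lemma ivp_stability:
  assumes lip: "\<And>x y. \<bar>k x - k y\<bar> \<le> K * \<bar>x - y\<bar>"
    and V: "\<And>z. z \<in> {0..Z} \<Longrightarrow> (V has_real_derivative u z) (at z within {0..Z})"
    and u: "\<And>z. z \<in> {0..Z} \<Longrightarrow> (u has_real_derivative a * (\<rho> * V z - k (u z) - f z)) (at z within {0..Z})"
    and V': "\<And>z. z \<in> {0..Z} \<Longrightarrow> (V' has_real_derivative u' z) (at z within {0..Z})"
    and u': "\<And>z. z \<in> {0..Z} \<Longrightarrow> (u' has_real_derivative a * (\<rho> * V' z - k (u' z) - f z)) (at z within {0..Z})"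
    and 0: "u 0 = 0" "u' 0 = 0"
  shows "\<bar>u Z - u' Z\<bar> \<le> sqrt (exp ((1 + a * \<rho> + 2 * a * K) * Z)) * \<bar>V 0 - V' 0\<bar>"
proof -
  have K: "K \<ge> 0" using lip[of 1 0] by simp
  define D E N where "D z = V z - V' z" and "E z = u z - u' z" and "N z = (D z)\<^sup>2 + (E z)\<^sup>2" for z
  define E' where "E' z = a * (\<rho> * D z - (k (u z) - k (u' z)))" for z
  let ?C = "1 + a * \<rho> + 2 * a * K"
  have DE: "(D has_real_derivative E z) (at z within {0..Z})"
    and EE: "(E has_real_derivative E' z) (at z within {0..Z})" if "z \<in> {0..Z}" for z
    unfolding D_def E_def E'_def using V[OF that] u[OF that] V'[OF that] u'[OF that]
    by (auto intro!: derivative_eq_intros simp: algebra_simps)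
  have "N Z \<le> (N 0 + 0 * Z) * exp (?C * Z)"
  proof (rule gronwall[of Z N "\<lambda>z. 2 * D z * E z + 2 * E z * E' z"])
    show "(N has_real_derivative 2 * D z * E z + 2 * E z * E' z) (at z within {0..Z})" if "z \<in> {0..Z}" for z
      unfolding N_def using DE[OF that] EE[OF that]
      by (auto intro!: derivative_eq_intros simp: power2_eq_square)
    show "2 * D z * E z + 2 * E z * E' z \<le> ?C * N z + 0" for z
    proof -
      have 1: "2 * (D z * E z) \<le> N z" using sum_squares_bound[of "D z" "E z"] by (simp add: N_def)
      have "- (E z * (k (u z) - k (u' z))) \<le> \<bar>E z\<bar> * \<bar>k (u z) - k (u' z)\<bar>"
        by (metis abs_ge_minus_self abs_mult)
      also have "\<dots> \<le> \<bar>E z\<bar> * (K * \<bar>E z\<bar>)"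
        using lip[of "u z" "u' z"] by (intro mult_left_mono) (auto simp: E_def)
      also have "\<dots> = K * (E z)\<^sup>2" by (simp add: power2_eq_square)
      also have "\<dots> \<le> K * N z" using K by (intro mult_left_mono) (auto simp: N_def)
      finally have 2: "- (E z * (k (u z) - k (u' z))) \<le> K * N z" .
      have "2 * E z * E' z = a * \<rho> * (2 * (D z * E z)) + 2 * a * (- (E z * (k (u z) - k (u' z))))"
        by (simp add: E'_def algebra_simps)
      also have "\<dots> \<le> a * \<rho> * N z + 2 * a * (K * N z)"
        using a_pos \<rho> 1 2 by (intro add_mono mult_left_mono) auto
      finally show ?thesis using 1 by (simp add: algebra_simps)
    qed
  qed (use a_pos \<rho> K Z in auto)
  then have "N Z \<le> (V 0 - V' 0)\<^sup>2 * exp (?C * Z)"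
    using 0 by (simp add: N_def D_def E_def)
  moreover have "(E Z)\<^sup>2 \<le> N Z" by (simp add: N_def)
  ultimately have "(E Z)\<^sup>2 \<le> (V 0 - V' 0)\<^sup>2 * exp (?C * Z)" by linarith
  also have "\<dots> = (sqrt (exp (?C * Z)) * \<bar>V 0 - V' 0\<bar>)\<^sup>2"
    by (simp add: power_mult_distrib mult.commute)
  finally show ?thesis unfolding E_def by (subst (asm) power2_le_iff_abs_le) auto
qed

text \<open>Shooting: the terminal slope depends continuously on \<open>V 0\<close>, and by the maximum
  principle it is nonpositive for \<open>V 0 = -1\<close> and nonnegative for \<open>V 0 = f Z / \<rho> + 1\<close>.\<close>

lemma exists_classical_lipschitz:
  assumes lip: "\<And>x y. \<bar>k x - k y\<bar> \<le> K * \<bar>x - y\<bar>" and k0: "k 0 = 0"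
  obtains V u where "classical k V u"
proof -
  have "\<exists>V u. V 0 = v \<and> u 0 = 0 \<and>
    (\<forall>z\<in>{0..Z}. (V has_real_derivative u z) (at z within {0..Z})) \<and>
    (\<forall>z\<in>{0..Z}. (u has_real_derivative a * (\<rho> * V z - k (u z) - f z)) (at z within {0..Z}))" for v
    using exists_ivp[OF lip, of v] by metis
  then obtain V u where V0: "\<And>v. V v 0 = v" and u0: "\<And>v. u v 0 = 0"
    and V: "\<And>v z. z \<in> {0..Z} \<Longrightarrow> (V v has_real_derivative u v z) (at z within {0..Z})"
    and u: "\<And>v z. z \<in> {0..Z} \<Longrightarrow> (u v has_real_derivative a * (\<rho> * V v z - k (u v z) - f z)) (at z within {0..Z})"
    by metis
  have K: "K \<ge> 0" using lip[of 1 0] by simp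
  have "continuous_on {-1..f Z / \<rho> + 1} (\<lambda>v. u v Z)"
  proof (rule lipschitz_on_continuous_on[of "sqrt (exp ((1 + a * \<rho> + 2 * a * K) * Z))"], rule lipschitz_onI)
    show "dist (u v Z) (u v' Z) \<le> sqrt (exp ((1 + a * \<rho> + 2 * a * K) * Z)) * dist v v'" for v v'
      using ivp_stability[OF lip V u V u u0 u0, of v v'] by (simp add: dist_real_def V0)
  qed simp
  \<comment> \<open>A positive slope at \<open>Z\<close> moves the minimum of \<open>V\<close> away
    from \<open>Z\<close>, to a point of zero slope. There the equation gives
    \<open>\<rho> * V \<ge> f \<ge> 0\<close>, although the minimum is at most
    \<open>V 0 = -1\<close>.\<close>
  moreover have "u (-1) Z \<le> 0"
  proof (rule ccontr)
    let ?V = "V (-1)" and ?u = "u (-1)"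
    assume pos: "\<not> ?u Z \<le> 0"
    have D: "((\<lambda>t. - ?V t) has_real_derivative - ?u z) (at z within {0..Z})" if "z \<in> {0..Z}" for z
      by (intro derivative_intros V that)
    have "continuous_on {0..Z} (\<lambda>t. - ?V t)" using D by (rule DERIV_continuous_on)
    then obtain y where y: "y \<in> {0..Z}" "\<And>t. t \<in> {0..Z} \<Longrightarrow> - ?V t \<le> - ?V y"
      using exists_max by blast
    have "y \<noteq> Z"
    proof
      assume "y = Z"
      from has_real_derivative_pos_inc_left[OF V[of Z "-1"], of] pos Z obtain e where e: "e > 0"
        "\<And>h. h > 0 \<Longrightarrow> Z - h \<in> {0..Z} \<Longrightarrow> h < e \<Longrightarrow> ?V (Z - h) < ?V Z" by auto
      have "min e Z / 2 > 0" "Z - min e Z / 2 \<in> {0..Z}" "min e Z / 2 < e"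
        using e(1) Z by (auto simp: min_def)
      then show False using e(2) y(2) \<open>y = Z\<close> by fastforce
    qed
    then have uy: "- ?u y = 0"
      using derivative_zero_at_interior_max[OF D[OF y(1)] _ _ y(2)] y(1) u0[of "-1"] by (cases "y = 0") auto
    have "((\<lambda>t. - ?u t) has_real_derivative - (a * (\<rho> * ?V y - k (?u y) - f y))) (at y within {0..Z})"
      by (intro derivative_intros u y)
    from second_derivative_nonpos_at_max[OF D this uy y(1) Z y(2)]
    have "\<rho> * ?V y - f y \<ge> 0" using a_pos uy k0 by (simp add: zero_le_mult_iff)
    moreover have "?V y \<le> -1" using y(2)[of 0] Z V0[of "-1"] by simp
    ultimately show False using f_nonneg[of y] \<rho> by (smt (verit) mult_pos_neg)
  qed
  \<comment> \<open>The mirror image: a negative slope at \<open>Z\<close> yields a maximum of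
    \<open>V\<close> with zero slope, hence \<open>\<rho> * V \<le> f Z\<close>, below the initial
    value.\<close>
  moreover have "u (f Z / \<rho> + 1) Z \<ge> 0"
  proof (rule ccontr)
    let ?V = "V (f Z / \<rho> + 1)" and ?u = "u (f Z / \<rho> + 1)"
    assume neg: "\<not> ?u Z \<ge> 0"
    have "continuous_on {0..Z} ?V" using V by (rule DERIV_continuous_on)
    then obtain y where y: "y \<in> {0..Z}" "\<And>t. t \<in> {0..Z} \<Longrightarrow> ?V t \<le> ?V y"
      using exists_max by blast
    have "y \<noteq> Z"
    proof
      assume "y = Z"
      from has_real_derivative_neg_dec_left[OF V[of Z "f Z / \<rho> + 1"]] neg Z obtain e where e: "e > 0"
        "\<And>h. h > 0 \<Longrightarrow> Z - h \<in> {0..Z} \<Longrightarrow> h < e \<Longrightarrow> ?V Z < ?V (Z - h)" by auto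
      have "min e Z / 2 > 0" "Z - min e Z / 2 \<in> {0..Z}" "min e Z / 2 < e"
        using e(1) Z by (auto simp: min_def)
      then show False using e(2) y(2) \<open>y = Z\<close> by fastforce
    qed
    then have uy: "?u y = 0"
      using derivative_zero_at_interior_max[OF V[OF y(1)] _ _ y(2)] y(1) u0 by (cases "y = 0") auto
    from second_derivative_nonpos_at_max[OF V u[OF y(1)] uy y(1) Z y(2)]
    have "\<rho> * ?V y - f y \<le> 0" using a_pos uy k0 by (simp add: mult_le_0_iff)
    moreover have "\<rho> * (f Z / \<rho> + 1) \<le> \<rho> * ?V y" using y(2)[of 0] Z V0[of "f Z / \<rho> + 1"] \<rho> by simp
    ultimately show False using f_le[of y] y(1) \<rho> by (simp add: distrib_left)
  qed
  moreover have "-1 \<le> f Z / \<rho> + 1" using f_nonneg[of Z] \<rho> by (smt (verit) divide_nonneg_pos)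
  ultimately obtain v where "u v Z = 0"
    using IVT'[of "\<lambda>v. u v Z" "-1" 0 "f Z / \<rho> + 1"] by auto
  then show ?thesis
    by (intro that[of "V v" "u v"]) (use V u u0 in \<open>auto simp: classical_def\<close>)
qed

abbreviation hs :: "real \<Rightarrow> real \<Rightarrow> real" where "hs s \<equiv> \<lambda>x. h x + s * x"

text \<open>The gradient bound \<open>u \<le> P\<close> does not see the growth of the Hamiltonian, so truncating
  it at slope \<open>P\<close> makes it Lipschitz without changing the solution.\<close>

lemma exists_classical:
  assumes "s \<ge> 0"
  obtains V u where "classical (hs s) V u"
proof -
  define k where "k x = h (min x P) + s * x" for x
  have k0: "k 0 = 0" using P_pos by (simp add: k_def h_0)
  have "\<bar>k x - k y\<bar> \<le> (g P + s) * \<bar>x - y\<bar>" for x y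
  proof -
    have "\<bar>k x - k y\<bar> \<le> \<bar>h (min x P) - h (min y P)\<bar> + \<bar>s * (x - y)\<bar>"
      by (simp add: k_def algebra_simps abs_if)
    also have "\<bar>h (min x P) - h (min y P)\<bar> \<le> g P * \<bar>min x P - min y P\<bar>"
      by (rule h_lipschitz) auto
    also have "\<dots> \<le> g P * \<bar>x - y\<bar>"
      by (intro mult_left_mono g_nonneg) auto
    finally show ?thesis using assms by (simp add: abs_mult distrib_right)
  qed
  then obtain V u where cl: "classical k V u"
    using exists_classical_lipschitz k0 by metis
  have "u z \<le> P" if "z \<in> {0..Z}" for z
    by (rule gradient_upper[OF cl k0 _ that]) (use assms h_nonneg in \<open>auto simp: k_def\<close>)
  then have "k (u z) = hs s (u z)" if "z \<in> {0..Z}" for z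
    using that by (simp add: k_def min_def)
  with cl have "classical (hs s) V u" by (auto simp: classical_def)
  then show ?thesis by (rule that)
qed



section \<open>Two-sided gradient bounds and stability in the spillover\<close>

lemma gradient_le_P:
  assumes "classical (hs s) V u" "0 \<le> s" "z \<in> {0..Z}"
  shows "u z \<le> P"
  by (rule gradient_upper[OF assms(1) _ _ assms(3)]) (use assms h_nonneg h_0 in auto)

text \<open>A Hopf-type lower bound: \<open>\<kappa> z (Z - z)\<close> is a strict subsolution of the equation obtained by
  differentiating the Hamilton-Jacobi equation, whose source \<open>f'\<close> is bounded below.\<close>

lemma gradient_lower:
  assumes "0 \<le> S"
  obtains \<kappa> where "\<kappa> > 0"
    "\<And>s V u z. classical (hs s) V u \<Longrightarrow> s \<in> {0..S} \<Longrightarrow> z \<in> {0..Z} \<Longrightarrow> \<kappa> * (z * (Z - z)) \<le> u z"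
proof
  \<comment> \<open>\<open>?c\<close> collects all coefficients of \<kappa> at a positive maximum of
    \<open>F\<close>: the zeroth-order term, the transport term and the 2 from the second derivative
    of the barrier. With this \<kappa> they amount to half of the source
    \<open>a * f' Z\<close>.\<close>
  let ?c = "a * (\<rho> * Z\<^sup>2 + (g P + S) * Z) + 2"
  define \<kappa> where "\<kappa> = a * f' Z / (2 * ?c)"
  have c: "?c > 0"
  proof -
    have "a * (\<rho> * Z\<^sup>2 + (g P + S) * Z) \<ge> 0"
      using a_pos \<rho> Z assms g_nonneg[of P] by (intro mult_nonneg_nonneg add_nonneg_nonneg) auto
    then show ?thesis by linarith
  qed
  show \<kappa>: "\<kappa> > 0" unfolding \<kappa>_def using a_pos f'_pos c by (intro divide_pos_pos mult_pos_pos) auto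
  fix s V u z
  assume clas: "classical (hs s) V u" and s: "s \<in> {0..S}" and z: "z \<in> {0..Z}"
  note cl = classicalD[OF clas]
  define R where "R t = a * (\<rho> * V t - hs s (u t) - f t)" for t
  define F where "F t = \<kappa> * (t * (Z - t)) - u t" for t
  define F1 where "F1 t = \<kappa> * (Z - 2 * t) - R t" for t
  have dF: "(F has_real_derivative F1 t) (at t within {0..Z})" if "t \<in> {0..Z}" for t
    unfolding F_def F1_def R_def
    by (auto intro!: derivative_eq_intros cl(2) that simp: algebra_simps)
  have "continuous_on {0..Z} F" using dF by (rule DERIV_continuous_on)
  then obtain y where y: "y \<in> {0..Z}" "\<And>t. t \<in> {0..Z} \<Longrightarrow> F t \<le> F y"
    using exists_max by blast
  have "F y \<le> 0"
  proof (rule ccontr)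
    assume neg: "\<not> F y \<le> 0"
    then have y': "0 < y" "y < Z" using y(1) cl(3,4) by (cases "y = 0"; cases "y = Z"; force simp: F_def)+
    have F1: "F1 y = 0" by (rule derivative_zero_at_interior_max[OF dF[OF y(1)] y' y(2)])
    \<comment> \<open>The Hamilton-Jacobi equation is differentiated once, at an interior point
      because \<open>f\<close> is singular at 0. The result is linear in \<open>R\<close>, with the
      drift as coefficient.\<close>
    have "(R has_real_derivative a * (\<rho> * u y - (g (u y) * R y + s * R y) - f' y)) (at y within {0..Z})"
      unfolding R_def
      by (auto intro!: derivative_eq_intros DERIV_chain2[OF h_has_derivative] cl(1,2) y
          has_field_derivative_at_within[OF f_has_derivative] y')
    then have "(F1 has_real_derivative - (2 * \<kappa>) - a * (\<rho> * u y - (g (u y) * R y + s * R y) - f' y)) (at y within {0..Z})"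
      unfolding F1_def by (auto intro!: derivative_eq_intros)
    from second_derivative_nonpos_at_max[OF dF this F1 y(1) Z y(2)]
    have le: "- (2 * \<kappa>) \<le> a * (\<rho> * u y - (g (u y) + s) * R y - f' y)"
      by (simp add: algebra_simps)
    have R: "R y = \<kappa> * (Z - 2 * y)" using F1 by (simp add: F1_def)
    have "y * (Z - y) \<le> Z * Z" using y' by (intro mult_mono) auto
    then have "\<kappa> * (y * (Z - y)) \<le> \<kappa> * Z\<^sup>2" using \<kappa> by (simp add: power2_eq_square)
    then have "u y \<le> \<kappa> * Z\<^sup>2" using neg by (simp add: F_def)
    then have 1: "\<rho> * u y \<le> \<rho> * (\<kappa> * Z\<^sup>2)" using \<rho> by simp
    have gs: "0 \<le> g (u y) + s" "g (u y) + s \<le> g P + S"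
      using g_nonneg[of "u y"] g_mono[OF gradient_le_P[OF clas _ y(1)]] s by auto
    have "- ((g (u y) + s) * R y) = (g (u y) + s) * (\<kappa> * (2 * y - Z))" unfolding R by (simp add: algebra_simps)
    also have "\<dots> \<le> (g (u y) + s) * (\<kappa> * Z)"
      using gs \<kappa> y' by (intro mult_left_mono) auto
    also have "\<dots> \<le> (g P + S) * (\<kappa> * Z)"
      using gs \<kappa> Z by (intro mult_right_mono) auto
    finally have 2: "- ((g (u y) + s) * R y) \<le> (g P + S) * (\<kappa> * Z)" .
    have "\<rho> * u y - (g (u y) + s) * R y - f' y \<le> \<rho> * (\<kappa> * Z\<^sup>2) + (g P + S) * (\<kappa> * Z) - f' Z"
      using 1 2 f'_ge[of y] y' by linarith
    then have "- (2 * \<kappa>) \<le> a * (\<rho> * (\<kappa> * Z\<^sup>2) + (g P + S) * (\<kappa> * Z) - f' Z)"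
      using le a_pos by (smt (verit) mult_left_mono)
    then have "a * f' Z \<le> \<kappa> * ?c" by (simp add: algebra_simps)
    also have "\<kappa> * ?c = a * f' Z / 2" using c by (simp add: \<kappa>_def field_simps)
    finally show False using a_pos f'_pos by (smt (verit) field_sum_of_halves mult_pos_pos)
  qed
  with y(2)[OF z] show "\<kappa> * (z * (Z - z)) \<le> u z" by (simp add: F_def)
qed

lemma gradient_nonneg:
  assumes c: "classical (hs s) V u" and s: "0 \<le> s" and z: "z \<in> {0..Z}"
  shows "0 \<le> u z"
proof -
  obtain \<kappa> where \<kappa>: "\<kappa> > 0"
    "\<And>s' V u z. classical (hs s') V u \<Longrightarrow> s' \<in> {0..s} \<Longrightarrow> z \<in> {0..Z} \<Longrightarrow> \<kappa> * (z * (Z - z)) \<le> u z"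
    using gradient_lower[OF s] by blast
  have "0 \<le> \<kappa> * (z * (Z - z))" using \<kappa>(1) z by auto
  also have "\<dots> \<le> u z" by (rule \<kappa>(2)[OF c _ z]) (use s in auto)
  finally show ?thesis .
qed

text \<open>Inside the interval the slope avoids 0, the only point where \<open>g\<close> may fail
  to be differentiable; the regularity of the densities rests on this.\<close>

lemma gradient_pos:
  assumes c: "classical (hs s) V u" and s: "0 \<le> s" and z: "0 < z" "z < Z"
  shows "0 < u z"
proof -
  obtain \<kappa> where \<kappa>: "\<kappa> > 0"
    "\<And>s' V u z. classical (hs s') V u \<Longrightarrow> s' \<in> {0..s} \<Longrightarrow> z \<in> {0..Z} \<Longrightarrow> \<kappa> * (z * (Z - z)) \<le> u z"
    using gradient_lower[OF s] by blast
  have "0 < \<kappa> * (z * (Z - z))" using \<kappa>(1) z by simp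
  also have "\<dots> \<le> u z" by (rule \<kappa>(2)[OF c]) (use s z in auto)
  finally show ?thesis .
qed

text \<open>At a maximum of \<open>V1 - V2\<close> the slopes coincide, so the nonlinear parts
  cancel and only \<open>(s1 - s2) * u2\<close> is left.\<close>

lemma value_difference:
  assumes c1: "classical (hs s1) V1 u1" and c2: "classical (hs s2) V2 u2"
    and s: "0 \<le> s1" "0 \<le> s2" and z: "z \<in> {0..Z}"
  shows "\<rho> * (V1 z - V2 z) \<le> \<bar>s1 - s2\<bar> * P"
proof -
  note cl1 = classicalD[OF c1] and cl2 = classicalD[OF c2]
  have D: "((\<lambda>t. V1 t - V2 t) has_real_derivative u1 t - u2 t) (at t within {0..Z})" if "t \<in> {0..Z}" for t
    by (intro derivative_intros cl1 cl2 that)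
  have "continuous_on {0..Z} (\<lambda>t. V1 t - V2 t)" using D by (rule DERIV_continuous_on)
  then obtain y where y: "y \<in> {0..Z}" "\<And>t. t \<in> {0..Z} \<Longrightarrow> V1 t - V2 t \<le> V1 y - V2 y"
    using exists_max by blast
  have E0: "u1 y - u2 y = 0"
    using derivative_zero_at_interior_max[OF D[OF y(1)] _ _ y(2)] y(1) cl1(3,4) cl2(3,4) by force
  have "((\<lambda>t. u1 t - u2 t) has_real_derivative
      a * (\<rho> * V1 y - hs s1 (u1 y) - f y) - a * (\<rho> * V2 y - hs s2 (u2 y) - f y)) (at y within {0..Z})"
    by (intro derivative_intros cl1 cl2 y)
  from second_derivative_nonpos_at_max[OF D this E0 y(1) Z y(2)]
  have "a * (\<rho> * (V1 y - V2 y) - (s1 - s2) * u2 y) \<le> 0"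
    using E0 by (simp add: algebra_simps)
  then have "\<rho> * (V1 y - V2 y) \<le> (s1 - s2) * u2 y" using a_pos by (simp add: mult_le_0_iff)
  also have "\<dots> \<le> \<bar>s1 - s2\<bar> * P"
    using gradient_nonneg[OF c2 s(2) y(1)] gradient_le_P[OF c2 s(2) y(1)] P_pos
    by (intro mult_mono) auto
  finally show ?thesis using y(2)[OF z] \<rho> by (smt (verit) mult_left_mono)
qed

lemma powr_increment_le:
  fixes r R t :: real
  assumes "0 \<le> r" "r \<le> R" "0 < t"
  shows "(1 + r) powr t - 1 \<le> t * (1 + R) powr t * r"
proof (cases "r = 0")
  case False
  then have r: "0 < r" using assms by simp
  have "\<exists>x. 0 < x \<and> x < r \<and> (1 + r) powr t - (1 + 0) powr t = (r - 0) * (t * (1 + x) powr (t - 1))"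
    by (rule MVT2[OF r]) (use r in \<open>auto intro!: derivative_eq_intros\<close>)
  then obtain x where x: "0 < x" "x < r" "(1 + r) powr t - 1 = r * (t * (1 + x) powr (t - 1))" by auto
  \<comment> \<open>The exponent \<open>t - 1\<close> is negative for \<open>t < 1\<close>; raising
    it to \<open>t\<close> makes the power increase with its base.\<close>
  have "(1 + x) powr (t - 1) \<le> (1 + x) powr t" using x by (intro powr_mono) auto
  also have "\<dots> \<le> (1 + R) powr t" using x assms by (intro powr_mono2) auto
  finally have "r * (t * (1 + x) powr (t - 1)) \<le> r * (t * (1 + R) powr t)"
    using assms by (intro mult_left_mono) auto
  then show ?thesis using x(3) by (simp add: mult_ac)
qed auto

text \<open>For \<open>\<theta> < 1\<close> the function \<open>g\<close> is not Lipschitz at 0; only the ratio of the gradients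
  controls it.\<close>

lemma g_ratio:
  assumes x: "0 \<le> x" "x \<le> P" and y: "0 \<le> y" "y \<le> P" and r: "0 \<le> r" "r \<le> R"
    and xy: "x \<le> y + r * y"
  shows "g x - g y \<le> \<theta> * (1 + R) powr \<theta> * g P * r"
proof -
  have "g x \<le> g ((1 + r) * y)" using xy by (intro g_mono) (simp add: algebra_simps)
  \<comment> \<open>\<open>g\<close> is homogeneous of degree \<theta> on nonnegative
    arguments.\<close>
  also have "\<dots> = (1 + r) powr \<theta> * g y"
  proof -
    have "\<gamma> / w * max 0 ((1 + r) * y) = (1 + r) * (\<gamma> / w * max 0 y)" using y r by (simp add: max_def)
    then show ?thesis unfolding g_def using \<gamma> w r y by (subst powr_mult[symmetric]) (auto simp: mult_ac)
  qed
  finally have "g x - g y \<le> ((1 + r) powr \<theta> - 1) * g y" by (simp add: algebra_simps)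
  also have "\<dots> \<le> (\<theta> * (1 + R) powr \<theta> * r) * g P"
    using powr_increment_le[OF r \<theta>_pos] g_mono[OF y(2)] g_nonneg \<theta>_pos r
    by (intro mult_mono) auto
  finally show ?thesis by (simp add: mult_ac)
qed

text \<open>The values are already controlled, so the difference \<open>E\<close> of the slopes
  obeys a first-order inequality. Gronwall bounds \<open>E\<close>, the equation then bounds its
  derivative, and as \<open>E\<close> vanishes at both ends it decays linearly there. The factor
  \<open>z * (Z - z)\<close> matches the barrier in \<open>gradient_lower\<close>.\<close>

lemma gradient_difference:
  assumes S: "0 \<le> S"
  obtains C where "C \<ge> 0"
    "\<And>s1 s2 V1 u1 V2 u2 z. classical (hs s1) V1 u1 \<Longrightarrow> classical (hs s2) V2 u2 \<Longrightarrow>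
      s1 \<in> {0..S} \<Longrightarrow> s2 \<in> {0..S} \<Longrightarrow> z \<in> {0..Z} \<Longrightarrow> \<bar>u1 z - u2 z\<bar> \<le> C * \<bar>s1 - s2\<bar> * (z * (Z - z))"
proof -
  define G where "G = g P + S"
  \<comment> \<open>\<open>A\<close> covers two terms of size \<open>P\<close> times |s1 - s2|, the
    difference of the values and the explicit \<open>(s1 - s2) * u2\<close>; \<open>G\<close> covers
    the Lipschitz constant of the Hamiltonian for slopes up to \<open>P\<close>.\<close>
  define A where "A = 2 * a * P"
  define C1 where "C1 = sqrt (Z * exp ((1 + 2 * a * G) * Z)) * A"
  define C2 where "C2 = A + a * G * C1"
  have G: "G \<ge> 0" using g_nonneg[of P] S by (simp add: G_def)
  have A: "A > 0" using a_pos P_pos by (simp add: A_def)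
  have C1: "C1 \<ge> 0" using A Z by (simp add: C1_def)
  have C2: "C2 \<ge> 0" unfolding C2_def using mult_nonneg_nonneg[OF mult_nonneg_nonneg[OF less_imp_le[OF a_pos] G] C1] A by linarith
  show ?thesis
  proof (rule that[of "2 * C2 / Z"])
    show "2 * C2 / Z \<ge> 0" using C2 Z by simp
    fix s1 s2 V1 u1 V2 u2 z
    assume c1: "classical (hs s1) V1 u1" and c2: "classical (hs s2) V2 u2"
      and s1: "s1 \<in> {0..S}" and s2: "s2 \<in> {0..S}" and z: "z \<in> {0..Z}"
    note cl1 = classicalD[OF c1] and cl2 = classicalD[OF c2]
    let ?d = "\<bar>s1 - s2\<bar>"
    define E where "E t = u1 t - u2 t" for t
    define E' where "E' t = a * (\<rho> * (V1 t - V2 t) - (h (u1 t) - h (u2 t)) - s1 * E t - (s1 - s2) * u2 t)" for t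
    have dE: "(E has_real_derivative E' t) (at t within {0..Z})" if "t \<in> {0..Z}" for t
    proof -
      have "(E has_real_derivative
        a * (\<rho> * V1 t - hs s1 (u1 t) - f t) - a * (\<rho> * V2 t - hs s2 (u2 t) - f t)) (at t within {0..Z})"
        unfolding E_def by (intro derivative_intros cl1 cl2 that)
      then show ?thesis by (simp add: E'_def E_def algebra_simps)
    qed
    have E'_le: "\<bar>E' t\<bar> \<le> A * ?d + a * G * \<bar>E t\<bar>" if t: "t \<in> {0..Z}" for t
    proof -
      have "\<bar>\<rho> * (V1 t - V2 t)\<bar> \<le> ?d * P"
        using value_difference[OF c1 c2 _ _ t] value_difference[OF c2 c1 _ _ t] s1 s2
        by (simp add: abs_le_iff abs_minus_commute algebra_simps)
      moreover have "\<bar>h (u1 t) - h (u2 t)\<bar> \<le> g P * \<bar>E t\<bar>"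
        unfolding E_def using gradient_le_P[OF c1 _ t] gradient_le_P[OF c2 _ t] s1 s2 by (intro h_lipschitz) auto
      moreover have "\<bar>s1 * E t\<bar> \<le> S * \<bar>E t\<bar>" using s1 by (simp add: abs_mult mult_right_mono)
      moreover have "\<bar>(s1 - s2) * u2 t\<bar> \<le> ?d * P"
        using gradient_le_P[OF c2 _ t] gradient_nonneg[OF c2 _ t] s2 by (simp add: abs_mult mult_left_mono)
      ultimately have "\<bar>\<rho> * (V1 t - V2 t) - (h (u1 t) - h (u2 t)) - s1 * E t - (s1 - s2) * u2 t\<bar>
          \<le> 2 * P * ?d + G * \<bar>E t\<bar>"
        unfolding G_def by (simp add: algebra_simps) linarith
      then have "a * \<bar>\<rho> * (V1 t - V2 t) - (h (u1 t) - h (u2 t)) - s1 * E t - (s1 - s2) * u2 t\<bar>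
          \<le> a * (2 * P * ?d + G * \<bar>E t\<bar>)"
        using a_pos by (intro mult_left_mono) auto
      moreover have "\<bar>E' t\<bar> = a * \<bar>\<rho> * (V1 t - V2 t) - (h (u1 t) - h (u2 t)) - s1 * E t - (s1 - s2) * u2 t\<bar>"
        unfolding E'_def abs_mult using a_pos by simp
      moreover have "a * (2 * P * ?d + G * \<bar>E t\<bar>) = A * ?d + a * G * \<bar>E t\<bar>"
        by (simp add: A_def algebra_simps)
      ultimately show ?thesis by linarith
    qed
    have E0: "E 0 = 0" "E Z = 0" using cl1 cl2 by (auto simp: E_def)
    have E_le: "\<bar>E t\<bar> \<le> C1 * ?d" if t: "t \<in> {0..Z}" for t
    proof -
      have "(E t)\<^sup>2 \<le> ((E 0)\<^sup>2 + (A * ?d)\<^sup>2 * t) * exp ((1 + 2 * a * G) * t)"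
      proof (rule gronwall[of Z "\<lambda>t. (E t)\<^sup>2" "\<lambda>t. 2 * E t * E' t"])
        show "((\<lambda>t. (E t)\<^sup>2) has_real_derivative 2 * E t * E' t) (at t within {0..Z})" if "t \<in> {0..Z}" for t
          by (auto intro!: derivative_eq_intros dE that)
        show "2 * E t * E' t \<le> (1 + 2 * a * G) * (E t)\<^sup>2 + (A * ?d)\<^sup>2" if "t \<in> {0..Z}" for t
        proof -
          have "2 * E t * E' t \<le> 2 * \<bar>E t\<bar> * \<bar>E' t\<bar>"
            using abs_ge_self[of "E t * E' t"] by (simp add: abs_mult)
          also have "\<dots> \<le> 2 * \<bar>E t\<bar> * (A * ?d + a * G * \<bar>E t\<bar>)"
            by (intro mult_left_mono E'_le that) auto
          also have "\<dots> = 2 * \<bar>E t\<bar> * (A * ?d) + 2 * a * G * \<bar>E t\<bar>\<^sup>2"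
            by (simp only: distrib_left power2_eq_square mult_ac)
          also have "\<bar>E t\<bar>\<^sup>2 = (E t)\<^sup>2" by simp
          also have "2 * \<bar>E t\<bar> * (A * ?d) \<le> (E t)\<^sup>2 + (A * ?d)\<^sup>2"
            using sum_squares_bound[of "\<bar>E t\<bar>" "A * ?d"] by simp
          finally show ?thesis by (simp add: distrib_right)
        qed
      qed (use t G a_pos in auto)
      also have "\<dots> = (A * ?d)\<^sup>2 * (t * exp ((1 + 2 * a * G) * t))" using E0 by simp
      also have "\<dots> \<le> (A * ?d)\<^sup>2 * (Z * exp ((1 + 2 * a * G) * Z))"
      proof -
        have "(1 + 2 * a * G) * t \<le> (1 + 2 * a * G) * Z"
          using t G a_pos by (intro mult_left_mono add_nonneg_nonneg mult_nonneg_nonneg) auto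
        then have "t * exp ((1 + 2 * a * G) * t) \<le> Z * exp ((1 + 2 * a * G) * Z)"
          using t by (intro mult_mono) auto
        then show ?thesis by (rule mult_left_mono) simp
      qed
      also have "\<dots> = (sqrt (Z * exp ((1 + 2 * a * G) * Z)))\<^sup>2 * (A * ?d)\<^sup>2"
        using Z by (subst real_sqrt_pow2) auto
      also have "\<dots> = (C1 * ?d)\<^sup>2" by (simp only: C1_def power_mult_distrib mult.assoc)
      finally show ?thesis using C1 by (subst (asm) power2_le_iff_abs_le) auto
    qed
    have E'_le2: "\<bar>E' t\<bar> \<le> C2 * ?d" if t: "t \<in> {0..Z}" for t
    proof -
      have "a * G * \<bar>E t\<bar> \<le> a * G * (C1 * ?d)"
        using a_pos G by (intro mult_left_mono E_le t) auto
      then show ?thesis using E'_le[OF t] by (simp add: C2_def distrib_right mult.assoc)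
    qed
    have lip: "\<bar>E x - E y\<bar> \<le> C2 * ?d * \<bar>x - y\<bar>" if "x \<in> {0..Z}" "y \<in> {0..Z}" for x y
    proof -
      have "norm (E x - E y) \<le> C2 * ?d * norm (x - y)"
        by (rule field_differentiable_bound[of "{0..Z}" E E']) (use that dE E'_le2 in auto)
      then show ?thesis by simp
    qed
    have b: "\<bar>E z\<bar> \<le> C2 * ?d * z" "\<bar>E z\<bar> \<le> C2 * ?d * (Z - z)"
      using lip[of z 0] lip[of z Z] z Z E0 by auto
    \<comment> \<open>Weighting each of the two endpoint bounds with the distance to the other
      endpoint produces the symmetric factor.\<close>
    have "Z * \<bar>E z\<bar> = z * \<bar>E z\<bar> + (Z - z) * \<bar>E z\<bar>" by (simp add: algebra_simps)
    also have "\<dots> \<le> z * (C2 * ?d * (Z - z)) + (Z - z) * (C2 * ?d * z)"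
      using b z by (intro add_mono mult_left_mono) auto
    finally have "Z * \<bar>E z\<bar> \<le> 2 * C2 * ?d * (z * (Z - z))" by (simp add: algebra_simps)
    then show "\<bar>u1 z - u2 z\<bar> \<le> 2 * C2 / Z * ?d * (z * (Z - z))"
      using Z by (simp add: E_def field_simps)
  qed
qed

text \<open>Dividing \<open>gradient_difference\<close> by the lower bound for the slope cancels the
  vanishing factor: \<open>u1\<close> exceeds \<open>u2\<close> by at most a relative error
  \<open>r\<close> proportional to |s1 - s2|, which is the input of \<open>g_ratio\<close>.\<close>

lemma drift_difference:
  assumes S: "0 \<le> S"
  obtains C where "C \<ge> 0"
    "\<And>s1 s2 V1 u1 V2 u2 z. classical (hs s1) V1 u1 \<Longrightarrow> classical (hs s2) V2 u2 \<Longrightarrow>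
      s1 \<in> {0..S} \<Longrightarrow> s2 \<in> {0..S} \<Longrightarrow> z \<in> {0..Z} \<Longrightarrow>
      \<bar>(g (u1 z) + s1) - (g (u2 z) + s2)\<bar> \<le> C * \<bar>s1 - s2\<bar>"
proof -
  obtain C0 where C0: "C0 \<ge> 0" "\<And>s1 s2 V1 u1 V2 u2 z. classical (hs s1) V1 u1 \<Longrightarrow> classical (hs s2) V2 u2 \<Longrightarrow>
      s1 \<in> {0..S} \<Longrightarrow> s2 \<in> {0..S} \<Longrightarrow> z \<in> {0..Z} \<Longrightarrow> \<bar>u1 z - u2 z\<bar> \<le> C0 * \<bar>s1 - s2\<bar> * (z * (Z - z))"
    using gradient_difference[OF S] by blast
  obtain \<kappa> where \<kappa>: "\<kappa> > 0"
    "\<And>s V u z. classical (hs s) V u \<Longrightarrow> s \<in> {0..S} \<Longrightarrow> z \<in> {0..Z} \<Longrightarrow> \<kappa> * (z * (Z - z)) \<le> u z"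
    using gradient_lower[OF S] by blast
  define C where "C = C0 / \<kappa>"
  have C: "C \<ge> 0" using C0 \<kappa> by (simp add: C_def)
  let ?K = "\<theta> * (1 + C * S) powr \<theta> * g P * C"
  have K: "?K \<ge> 0" using \<theta>_pos C g_nonneg[of P] by (intro mult_nonneg_nonneg) auto
  have one: "g (u1 z) - g (u2 z) \<le> ?K * \<bar>s1 - s2\<bar>"
    if c1: "classical (hs s1) V1 u1" and c2: "classical (hs s2) V2 u2"
      and s: "s1 \<in> {0..S}" "s2 \<in> {0..S}" and z: "z \<in> {0..Z}" for s1 s2 V1 u1 V2 u2 z
  proof -
    have "\<bar>u1 z - u2 z\<bar> \<le> C0 * \<bar>s1 - s2\<bar> * (z * (Z - z))" by (rule C0(2)[OF c1 c2 s z])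
    also have "\<dots> = C * \<bar>s1 - s2\<bar> * (\<kappa> * (z * (Z - z)))" using \<kappa> by (simp add: C_def)
    also have "\<dots> \<le> C * \<bar>s1 - s2\<bar> * u2 z"
      using C by (intro mult_left_mono \<kappa>(2)[OF c2 s(2) z]) auto
    finally have "u1 z \<le> u2 z + (C * \<bar>s1 - s2\<bar>) * u2 z" by linarith
    from g_ratio[OF _ _ _ _ _ _ this, of "C * S"] show ?thesis
      using gradient_nonneg[OF c1 _ z] gradient_nonneg[OF c2 _ z] gradient_le_P[OF c1 _ z] gradient_le_P[OF c2 _ z]
        s C by (auto simp: mult_left_mono mult_ac abs_le_iff)
  qed
  show ?thesis
  \<comment> \<open>The additional 1 pays for the explicit summand \<open>s1 - s2\<close> of the
    drift.\<close>
  proof (rule that[of "?K + 1"])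
    show "0 \<le> ?K + 1" using K by simp
    fix s1 s2 V1 u1 V2 u2 z
    assume *: "classical (hs s1) V1 u1" "classical (hs s2) V2 u2" "s1 \<in> {0..S}" "s2 \<in> {0..S}" "z \<in> {0..Z}"
    have "\<bar>g (u1 z) - g (u2 z)\<bar> \<le> ?K * \<bar>s1 - s2\<bar>"
      using one[OF *] one[OF *(2,1,4,3,5)] by (simp add: abs_le_iff abs_minus_commute)
    then show "\<bar>(g (u1 z) + s1) - (g (u2 z) + s2)\<bar> \<le> (?K + 1) * \<bar>s1 - s2\<bar>"
      by (simp add: distrib_right)
  qed
qed

lemma classical_unique:
  assumes c: "classical (hs s) V1 u1" "classical (hs s) V2 u2" and s: "0 \<le> s" and z: "z \<in> {0..Z}"
  shows "V1 z = V2 z" "u1 z = u2 z"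
proof -
  have "\<rho> * (V1 z - V2 z) \<le> 0" "\<rho> * (V2 z - V1 z) \<le> 0"
    using value_difference[OF c s s z] value_difference[OF c(2,1) s s z] by auto
  then show "V1 z = V2 z" using \<rho> by (simp add: mult_le_0_iff)
  obtain C where "C \<ge> 0" and C: "\<And>s1 s2 V1 u1 V2 u2 z. classical (hs s1) V1 u1 \<Longrightarrow> classical (hs s2) V2 u2 \<Longrightarrow>
      s1 \<in> {0..s} \<Longrightarrow> s2 \<in> {0..s} \<Longrightarrow> z \<in> {0..Z} \<Longrightarrow> \<bar>u1 z - u2 z\<bar> \<le> C * \<bar>s1 - s2\<bar> * (z * (Z - z))"
    using gradient_difference[OF s] by blast
  from C[OF c _ _ z] s show "u1 z = u2 z" by simp
qed

subsection \<open>Stationary densities\<close>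

definition potential :: "(real \<Rightarrow> real) \<Rightarrow> real \<Rightarrow> real" where
  "potential b z = integral {0..z} (\<lambda>t. a * b t)"

definition stat_density :: "(real \<Rightarrow> real) \<Rightarrow> real \<Rightarrow> real" where
  "stat_density b z = exp (potential b z) / integral {0..Z} (\<lambda>t. exp (potential b t))"

definition mean :: "(real \<Rightarrow> real) \<Rightarrow> real" where
  "mean b = integral {0..Z} (\<lambda>z. z * stat_density b z)"

lemma potential_has_derivative:
  assumes "continuous_on {0..Z} b" "z \<in> {0..Z}"
  shows "(potential b has_real_derivative a * b z) (at z within {0..Z})"
  unfolding potential_def[abs_def]
  by (rule integral_has_real_derivative) (use assms in \<open>auto intro: continuous_on_mult_left\<close>)

lemma continuous_on_exp_potential:
  assumes "continuous_on {0..Z} b"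
  shows "continuous_on {0..Z} (\<lambda>z. exp (potential b z))"
  using DERIV_continuous_on[OF potential_has_derivative[OF assms]] by (rule continuous_on_exp)

lemma total_mass_pos:
  assumes "continuous_on {0..Z} b"
  shows "integral {0..Z} (\<lambda>t. exp (potential b t)) > 0"
proof -
  note c = continuous_on_exp_potential[OF assms]
  have "integral {0..Z} (\<lambda>t. exp (potential b t)) \<ge> 0"
    by (rule integral_nonneg) (use c in \<open>auto intro: integrable_continuous_real\<close>)
  moreover have "integral {0..Z} (\<lambda>t. exp (potential b t)) \<noteq> 0"
  proof
    assume "integral {0..Z} (\<lambda>t. exp (potential b t)) = 0"
    then have "(LINT z|lebesgue_on {0..Z}. exp (potential b z)) = 0"
      using lebesgue_integral_eq_integral[OF continuous_imp_integrable_real[OF c]] by simp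
    then show False using integralL_eq_0_iff[OF c Z] Z by force
  qed
  ultimately show ?thesis by simp
qed

lemma stat_density_pos: "continuous_on {0..Z} b \<Longrightarrow> stat_density b z > 0"
  using total_mass_pos by (simp add: stat_density_def)

lemma stat_density_has_derivative:
  assumes "continuous_on {0..Z} b" "z \<in> {0..Z}"
  shows "(stat_density b has_real_derivative a * b z * stat_density b z) (at z within {0..Z})"
  unfolding stat_density_def using total_mass_pos[OF assms(1)]
  by (auto intro!: derivative_eq_intros potential_has_derivative[OF assms])

lemma continuous_on_stat_density:
  "continuous_on {0..Z} b \<Longrightarrow> continuous_on {0..Z} (stat_density b)"
  using stat_density_has_derivative by (rule DERIV_continuous_on)

lemma integral_stat_density:
  assumes "continuous_on {0..Z} b" shows "integral {0..Z} (stat_density b) = 1"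
  using total_mass_pos[OF assms] unfolding stat_density_def by simp

lemma mean_bounds:
  assumes b: "continuous_on {0..Z} b" shows "0 \<le> mean b" "mean b \<le> Z"
proof -
  have i: "(\<lambda>z. z * stat_density b z) integrable_on {0..Z}" "(\<lambda>z. Z * stat_density b z) integrable_on {0..Z}"
    by (intro integrable_continuous_real continuous_intros continuous_on_stat_density b)+
  show "0 \<le> mean b"
    unfolding mean_def by (rule integral_nonneg[OF i(1)]) (use stat_density_pos[OF b] in \<open>simp add: less_imp_le\<close>)
  have "mean b \<le> integral {0..Z} (\<lambda>z. Z * stat_density b z)"
    unfolding mean_def
    by (rule integral_le[OF i(1)]) (use i stat_density_pos[OF b] in \<open>auto intro!: mult_right_mono less_imp_le\<close>)
  also have "\<dots> = Z" using integral_stat_density[OF b] by simp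
  finally show "mean b \<le> Z" .
qed

text \<open>The potentials differ by at most \<open>r\<close>, so the exponentials and their total
  masses each change by a factor of at most \<open>exp r\<close>, and the densities by at most
  \<open>exp (2 * r)\<close>. The rest is e^x - 1 \<le> x e^x and the bound \<open>Z\<close> on the
  mean.\<close>

lemma mean_difference:
  assumes b: "continuous_on {0..Z} b" and b': "continuous_on {0..Z} b'"
    and d: "\<And>z. z \<in> {0..Z} \<Longrightarrow> \<bar>b z - b' z\<bar> \<le> d"
  shows "mean b - mean b' \<le> 2 * a * Z\<^sup>2 * exp (2 * a * Z * d) * d"
proof -
  define r where "r = a * Z * d"
  have d0: "d \<ge> 0" using d[of 0] Z by auto
  have r0: "r \<ge> 0" using d0 a_pos Z by (simp add: r_def)
  have P: "\<bar>potential b z - potential b' z\<bar> \<le> r" if z: "z \<in> {0..Z}" for z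
  proof -
    have sub: "{0..z} \<subseteq> {0..Z}" using z by auto
    have i: "(\<lambda>t. a * b t) integrable_on {0..z}" "(\<lambda>t. a * b' t) integrable_on {0..z}"
      by (intro integrable_continuous_real continuous_intros continuous_on_subset[OF b sub] continuous_on_subset[OF b' sub])+
    have "potential b z - potential b' z = integral {0..z} (\<lambda>t. a * b t - a * b' t)"
      unfolding potential_def by (rule Henstock_Kurzweil_Integration.integral_diff[OF i, symmetric])
    moreover have "norm (integral {0..z} (\<lambda>t. a * b t - a * b' t)) \<le> integral {0..z} (\<lambda>t. a * d)"
    proof (rule integral_norm_bound_integral)
      show "(\<lambda>t. a * b t - a * b' t) integrable_on {0..z}" using i by (rule Henstock_Kurzweil_Integration.integrable_diff)
      show "norm (a * b t - a * b' t) \<le> a * d" if "t \<in> {0..z}" for t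
      proof -
        have "norm (a * b t - a * b' t) = a * \<bar>b t - b' t\<bar>"
          using a_pos by (simp add: abs_mult flip: right_diff_distrib)
        also have "\<dots> \<le> a * d" using a_pos d that sub by (intro mult_left_mono) auto
        finally show ?thesis .
      qed
    qed auto
    moreover have "integral {0..z} (\<lambda>t. a * d) = z * (a * d)" using z by simp
    moreover have "z * (a * d) \<le> r"
      unfolding r_def using mult_right_mono[of z Z "a * d"] z a_pos d0 by (simp add: mult_ac)
    ultimately show ?thesis unfolding real_norm_def by linarith
  qed
  have e: "exp (potential b z) \<le> exp r * exp (potential b' z)" "exp (potential b' z) \<le> exp r * exp (potential b z)"
    if "z \<in> {0..Z}" for z
    using P[OF that] by (auto simp flip: exp_add)
  let ?I = "integral {0..Z} (\<lambda>t. exp (potential b t))" and ?I' = "integral {0..Z} (\<lambda>t. exp (potential b' t))"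
  have ic: "(\<lambda>t. exp (potential b t)) integrable_on {0..Z}" "(\<lambda>t. exp (potential b' t)) integrable_on {0..Z}"
    by (intro integrable_continuous_real continuous_on_exp_potential b b')+
  have "?I' \<le> integral {0..Z} (\<lambda>t. exp r * exp (potential b t))"
    by (rule integral_le) (use ic e in auto)
  then have I: "?I' \<le> exp r * ?I" by simp
  have I0: "?I > 0" "?I' > 0" using total_mass_pos b b' by auto
  have m: "stat_density b z \<le> exp (2 * r) * stat_density b' z" if z: "z \<in> {0..Z}" for z
  proof -
    have "exp (potential b z) * ?I' \<le> (exp r * exp (potential b' z)) * (exp r * ?I)"
      by (intro mult_mono e z I) (use I0 in auto)
    also have "\<dots> = exp (2 * r) * exp (potential b' z) * ?I"
      by (simp add: mult_ac flip: exp_add)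
    finally show ?thesis using I0 by (simp add: stat_density_def field_simps)
  qed
  have i: "(\<lambda>z. z * stat_density b z) integrable_on {0..Z}" "(\<lambda>z. z * stat_density b' z) integrable_on {0..Z}"
    by (intro integrable_continuous_real continuous_intros continuous_on_stat_density b b')+
  have "mean b \<le> integral {0..Z} (\<lambda>z. exp (2 * r) * (z * stat_density b' z))"
    unfolding mean_def
  proof (rule integral_le[OF i(1)])
    show "(\<lambda>z. exp (2 * r) * (z * stat_density b' z)) integrable_on {0..Z}" using i(2) by simp
    show "z * stat_density b z \<le> exp (2 * r) * (z * stat_density b' z)" if "z \<in> {0..Z}" for z
      using mult_left_mono[OF m[OF that], of z] that by (simp add: mult_ac)
  qed
  also have "\<dots> = exp (2 * r) * mean b'" by (simp add: mean_def)
  finally have "mean b - mean b' \<le> (exp (2 * r) - 1) * mean b'" by (simp add: algebra_simps)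
  also have "\<dots> \<le> (2 * r * exp (2 * r)) * Z"
  proof (intro mult_mono)
    have "1 - 2 * r \<le> exp (- (2 * r))" using exp_ge_add_one_self[of "- (2 * r)"] by simp
    then have "(1 - 2 * r) * exp (2 * r) \<le> exp (- (2 * r)) * exp (2 * r)" by (intro mult_right_mono) auto
    then show "exp (2 * r) - 1 \<le> 2 * r * exp (2 * r)" by (simp add: exp_minus algebra_simps)
  qed (use mean_bounds[OF b'] r0 in auto)
  finally show ?thesis by (simp add: r_def power2_eq_square mult_ac)
qed

text \<open>\<open>exp (- potential b z)\<close> is an integrating factor; the mass fixes the
  remaining constant.\<close>

lemma stat_density_unique:
  assumes b: "continuous_on {0..Z} b"
    and D: "\<And>z. z \<in> {0..Z} \<Longrightarrow> (m has_real_derivative a * b z * m z) (at z within {0..Z})"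
    and 1: "integral {0..Z} m = 1" and z: "z \<in> {0..Z}"
  shows "m z = stat_density b z"
proof -
  have c: "\<exists>c. \<forall>z\<in>{0..Z}. m z * exp (- potential b z) = c"
  proof (rule has_field_derivative_zero_constant)
    show "((\<lambda>z. m z * exp (- potential b z)) has_field_derivative 0) (at z within {0..Z})" if "z \<in> {0..Z}" for z
      by (auto intro!: derivative_eq_intros D that potential_has_derivative[OF b])
  qed auto
  then obtain c where c: "\<And>z. z \<in> {0..Z} \<Longrightarrow> m z * exp (- potential b z) = c" by blast
  have m: "m z = c * exp (potential b z)" if "z \<in> {0..Z}" for z
    using c[OF that] by (simp add: exp_minus field_simps)
  have "integral {0..Z} m = integral {0..Z} (\<lambda>z. c * exp (potential b z))"
    by (rule integral_cong) (use m in auto)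
  then have "c * integral {0..Z} (\<lambda>z. exp (potential b z)) = 1" using 1 by simp
  then show ?thesis using m[OF z] total_mass_pos[OF b] by (simp add: stat_density_def field_simps)
qed

text \<open>A bootstrap: the divergence form gives V' a continuous representative \<open>u\<close>
  that vanishes at both ends, so \<open>V\<close> has a C^1 representative \<open>W\<close>. Then
  the right-hand side is continuous and \<open>u\<close> is C^1.\<close>

lemma weak_imp_classical:
  assumes V: "V \<in> H1 Z"
    and iH: "integrable (lebesgue_on (Omega Z)) (\<lambda>z. hs s (weak_deriv Z V z) + f z)"
    and weak: "\<And>\<phi>. smooth \<phi> \<Longrightarrow> (LINT z|lebesgue_on (Omega Z).
      \<sigma>\<^sup>2 / 2 * weak_deriv Z V z * deriv \<phi> z + \<rho> * V z * \<phi> z - (hs s (weak_deriv Z V z) + f z) * \<phi> z) = 0"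
  obtains W u where "classical (hs s) W u" "AE z in lebesgue_on (Omega Z). V z = W z"
    "AE z in lebesgue_on (Omega Z). weak_deriv Z V z = u z"
proof -
  let ?M = "lebesgue_on (Omega Z)"
  let ?V' = "weak_deriv Z V"
  have iV: "integrable ?M V" using V by (auto simp: H1_def intro: L2_imp_integrable)
  have iV': "integrable ?M ?V'" using weak_deriv_H1(1)[OF V] by (rule L2_imp_integrable)
  define q where "q z = \<rho> * V z - (hs s (?V' z) + f z)" for z
  have iq: "integrable ?M q"
    unfolding q_def by (intro Bochner_Integration.integrable_diff integrable_mult_right iV iH) 
  have *: "(LINT z|?M. (\<sigma>\<^sup>2 / 2 * ?V' z) * deriv \<phi> z + q z * \<phi> z) = 0" if "smooth \<phi>" for \<phi>
    using weak[OF that] by (simp add: q_def algebra_simps)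
  have ir: "integrable ?M (\<lambda>z. \<sigma>\<^sup>2 / 2 * ?V' z)" using iV' by simp
  have div: "AE z in ?M. \<sigma>\<^sup>2 / 2 * ?V' z = integral {0..z} q" "integral {0..Z} q = 0"
    using weak_divergence_form[OF Z ir iq] * by auto
  define u where "u z = a * integral {0..z} q" for z
  have cu: "continuous_on {0..Z} u"
    unfolding u_def by (intro continuous_intros indefinite_integral_Omega(1)[OF iq])
  have V'u: "AE z in ?M. ?V' z = u z"
    using div(1)
  proof (eventually_elim)
    case (elim z)
    then show ?case using \<sigma> by (simp add: u_def a_def field_simps)
  qed
  obtain c where c: "AE z in ?M. V z = c + integral {0..z} ?V'"
    using weak_deriv_primitive[OF Z iV iV' weak_deriv_H1(2)[OF V]] .
  define W where "W z = c + integral {0..z} u" for z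
  have dW: "(W has_real_derivative u z) (at z within {0..Z})" if "z \<in> {0..Z}" for z
    unfolding W_def by (auto intro!: derivative_eq_intros integral_has_real_derivative[OF cu that])
  have cW: "continuous_on {0..Z} W" using dW by (rule DERIV_continuous_on)
  have VW: "AE z in ?M. V z = W z"
    using c AE_space[of ?M]
  proof eventually_elim
    case (elim z)
    then show ?case using integral_cong_AE_Omega[OF V'u, of z] by (simp add: W_def)
  qed
  \<comment> \<open>The continuous representative of the merely integrable \<open>q\<close>; only
    for it may the primitive be differentiated at every point.\<close>
  define q' where "q' z = \<rho> * W z - hs s (u z) - f z" for z
  have cq': "continuous_on {0..Z} q'"
    unfolding q'_def by (intro continuous_intros cW cu continuous_on_f)
  have qq': "AE z in ?M. q z = q' z"
    using VW V'u by eventually_elim (simp add: q_def q'_def)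
  have u': "u z = a * integral {0..z} q'" if "z \<in> {0..Z}" for z
    using integral_cong_AE_Omega[OF qq', of z] that by (simp add: u_def)
  have du: "(u has_real_derivative a * q' z) (at z within {0..Z})" if z: "z \<in> {0..Z}" for z
  proof -
    have "((\<lambda>z. a * integral {0..z} q') has_real_derivative a * q' z) (at z within {0..Z})"
      by (intro DERIV_cmult integral_has_real_derivative cq' z)
    then show ?thesis
      by (rule has_field_derivative_transform_within[where d = 1]) (use z u' in auto)
  qed
  have "classical (hs s) W u"
    unfolding classical_def using dW du div(2) by (auto simp: u_def q'_def)
  then show ?thesis using VW V'u by (rule that)
qed

text \<open>The divergence form with zero source says that the flux vanishes almost everywhere, and
  the bootstrap turns this into a linear equation for a continuous representative. The coefficient
  \<open>d\<close> is only almost everywhere the continuous drift, since it contains a chosen weak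
  derivative.\<close>

lemma weak_imp_density:
  assumes m: "m \<in> H1 Z" and b: "continuous_on {0..Z} b"
    and d: "AE z in lebesgue_on (Omega Z). d z = b z"
    and id: "integrable (lebesgue_on (Omega Z)) (\<lambda>z. d z * m z)"
    and weak: "\<And>\<phi>. smooth \<phi> \<Longrightarrow> (LINT z|lebesgue_on (Omega Z).
      (\<sigma>\<^sup>2 / 2 * weak_deriv Z m z - d z * m z) * deriv \<phi> z) = 0"
    and 1: "(LINT z|lebesgue_on (Omega Z). m z) = 1"
  shows "AE z in lebesgue_on (Omega Z). m z = stat_density b z"
proof -
  let ?M = "lebesgue_on (Omega Z)"
  let ?m' = "weak_deriv Z m"
  have im: "integrable ?M m" using m by (auto simp: H1_def intro: L2_imp_integrable)
  have im': "integrable ?M ?m'" using weak_deriv_H1(1)[OF m] by (rule L2_imp_integrable)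
  have ir: "integrable ?M (\<lambda>z. \<sigma>\<^sup>2 / 2 * ?m' z - d z * m z)" using im' id by simp
  have "AE z in ?M. \<sigma>\<^sup>2 / 2 * ?m' z - d z * m z = integral {0..z} (\<lambda>_. 0 :: real)"
    by (rule weak_divergence_form(1)[OF Z ir]) (use weak in auto)
  then have m'1: "AE z in ?M. ?m' z = a * b z * m z"
    using d
  proof eventually_elim
    case (elim z)
    then show ?case using \<sigma> by (simp add: a_def field_simps)
  qed
  obtain c where c: "AE z in ?M. m z = c + integral {0..z} ?m'"
    using weak_deriv_primitive[OF Z im im' weak_deriv_H1(2)[OF m]] .
  define M where "M z = c + integral {0..z} ?m'" for z
  have cM: "continuous_on {0..Z} M"
    unfolding M_def by (intro continuous_intros indefinite_integral_Omega(1)[OF im'])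
  have m'2: "AE z in ?M. ?m' z = a * b z * M z"
    using m'1 c by eventually_elim (simp add: M_def)
  have cbM: "continuous_on {0..Z} (\<lambda>z. a * b z * M z)" by (intro continuous_intros b cM)
  have M: "M z = c + integral {0..z} (\<lambda>z. a * b z * M z)" if "z \<in> {0..Z}" for z
    using integral_cong_AE_Omega[OF m'2, of z] that by (simp add: M_def)
  have dM: "(M has_real_derivative a * b z * M z) (at z within {0..Z})" if z: "z \<in> {0..Z}" for z
  proof -
    have "((\<lambda>z. c + integral {0..z} (\<lambda>z. a * b z * M z)) has_real_derivative a * b z * M z) (at z within {0..Z})"
      by (auto intro!: derivative_eq_intros integral_has_real_derivative[OF cbM z])
    then show ?thesis
      by (rule has_field_derivative_transform_within[where d = 1]) (use z M in auto)
  qed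
  have mM: "AE z in ?M. m z = M z" using c by (simp add: M_def)
  have "integral {0..Z} m = integral {0..Z} M" using integral_cong_AE_Omega[OF mM, of Z] by simp
  then have 2: "integral {0..Z} M = 1"
    using 1 lebesgue_integral_eq_integral[OF im] by (simp add: integral_open_interval_real)
  show ?thesis
    using mM AE_space[of ?M]
  proof eventually_elim
    case (elim z)
    then show ?case using stat_density_unique[OF b dM 2, of z] by simp
  qed
qed

subsection \<open>The fixed point problem for the first moments\<close>

text \<open>For \<open>s \<ge> 0\<close> a solution exists, and by \<open>classical_unique\<close>
  the choice does not matter on \<open>{0..Z}\<close>.\<close>

definition sol :: "real \<Rightarrow> (real \<Rightarrow> real) \<times> (real \<Rightarrow> real)" where
  "sol s = (SOME Vu. classical (hs s) (fst Vu) (snd Vu))"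

abbreviation Vsol :: "real \<Rightarrow> real \<Rightarrow> real" where "Vsol s \<equiv> fst (sol s)"
abbreviation usol :: "real \<Rightarrow> real \<Rightarrow> real" where "usol s \<equiv> snd (sol s)"

definition drift :: "real \<Rightarrow> real \<Rightarrow> real" where "drift s z = g (usol s z) + s"

lemma classical_sol: "0 \<le> s \<Longrightarrow> classical (hs s) (Vsol s) (usol s)"
proof -
  assume "0 \<le> s"
  then obtain V u where "classical (hs s) V u" using exists_classical by blast
  then have "classical (hs s) (fst (V, u)) (snd (V, u))" by simp
  then show ?thesis unfolding sol_def by (rule someI)
qed

lemma continuous_on_drift: "0 \<le> s \<Longrightarrow> continuous_on {0..Z} (drift s)"
  unfolding drift_def by (intro continuous_intros classicalD(6)[OF classical_sol])

lemma mean_lipschitz: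
  assumes S: "0 \<le> S"
  obtains K where "K \<ge> 0"
    "\<And>s s'. s \<in> {0..S} \<Longrightarrow> s' \<in> {0..S} \<Longrightarrow> \<bar>mean (drift s) - mean (drift s')\<bar> \<le> K * \<bar>s - s'\<bar>"
proof -
  obtain C where C: "C \<ge> 0"
    "\<And>s1 s2 V1 u1 V2 u2 z. classical (hs s1) V1 u1 \<Longrightarrow> classical (hs s2) V2 u2 \<Longrightarrow>
      s1 \<in> {0..S} \<Longrightarrow> s2 \<in> {0..S} \<Longrightarrow> z \<in> {0..Z} \<Longrightarrow>
      \<bar>(g (u1 z) + s1) - (g (u2 z) + s2)\<bar> \<le> C * \<bar>s1 - s2\<bar>"
    using drift_difference[OF S] by blast
  define c where "c = 2 * a * Z\<^sup>2"
  \<comment> \<open>The exponential factor is estimated at the largest possible gap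
    \<open>S\<close>, which leaves a bound linear in |s - s'|.\<close>
  define K where "K = c * exp (2 * a * Z * (C * S)) * C"
  have c: "c \<ge> 0" using a_pos by (simp add: c_def)
  have K: "K \<ge> 0" using c C by (simp add: K_def)
  have one: "mean (drift s) - mean (drift s') \<le> K * \<bar>s - s'\<bar>" if s: "s \<in> {0..S}" "s' \<in> {0..S}" for s s'
  proof -
    have d: "\<bar>drift s z - drift s' z\<bar> \<le> C * \<bar>s - s'\<bar>" if "z \<in> {0..Z}" for z
      unfolding drift_def using C(2)[OF classical_sol classical_sol] s that by auto
    have "mean (drift s) - mean (drift s') \<le> c * exp (2 * a * Z * (C * \<bar>s - s'\<bar>)) * (C * \<bar>s - s'\<bar>)"
      unfolding c_def by (rule mean_difference[OF _ _ d]) (use s in \<open>auto intro: continuous_on_drift\<close>)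
    also have "\<dots> \<le> c * exp (2 * a * Z * (C * S)) * (C * \<bar>s - s'\<bar>)"
      using s C c a_pos Z by (intro mult_right_mono mult_left_mono iffD2[OF exp_le_cancel_iff]) auto
    finally show ?thesis by (simp add: K_def mult.assoc)
  qed
  show ?thesis
  proof (rule that[OF K])
    show "\<bar>mean (drift s) - mean (drift s')\<bar> \<le> K * \<bar>s - s'\<bar>" if "s \<in> {0..S}" "s' \<in> {0..S}" for s s'
      using one[OF that] one[OF that(2,1)] by (simp add: abs_minus_commute abs_le_iff)
  qed
qed

section \<open>Regularity of the constructed solutions\<close>

lemma g_has_derivative:
  assumes "x > 0"
  shows "(g has_real_derivative \<theta> * (\<gamma> / w) * (\<gamma> / w * x) powr (\<theta> - 1)) (at x)"
proof -
  have "((\<lambda>x. (\<gamma> / w * x) powr \<theta>) has_real_derivative \<theta> * (\<gamma> / w) * (\<gamma> / w * x) powr (\<theta> - 1)) (at x)"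
    using assms \<gamma> w by (auto intro!: derivative_eq_intros)
  then show ?thesis
    by (rule has_field_derivative_transform_within_open[where S = "{0<..}"])
      (use assms in \<open>auto simp: g_def\<close>)
qed

lemma C2_C1_classical:
  assumes "classical (hs s) V u" shows "V \<in> C2_C1 Z"
proof -
  note cl = classicalD[OF assms]
  let ?u' = "\<lambda>z. a * (\<rho> * V z - hs s (u z) - f z)"
  have c: "continuous_on {0..Z} ?u'" by (intro continuous_intros cl continuous_on_f)
  have du: "(u has_real_derivative ?u' z) (at z)" if "z \<in> Omega Z" for z
    using cl(2)[of z] that at_within_interior[of z "{0..Z}"] by auto
  have c': "continuous_on (Omega Z) ?u'" by (rule continuous_on_subset[OF c]) auto
  show ?thesis
    unfolding C2_C1_def by (intro CollectI exI[of _ u] exI[of _ ?u'] conjI ballI cl(1) cl(6) du c')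
qed

text \<open>The first derivative is continuous up to the boundary because the drift is. The second
  contains the derivative of \<open>g\<close> along \<open>usol s\<close>, which may blow up at the
  endpoints, where the slope is 0, and is continuous where the slope is positive.\<close>

lemma C2_C1_stat_density:
  assumes s: "0 \<le> s" shows "stat_density (drift s) \<in> C2_C1 Z"
proof -
  note cl = classicalD[OF classical_sol[OF s]]
  note cb = continuous_on_drift[OF s]
  define u' where "u' z = a * (\<rho> * Vsol s z - hs s (usol s z) - f z)" for z
  define b' where "b' z = \<theta> * (\<gamma> / w) * (\<gamma> / w * usol s z) powr (\<theta> - 1) * u' z" for z
  let ?m = "stat_density (drift s)"
  define m' where "m' z = a * drift s z * ?m z" for z
  define m'' where "m'' z = a * b' z * ?m z + m' z * (a * drift s z)" for z
  have pos: "usol s z > 0" if "z \<in> Omega Z" for z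
    using gradient_pos[OF classical_sol[OF s] s] that by auto
  have at: "at z within {0..Z} = at z" if "z \<in> Omega Z" for z
    by (rule at_within_interior) (use that in auto)
  have du: "(usol s has_real_derivative u' z) (at z)" if "z \<in> Omega Z" for z
    using cl(2)[of z] that at[OF that] by (auto simp: u'_def)
  have db: "(drift s has_real_derivative b' z) (at z)" if "z \<in> Omega Z" for z
  proof -
    have "((\<lambda>z. g (usol s z)) has_real_derivative b' z) (at z)"
      unfolding b'_def by (rule DERIV_chain2[where f = g and g = "usol s"]) (intro g_has_derivative pos du that)+
    from DERIV_add[OF this DERIV_const[of s]] show ?thesis by (simp add: drift_def[abs_def])
  qed
  have dm: "(?m has_real_derivative m' z) (at z within {0..Z})" if "z \<in> {0..Z}" for z
    unfolding m'_def by (rule stat_density_has_derivative[OF cb that])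
  have ddm: "(m' has_real_derivative m'' z) (at z)" if "z \<in> Omega Z" for z
  proof -
    have "(?m has_real_derivative m' z) (at z)" using dm[of z] at[OF that] that by auto
    from DERIV_mult[OF DERIV_cmult[OF db[OF that], of a] this] show ?thesis
      by (simp only: m'_def[abs_def] m''_def)
  qed
  have cm: "continuous_on {0..Z} ?m" by (rule continuous_on_stat_density[OF cb])
  have cm': "continuous_on {0..Z} m'" unfolding m'_def by (intro continuous_intros cb cm)
  have cu': "continuous_on {0..Z} u'" unfolding u'_def by (intro continuous_intros cl continuous_on_f)
  have sub: "Omega Z \<subseteq> {0..Z}" by auto
  have "continuous_on (Omega Z) b'"
    unfolding b'_def using pos \<gamma> w
    by (intro continuous_intros continuous_on_subset[OF cu' sub] continuous_on_subset[OF cl(6) sub]) force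
  then have "continuous_on (Omega Z) m''"
    unfolding m''_def
    by (intro continuous_intros continuous_on_subset[OF cm sub] continuous_on_subset[OF cb sub]
        continuous_on_subset[OF cm' sub])
  then show ?thesis
    unfolding C2_C1_def by (intro CollectI exI[of _ m'] exI[of _ m''] conjI ballI dm cm' ddm)
qed

section \<open>The system and the moment equation\<close>

lemma hamiltonian_eq:
  "hamiltonian L Z w B \<alpha> \<gamma> A p l z m x = hs (spillover L Z A p l m) x + f z"
  by (simp add: hamiltonian_def h_def f_def \<theta>_def)

lemma d_hamiltonian_drift:
  "d_hamiltonian L Z w B \<alpha> \<gamma> A p l z m x = g x + spillover L Z A p l m"
  by (subst d_hamiltonian_eq[OF \<gamma> w]) (simp add: g_def \<theta>_def)

text \<open>V' stands for any measurable function that agrees almost everywhere with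
  \<open>u\<close>, so that \<open>weak_deriv\<close> can be inserted.\<close>

lemma classical_imp_weak:
  assumes cl: "classical (hs s) V u" and \<phi>: "smooth \<phi>"
    and V': "AE z in lebesgue_on (Omega Z). V' z = u z" and V'm: "V' \<in> borel_measurable (lebesgue_on (Omega Z))"
  shows "integrable (lebesgue_on (Omega Z)) (\<lambda>z. hs s (V' z) + f z)"
    "(LINT z|lebesgue_on (Omega Z).
      \<sigma>\<^sup>2 / 2 * V' z * deriv \<phi> z + \<rho> * V z * \<phi> z - (hs s (V' z) + f z) * \<phi> z) = 0"
proof -
  let ?M = "lebesgue_on (Omega Z)"
  note cl = classicalD[OF cl]
  have c\<phi>: "continuous_on {0..Z} \<phi>" "continuous_on {0..Z} (deriv \<phi>)"
    using \<phi> smooth_continuous_on smooth_deriv by blast+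
  have [measurable]: "V' \<in> borel_measurable ?M" by (rule V'm)
  have meas: "v \<in> borel_measurable ?M" if "continuous_on {0..Z} v" for v :: "real \<Rightarrow> real"
    using integrable_Omega_continuous(1)[OF that] by auto
  have [measurable]: "f \<in> borel_measurable ?M" "\<phi> \<in> borel_measurable ?M" "deriv \<phi> \<in> borel_measurable ?M"
      "V \<in> borel_measurable ?M"
    using meas continuous_on_f c\<phi> cl(5) by blast+
  have [measurable]: "h \<in> borel_measurable borel"
    by (intro borel_measurable_continuous_onI continuous_on_h continuous_intros)
  have cH: "continuous_on {0..Z} (\<lambda>z. hs s (u z) + f z)"
    by (intro continuous_intros cl continuous_on_f)
  show "integrable ?M (\<lambda>z. hs s (V' z) + f z)"
  proof (rule integrable_cong_AE_imp[OF integrable_Omega_continuous(1)[OF cH]])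
    show "AE z in ?M. hs s (u z) + f z = hs s (V' z) + f z"
      using V' by eventually_elim simp
  qed measurable
  have cF: "continuous_on {0..Z} (\<lambda>z. \<sigma>\<^sup>2 / 2 * u z * deriv \<phi> z + \<rho> * V z * \<phi> z - (hs s (u z) + f z) * \<phi> z)"
    by (intro continuous_intros cl continuous_on_f c\<phi>)
  have [measurable]: "u \<in> borel_measurable ?M" using meas cl(6) by blast
  have "(LINT z|?M. \<sigma>\<^sup>2 / 2 * V' z * deriv \<phi> z + \<rho> * V z * \<phi> z - (hs s (V' z) + f z) * \<phi> z)
      = (LINT z|?M. \<sigma>\<^sup>2 / 2 * u z * deriv \<phi> z + \<rho> * V z * \<phi> z - (hs s (u z) + f z) * \<phi> z)"
  proof (rule integral_cong_AE)
    show "AE z in ?M. \<sigma>\<^sup>2 / 2 * V' z * deriv \<phi> z + \<rho> * V z * \<phi> z - (hs s (V' z) + f z) * \<phi> z =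
        \<sigma>\<^sup>2 / 2 * u z * deriv \<phi> z + \<rho> * V z * \<phi> z - (hs s (u z) + f z) * \<phi> z"
      using V' by eventually_elim simp
  qed measurable
  also have "\<dots> = integral {0..Z} (\<lambda>z. \<sigma>\<^sup>2 / 2 * u z * deriv \<phi> z + \<rho> * V z * \<phi> z - (hs s (u z) + f z) * \<phi> z)"
    by (rule integrable_Omega_continuous(2)[OF cF])
  \<comment> \<open>By the equation the integrand is an exact derivative, and its boundary values
    vanish by the Neumann conditions.\<close>
  also have "\<dots> = \<sigma>\<^sup>2 / 2 * u Z * \<phi> Z - \<sigma>\<^sup>2 / 2 * u 0 * \<phi> 0"
  proof (rule integral_unique, rule fundamental_theorem_of_calculus)
    fix z assume z: "z \<in> {0..Z}"
    have "((\<lambda>z. \<sigma>\<^sup>2 / 2 * u z * \<phi> z) has_real_derivative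
        \<sigma>\<^sup>2 / 2 * (a * (\<rho> * V z - hs s (u z) - f z)) * \<phi> z + deriv \<phi> z * (\<sigma>\<^sup>2 / 2 * u z)) (at z within {0..Z})"
      by (intro DERIV_mult DERIV_cmult cl z has_field_derivative_at_within[OF smooth_has_derivative[OF \<phi>]])
    moreover have E: "\<sigma>\<^sup>2 / 2 * (a * (\<rho> * V z - hs s (u z) - f z)) = \<rho> * V z - hs s (u z) - f z"
      using \<sigma> by (simp add: a_def)
    moreover have "(\<rho> * V z - hs s (u z) - f z) * \<phi> z + deriv \<phi> z * (\<sigma>\<^sup>2 / 2 * u z) =
        \<sigma>\<^sup>2 / 2 * u z * deriv \<phi> z + \<rho> * V z * \<phi> z - (hs s (u z) + f z) * \<phi> z"
      by (simp add: algebra_simps)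
    ultimately show "((\<lambda>z. \<sigma>\<^sup>2 / 2 * u z * \<phi> z) has_vector_derivative
        \<sigma>\<^sup>2 / 2 * u z * deriv \<phi> z + \<rho> * V z * \<phi> z - (hs s (u z) + f z) * \<phi> z) (at z within {0..Z})"
      unfolding has_real_derivative_iff_has_vector_derivative[symmetric] by (simp only: E)
  qed (use Z in auto)
  also have "\<dots> = 0" using cl(3,4) by simp
  finally show "(LINT z|?M. \<sigma>\<^sup>2 / 2 * V' z * deriv \<phi> z + \<rho> * V z * \<phi> z - (hs s (V' z) + f z) * \<phi> z) = 0" .
qed


text \<open>Every solution is determined by its spillovers. Its first moments are
  \<open>mean (drift s)\<close>, so the definition of the spillover becomes a closed system of
  \<open>L\<close> scalar equations.\<close>

lemma mfg_solution_imp: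
  assumes sol: "mfg_solution L Z \<sigma> \<rho> w B \<alpha> \<gamma> A p m V" and wt: "mfg_weights L A p" and l: "l \<in> {1..L}"
  defines "s \<equiv> spillover L Z A p l m"
  shows "0 \<le> s" "AE z in lebesgue_on (Omega Z). m l z = stat_density (drift s) z \<and> V l z = Vsol s z"
    "(LINT z|lebesgue_on (Omega Z). z * m l z) = mean (drift s)"
proof -
  let ?M = "lebesgue_on (Omega Z)"
  have pos: "\<And>l z. l \<in> {1..L} \<Longrightarrow> z \<in> Omega Z \<Longrightarrow> m l z > 0"
    and H1: "m l \<in> H1 Z" "V l \<in> H1 Z"
    using sol l unfolding mfg_solution_def by blast+
  have weak: "integrable ?M (\<lambda>z. hs s (weak_deriv Z (V l) z) + f z)"
      "integrable ?M (\<lambda>z. (g (weak_deriv Z (V l) z) + s) * m l z)"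
      "\<And>\<phi>. smooth \<phi> \<Longrightarrow> (LINT z|?M. \<sigma>\<^sup>2 / 2 * weak_deriv Z (V l) z * deriv \<phi> z + \<rho> * V l z * \<phi> z
        - (hs s (weak_deriv Z (V l) z) + f z) * \<phi> z) = 0"
      "\<And>\<phi>. smooth \<phi> \<Longrightarrow> (LINT z|?M. (\<sigma>\<^sup>2 / 2 * weak_deriv Z (m l) z
        - (g (weak_deriv Z (V l) z) + s) * m l z) * deriv \<phi> z) = 0"
      "(LINT z|?M. m l z) = 1"
    using sol l unfolding mfg_solution_def Let_def hamiltonian_eq d_hamiltonian_drift s_def by blast+
  have "0 \<le> (LINT z|?M. z * m l' z)" if "l' \<in> {1..L}" for l'
    by (rule Bochner_Integration.integral_nonneg_AE, rule AE_I2) (use pos[OF that] in \<open>auto intro: less_imp_le\<close>)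
  \<comment> \<open>Positivity of the densities enters here and puts \<open>s\<close> into the range
    where \<open>sol s\<close> is known to solve the equation.\<close>
  then show s: "0 \<le> s"
    unfolding s_def spillover_def using wt l
    by (intro sum_nonneg mult_nonneg_nonneg) (auto simp: mfg_weights_def less_imp_le)
  obtain W u where W: "classical (hs s) W u" "AE z in ?M. V l z = W z" "AE z in ?M. weak_deriv Z (V l) z = u z"
    using weak_imp_classical[OF H1(2) weak(1,3)] by blast
  note un = classical_unique[OF W(1) classical_sol[OF s] s]
  have V: "AE z in ?M. V l z = Vsol s z"
    using W(2) AE_space[of ?M]
  proof eventually_elim
    case (elim z)
    then show ?case using un(1)[of z] by simp
  qed
  have b: "AE z in ?M. g (weak_deriv Z (V l) z) + s = drift s z"
    using W(3) AE_space[of ?M]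
  proof eventually_elim
    case (elim z)
    then show ?case using un(2)[of z] by (simp add: drift_def)
  qed
  have m: "AE z in ?M. m l z = stat_density (drift s) z"
    by (rule weak_imp_density[OF H1(1) continuous_on_drift[OF s] b weak(2,4,5)])
  with V show "AE z in ?M. m l z = stat_density (drift s) z \<and> V l z = Vsol s z" by eventually_elim simp
  have c: "continuous_on {0..Z} (\<lambda>z. z * stat_density (drift s) z)"
    by (intro continuous_intros continuous_on_stat_density continuous_on_drift s)
  have "(LINT z|?M. z * m l z) = (LINT z|?M. z * stat_density (drift s) z)"
  proof (rule integral_cong_AE)
    have [measurable]: "(\<lambda>z. z) \<in> borel_measurable ?M"
      by (intro measurable_restrict_space1 measurable_completion) simp
    have [measurable]: "m l \<in> borel_measurable ?M" using H1(1) by (simp add: H1_def L2_def)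
    show "(\<lambda>z. z * m l z) \<in> borel_measurable ?M" by measurable
    show "(\<lambda>z. z * stat_density (drift s) z) \<in> borel_measurable ?M"
      using integrable_Omega_continuous(1)[OF c] by auto
    show "AE z in ?M. z * m l z = z * stat_density (drift s) z" using m by eventually_elim simp
  qed
  also have "\<dots> = mean (drift s)" using integrable_Omega_continuous(2)[OF c] by (simp add: mean_def)
  finally show "(LINT z|?M. z * m l z) = mean (drift s)" .
qed

text \<open>The converse: each population is solved with its prescribed \<open>s l\<close>, and only
  afterwards is this number recognised as the spillover of the resulting densities.\<close>

lemma mfg_solutionI:
  assumes s: "\<And>l. l \<in> {1..L} \<Longrightarrow> 0 \<le> s l"
    and fixp: "\<And>l. l \<in> {1..L} \<Longrightarrow> (\<Sum>l'=1..L. A l' * p l l' * mean (drift (s l'))) = s l"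
  defines "m \<equiv> \<lambda>l. stat_density (drift (s l))" and "V \<equiv> \<lambda>l. Vsol (s l)"
  shows "mfg_solution L Z \<sigma> \<rho> w B \<alpha> \<gamma> A p m V"
proof -
  let ?M = "lebesgue_on (Omega Z)"
  have main: "m l \<in> H1 Z \<and> V l \<in> H1 Z \<and> (\<forall>z\<in>Omega Z. m l z > 0) \<and>
      integrable ?M (\<lambda>z. hs (s l) (weak_deriv Z (V l) z) + f z) \<and>
      integrable ?M (\<lambda>z. (g (weak_deriv Z (V l) z) + s l) * m l z) \<and>
      (\<forall>\<phi>. smooth \<phi> \<longrightarrow> (LINT z|?M. \<sigma>\<^sup>2 / 2 * weak_deriv Z (V l) z * deriv \<phi> z + \<rho> * V l z * \<phi> z
        - (hs (s l) (weak_deriv Z (V l) z) + f z) * \<phi> z) = 0) \<and>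
      (\<forall>\<phi>. smooth \<phi> \<longrightarrow> (LINT z|?M. (\<sigma>\<^sup>2 / 2 * weak_deriv Z (m l) z
        - (g (weak_deriv Z (V l) z) + s l) * m l z) * deriv \<phi> z) = 0) \<and>
      (LINT z|?M. m l z) = 1 \<and> (LINT z|?M. z * m l z) = mean (drift (s l))" if l: "l \<in> {1..L}" for l
  proof -
    note sl = s[OF l]
    note cls = classical_sol[OF sl]
    note cl = classicalD[OF cls]
    note cb = continuous_on_drift[OF sl]
    have cm: "continuous_on {0..Z} (m l)" unfolding m_def by (rule continuous_on_stat_density[OF cb])
    have dm: "(m l has_real_derivative a * drift (s l) z * m l z) (at z within {0..Z})" if "z \<in> {0..Z}" for z
      unfolding m_def by (rule stat_density_has_derivative[OF cb that])
    have cm': "continuous_on {0..Z} (\<lambda>z. a * drift (s l) z * m l z)" by (intro continuous_intros cb cm)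
    have V: "V l \<in> H1 Z" "AE z in ?M. weak_deriv Z (V l) z = usol (s l) z"
      unfolding V_def by (rule C1_weak_deriv[OF Z cl(1) cl(6)], assumption)+
    have m: "m l \<in> H1 Z" "AE z in ?M. weak_deriv Z (m l) z = a * drift (s l) z * m l z"
      by (rule C1_weak_deriv[OF Z dm cm'], assumption)+
    have mV [measurable]: "weak_deriv Z (V l) \<in> borel_measurable ?M" and [measurable]: "weak_deriv Z (m l) \<in> borel_measurable ?M"
      using weak_deriv_H1(1)[OF V(1)] weak_deriv_H1(1)[OF m(1)] by (auto simp: L2_def)
    have [measurable]: "m l \<in> borel_measurable ?M" using m(1) by (simp add: H1_def L2_def)
    have [measurable]: "g \<in> borel_measurable borel"
      by (intro borel_measurable_continuous_onI continuous_on_g continuous_intros)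
    have 1: "integrable ?M (\<lambda>z. (g (weak_deriv Z (V l) z) + s l) * m l z)"
    proof (rule integrable_cong_AE_imp[of _ "\<lambda>z. drift (s l) z * m l z"])
      show "integrable ?M (\<lambda>z. drift (s l) z * m l z)"
        by (intro integrable_Omega_continuous continuous_intros cb cm)
      show "AE z in ?M. drift (s l) z * m l z = (g (weak_deriv Z (V l) z) + s l) * m l z"
        using V(2) by eventually_elim (simp add: drift_def)
    qed measurable
    have 2: "(LINT z|?M. (\<sigma>\<^sup>2 / 2 * weak_deriv Z (m l) z
        - (g (weak_deriv Z (V l) z) + s l) * m l z) * deriv \<phi> z) = 0" for \<phi>
    proof -
      have "AE z in ?M. (\<sigma>\<^sup>2 / 2 * weak_deriv Z (m l) z
        - (g (weak_deriv Z (V l) z) + s l) * m l z) * deriv \<phi> z = 0"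
        using V(2) m(2)
      proof eventually_elim
        case (elim z)
        have "\<sigma>\<^sup>2 / 2 * (a * drift (s l) z * m l z) = drift (s l) z * m l z" using \<sigma> by (simp add: a_def)
        with elim show ?case by (simp add: drift_def)
      qed
      then show ?thesis by (rule integral_eq_zero_AE)
    qed
    have 3: "(LINT z|?M. m l z) = 1"
      using integrable_Omega_continuous(2)[OF cm] integral_stat_density[OF cb] by (simp add: m_def)
    have cz: "continuous_on {0..Z} (\<lambda>z. z * m l z)" by (intro continuous_intros cm)
    have 4: "(LINT z|?M. z * m l z) = mean (drift (s l))"
      using integrable_Omega_continuous(2)[OF cz] by (simp add: mean_def m_def)
    have 5: "integrable ?M (\<lambda>z. hs (s l) (weak_deriv Z (V l) z) + f z)"
      by (rule classical_imp_weak(1)[OF cls smooth_const V(2) mV])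
    have 6: "(LINT z|?M. \<sigma>\<^sup>2 / 2 * weak_deriv Z (V l) z * deriv \<phi> z + \<rho> * V l z * \<phi> z
        - (hs (s l) (weak_deriv Z (V l) z) + f z) * \<phi> z) = 0" if "smooth \<phi>" for \<phi>
      using classical_imp_weak(2)[OF cls that V(2) mV] by (simp add: V_def)
    show ?thesis
      using V(1) m(1) 1 2 3 4 5 6 stat_density_pos[OF cb] by (auto simp: m_def)
  qed
  \<comment> \<open>This closes the loop: the fixed point equation is the self-consistency of the
    spillovers.\<close>
  have sp: "spillover L Z A p l m = s l" if l: "l \<in> {1..L}" for l
  proof -
    have "spillover L Z A p l m = (\<Sum>l'=1..L. A l' * p l l' * mean (drift (s l')))"
      unfolding spillover_def by (rule sum.cong) (use main in auto)
    then show ?thesis using fixp[OF l] by simp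
  qed
  show ?thesis
    unfolding mfg_solution_def Let_def hamiltonian_eq d_hamiltonian_drift
  proof (intro conjI ballI)
    fix l assume l: "l \<in> {1..L}"
    note main = main[OF l]
    show "m l \<in> H1 Z" "V l \<in> H1 Z" "\<And>z. z \<in> Omega Z \<Longrightarrow> 0 < m l z" using main by blast+
    show "integrable ?M (\<lambda>z. hs (spillover L Z A p l m) (weak_deriv Z (V l) z) + f z)"
      "integrable ?M (\<lambda>z. (g (weak_deriv Z (V l) z) + spillover L Z A p l m) * m l z)"
      "\<forall>\<phi>. smooth \<phi> \<longrightarrow> (LINT z|?M. \<sigma>\<^sup>2 / 2 * weak_deriv Z (V l) z * deriv \<phi> z + \<rho> * V l z * \<phi> z
        - (hs (spillover L Z A p l m) (weak_deriv Z (V l) z) + f z) * \<phi> z) = 0"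
      "\<forall>\<phi>. smooth \<phi> \<longrightarrow> (LINT z|?M. (\<sigma>\<^sup>2 / 2 * weak_deriv Z (m l) z
        - (g (weak_deriv Z (V l) z) + spillover L Z A p l m) * m l z) * deriv \<phi> z) = 0"
      "(LINT z|?M. m l z) = 1"
      unfolding sp[OF l] using main by blast+
  qed
qed

text \<open>The unknowns are the moments divided by \<open>Z\<close>. As means of probability
  densities on \<open>{0..Z}\<close> they stay in the unit cube however large the interaction
  is.\<close>

lemma exists_fixed_point:
  assumes wt: "mfg_weights L A p"
  obtains s where "\<And>l. l \<in> {1..L} \<Longrightarrow> 0 \<le> s l"
    "\<And>l. l \<in> {1..L} \<Longrightarrow> (\<Sum>l'=1..L. A l' * p l l' * mean (drift (s l'))) = s l"
proof -
  define c where "c l l' = A l' * p l l'" for l l'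
  have c: "0 \<le> c l l'" if "l \<in> {1..L}" "l' \<in> {1..L}" for l l'
    using wt that by (auto simp: c_def mfg_weights_def less_imp_le)
  \<comment> \<open>Coordinates of the cube count from 0 and populations from 1, hence
    \<open>l' - 1\<close> here and \<open>i + 1\<close> in \<open>F\<close>.\<close>
  define T where "T x l = (\<Sum>l'=1..L. c l l' * (Z * x (l' - 1)))" for x :: "nat \<Rightarrow> real" and l
  define F where "F i x = mean (drift (T x (i + 1))) / Z" for i x
  have T: "T x l \<in> {0..(\<Sum>l'=1..L. c l l') * Z}" if l: "l \<in> {1..L}" and x: "\<forall>j<L. x j \<in> {0..1}" for x l
  proof -
    have "0 \<le> Z * x (l' - 1)" "Z * x (l' - 1) \<le> Z" if "l' \<in> {1..L}" for l'
      using x[rule_format, of "l' - 1"] that Z by (auto simp: mult_left_le)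
    then have "0 \<le> c l l' * (Z * x (l' - 1))" "c l l' * (Z * x (l' - 1)) \<le> c l l' * Z" if "l' \<in> {1..L}" for l'
      using c[OF l that] that by (simp_all add: mult_left_mono)
    then show ?thesis
      unfolding T_def atLeastAtMost_iff sum_distrib_right by (auto intro!: sum_nonneg sum_mono)
  qed
  obtain x where x: "\<And>i. i < L \<Longrightarrow> x i \<in> {0..1}" "\<And>i. i < L \<Longrightarrow> F i x = x i"
  proof (rule brouwer_unit_cube_nat[of L F])
    fix i x assume i: "i < L" and x: "\<forall>j<L. x j \<in> {0..1::real}"
    have "0 \<le> T x (i + 1)" using T[OF _ x, of "i + 1"] i by auto
    then show "F i x \<in> {0..1}"
      unfolding F_def using mean_bounds[OF continuous_on_drift] Z by auto
  next
    fix i X x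
    assume i: "i < L" and X: "\<forall>k. \<forall>j<L. X k j \<in> {0..1::real}" and x: "\<forall>j<L. x j \<in> {0..1}"
      and lim: "\<forall>j<L. (\<lambda>k. X k j) \<longlonglongrightarrow> x j"
    have l: "i + 1 \<in> {1..L}" using i by auto
    \<comment> \<open>An upper bound of the spillover over the whole cube, so one Lipschitz constant
      serves the sequence and its limit.\<close>
    let ?S = "(\<Sum>l'=1..L. c (i + 1) l') * Z"
    have S: "0 \<le> ?S" using T[OF l x] by auto
    obtain K where K: "\<And>s s'. s \<in> {0..?S} \<Longrightarrow> s' \<in> {0..?S} \<Longrightarrow> \<bar>mean (drift s) - mean (drift s')\<bar> \<le> K * \<bar>s - s'\<bar>"
      using mean_lipschitz[OF S] by blast
    have "(\<lambda>k. T (X k) (i + 1)) \<longlonglongrightarrow> T x (i + 1)"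
      unfolding T_def by (intro tendsto_intros) (use lim in auto)
    then have "(\<lambda>k. K * \<bar>T (X k) (i + 1) - T x (i + 1)\<bar>) \<longlonglongrightarrow> K * \<bar>T x (i + 1) - T x (i + 1)\<bar>"
      by (intro tendsto_intros)
    then have 0: "(\<lambda>k. K * \<bar>T (X k) (i + 1) - T x (i + 1)\<bar>) \<longlonglongrightarrow> 0" by simp
    have "norm (mean (drift (T (X k) (i + 1))) - mean (drift (T x (i + 1)))) \<le> K * \<bar>T (X k) (i + 1) - T x (i + 1)\<bar>" for k
      unfolding real_norm_def by (rule K[OF T[OF l spec[OF X]] T[OF l x]])
    then have "(\<lambda>k. mean (drift (T (X k) (i + 1))) - mean (drift (T x (i + 1)))) \<longlonglongrightarrow> 0"
      by (intro Lim_null_comparison[OF _ 0] always_eventually allI)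
    then have "(\<lambda>k. mean (drift (T (X k) (i + 1)))) \<longlonglongrightarrow> mean (drift (T x (i + 1)))"
      by (simp add: LIM_zero_iff)
    then show "(\<lambda>k. F i (X k)) \<longlonglongrightarrow> F i x" unfolding F_def by (intro tendsto_divide tendsto_const) (use Z in auto)
  qed blast
  show ?thesis
  proof (rule that[of "T x"])
    fix l assume l: "l \<in> {1..L}"
    have "\<forall>j<L. x j \<in> {0..1}" using x(1) by blast
    from T[OF l this] show "0 \<le> T x l" by simp
    have "mean (drift (T x l')) = Z * x (l' - 1)" if "l' \<in> {1..L}" for l'
    proof -
      have "l' - 1 < L" "l' - 1 + 1 = l'" using that by auto
      with x(2) have "mean (drift (T x l')) / Z = x (l' - 1)" unfolding F_def by metis
      then show ?thesis using Z by (simp add: divide_eq_eq mult.commute)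
    qed
    then show "(\<Sum>l'=1..L. A l' * p l l' * mean (drift (T x l'))) = T x l"
      unfolding T_def[of x l] c_def by (intro sum.cong) auto
  qed
qed

section \<open>Existence, and uniqueness for weak interaction\<close>

lemma mfg_existence:
  assumes "mfg_weights L A p"
  shows "\<exists>m V. mfg_solution L Z \<sigma> \<rho> w B \<alpha> \<gamma> A p m V \<and> (\<forall>l\<in>{1..L}. m l \<in> C2_C1 Z \<and> V l \<in> C2_C1 Z)"
proof -
  obtain s where s: "\<And>l. l \<in> {1..L} \<Longrightarrow> 0 \<le> s l"
    "\<And>l. l \<in> {1..L} \<Longrightarrow> (\<Sum>l'=1..L. A l' * p l l' * mean (drift (s l'))) = s l"
    using exists_fixed_point[OF assms] by blast
  show ?thesis
    using mfg_solutionI[OF s] C2_C1_stat_density[OF s(1)] C2_C1_classical[OF classical_sol[OF s(1)]] by blast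
qed

text \<open>Two solutions are compared through their moments: averaging over the populations shrinks
  the largest gap by \<epsilon>, and the map from spillover to moment stretches it by at most
  \<open>K\<close>. Equal spillovers then give equal solutions almost everywhere.\<close>

lemma mfg_uniqueness:
  assumes L: "1 \<le> L"
  shows "\<exists>\<epsilon>>0. \<forall>A p. mfg_weights L A p \<and> (\<forall>l\<in>{1..L}. (\<Sum>l'=1..L. A l' * p l l') < \<epsilon>) \<longrightarrow>
        (\<forall>m V m' V'.
          mfg_solution L Z \<sigma> \<rho> w B \<alpha> \<gamma> A p m V \<and> mfg_solution L Z \<sigma> \<rho> w B \<alpha> \<gamma> A p m' V' \<longrightarrow>
          (\<forall>l\<in>{1..L}. AE z in lebesgue_on (Omega Z). m l z = m' l z \<and> V l z = V' l z))"
proof -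
  obtain K where K: "K \<ge> 0"
    "\<And>s s'. s \<in> {0..Z} \<Longrightarrow> s' \<in> {0..Z} \<Longrightarrow> \<bar>mean (drift s) - mean (drift s')\<bar> \<le> K * \<bar>s - s'\<bar>"
    using mean_lipschitz[of Z] Z by auto
  \<comment> \<open>It satisfies \<open>K * \<epsilon> < 1\<close> for the contraction and
    \<open>\<epsilon> \<le> 1\<close>, which keeps all spillovers in \<open>{0..Z}\<close>, where
    \<open>K\<close> was chosen before \<open>A\<close> and \<open>p\<close>.\<close>
  define \<epsilon> where "\<epsilon> = 1 / (K + 1)"
  have \<epsilon>: "\<epsilon> > 0" "\<epsilon> \<le> 1" "K * \<epsilon> < 1" using K(1) by (auto simp: \<epsilon>_def)
  show ?thesis
  proof (intro exI[of _ \<epsilon>] conjI allI impI \<epsilon>(1))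
    fix A p m V m' V'
    assume *: "mfg_weights L A p \<and> (\<forall>l\<in>{1..L}. (\<Sum>l'=1..L. A l' * p l l') < \<epsilon>)"
      and "mfg_solution L Z \<sigma> \<rho> w B \<alpha> \<gamma> A p m V \<and> mfg_solution L Z \<sigma> \<rho> w B \<alpha> \<gamma> A p m' V'"
    then have wt: "mfg_weights L A p" and sol: "mfg_solution L Z \<sigma> \<rho> w B \<alpha> \<gamma> A p m V"
      and sol': "mfg_solution L Z \<sigma> \<rho> w B \<alpha> \<gamma> A p m' V'" by auto
    define c where "c l l' = A l' * p l l'" for l l'
    have c: "0 \<le> c l l'" if "l \<in> {1..L}" "l' \<in> {1..L}" for l l'
      using wt that by (auto simp: c_def mfg_weights_def less_imp_le)
    have csum: "(\<Sum>l'=1..L. c l l') \<le> \<epsilon>" if "l \<in> {1..L}" for l using * that by (auto simp: c_def less_imp_le)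
    define s s' where "s l = spillover L Z A p l m" and "s' l = spillover L Z A p l m'" for l
    define x x' where "x l = mean (drift (s l))" and "x' l = mean (drift (s' l))" for l
    have s: "s l = (\<Sum>l'=1..L. c l l' * x l')" "s' l = (\<Sum>l'=1..L. c l l' * x' l')" for l
      unfolding s_def[of l] s'_def[of l] spillover_def c_def x_def x'_def
      by (auto intro!: sum.cong simp: s_def s'_def mfg_solution_imp(3)[OF sol wt] mfg_solution_imp(3)[OF sol' wt])
    have s0: "0 \<le> s l" "0 \<le> s' l" if "l \<in> {1..L}" for l
      using mfg_solution_imp(1)[OF sol wt that] mfg_solution_imp(1)[OF sol' wt that] by (auto simp: s_def s'_def)
    have xZ: "x l \<le> Z" "x' l \<le> Z" if "l \<in> {1..L}" for l
      using mean_bounds(2)[OF continuous_on_drift] s0[OF that] by (auto simp: x_def x'_def)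
    have sZ: "(\<Sum>l'=1..L. c l l' * y l') \<le> \<epsilon> * M" if "l \<in> {1..L}" "\<And>l'. l' \<in> {1..L} \<Longrightarrow> y l' \<le> M" "0 \<le> M" for l y M
    proof -
      have "(\<Sum>l'=1..L. c l l' * y l') \<le> (\<Sum>l'=1..L. c l l' * M)"
        using c that by (intro sum_mono mult_left_mono) auto
      also have "\<dots> = (\<Sum>l'=1..L. c l l') * M" by (simp add: sum_distrib_right)
      also have "\<dots> \<le> \<epsilon> * M" using csum that by (intro mult_right_mono) auto
      finally show ?thesis .
    qed
    have sI: "s l \<in> {0..Z}" "s' l \<in> {0..Z}" if "l \<in> {1..L}" for l
    proof -
      have e: "\<epsilon> * Z \<le> Z" using \<epsilon> Z by simp
      have "s l \<le> \<epsilon> * Z" unfolding s by (rule sZ[OF that]) (use xZ Z in auto)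
      from order_trans[OF this e] show "s l \<in> {0..Z}" using s0[OF that] by simp
      have "s' l \<le> \<epsilon> * Z" unfolding s by (rule sZ[OF that]) (use xZ Z in auto)
      from order_trans[OF this e] show "s' l \<in> {0..Z}" using s0[OF that] by simp
    qed
    define M where "M = Max ((\<lambda>l. \<bar>x l - x' l\<bar>) ` {1..L})"
    have "M \<in> (\<lambda>l. \<bar>x l - x' l\<bar>) ` {1..L}" unfolding M_def using L by (intro Max_in) auto
    then obtain k where k: "k \<in> {1..L}" "M = \<bar>x k - x' k\<bar>" by auto
    have leM: "\<bar>x l - x' l\<bar> \<le> M" if "l \<in> {1..L}" for l unfolding M_def using that by (intro Max_ge) auto
    have M0: "0 \<le> M" using k by simp
    have ds: "\<bar>s l - s' l\<bar> \<le> \<epsilon> * M" if l: "l \<in> {1..L}" for l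
    proof -
      have "s l - s' l = (\<Sum>l'=1..L. c l l' * (x l' - x' l'))" by (simp add: s right_diff_distrib sum_subtractf)
      also have "\<bar>\<dots>\<bar> \<le> (\<Sum>l'=1..L. \<bar>c l l' * (x l' - x' l')\<bar>)" by (rule sum_abs)
      also have "\<dots> = (\<Sum>l'=1..L. c l l' * \<bar>x l' - x' l'\<bar>)" using c[OF l] by (intro sum.cong) (auto simp: abs_mult)
      also have "\<dots> \<le> \<epsilon> * M" using leM M0 by (intro sZ[OF l]) auto
      finally show ?thesis .
    qed
    \<comment> \<open>At the population \<open>k\<close> with the largest gap this gives M \<le> K
      \<epsilon> M, hence M = 0.\<close>
    have "M \<le> K * \<bar>s k - s' k\<bar>" unfolding k(2) x_def x'_def using sI[OF k(1)] by (intro K(2))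
    also have "\<dots> \<le> K * (\<epsilon> * M)" using ds[OF k(1)] K(1) by (intro mult_left_mono)
    finally have "(1 - K * \<epsilon>) * M \<le> 0" by (simp add: algebra_simps)
    then have "M = 0" using \<epsilon>(3) M0 by (simp add: mult_le_0_iff)
    then have eq: "s l = s' l" if "l \<in> {1..L}" for l using ds[OF that] by simp
    show "\<forall>l\<in>{1..L}. AE z in lebesgue_on (Omega Z). m l z = m' l z \<and> V l z = V' l z"
    proof
      fix l assume l: "l \<in> {1..L}"
      show "AE z in lebesgue_on (Omega Z). m l z = m' l z \<and> V l z = V' l z"
        using mfg_solution_imp(2)[OF sol wt l] mfg_solution_imp(2)[OF sol' wt l] eq[OF l]
        unfolding s_def s'_def by (auto elim!: eventually_elim2)
    qed
  qed
qed

end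

theorem theorem3p3:
  fixes L :: nat and zb \<sigma> \<rho> w B \<alpha> \<gamma> :: real
  assumes "L \<ge> 1" and "zb > 0" and "\<sigma> > 0" and "\<rho> > 0" and "w > 0" and "B > 0"
    and "0 < \<alpha>" and "\<alpha> < 1" and "0 < \<gamma>" and "\<gamma> < 1"
  shows
    "(\<forall>A p. mfg_weights L A p \<longrightarrow>
        (\<exists>m V. mfg_solution L zb \<sigma> \<rho> w B \<alpha> \<gamma> A p m V \<and>
          (\<forall>l\<in>{1..L}. m l \<in> C2_C1 zb \<and> V l \<in> C2_C1 zb))) \<and>
     (\<exists>\<epsilon>>0. \<forall>A p. mfg_weights L A p \<and> (\<forall>l\<in>{1..L}. (\<Sum>l'=1..L. A l' * p l l') < \<epsilon>) \<longrightarrow>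
        (\<forall>m V m' V'.
          mfg_solution L zb \<sigma> \<rho> w B \<alpha> \<gamma> A p m V \<and> mfg_solution L zb \<sigma> \<rho> w B \<alpha> \<gamma> A p m' V' \<longrightarrow>
          (\<forall>l\<in>{1..L}. AE z in lebesgue_on (Omega zb). m l z = m' l z \<and> V l z = V' l z)))"
proof -
  interpret hjb zb \<sigma> \<rho> w B \<alpha> \<gamma> by unfold_locales (use assms in auto)
  show ?thesis using mfg_existence mfg_uniqueness[OF assms(1)] by blast
qed

end
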